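(* Let $G$ be a finitely generated group that is hyperbolic relative to a collection $\Omega$ of (peripheral) subgroups, and assume $G$ is non-elementary. Let $S\subset G$ be a finite set generating $G$, let $\{H_1,\dots,H_r\}\subset\Omega$ be a complete set of representatives of the conjugacy classes in $\Omega$, and let $\ell$ be the word length on $G$ determined by the generating set $S\cup\bigcup_{1\le i\le r}H_i$. Let $\mu$ be an admissible probability measure on $G$, and let $(Y_n)_{n\ge 0}$ be the right random walk on $G$ issued from the identity with increments distributed according to $\mu$. Then the sequence of random variables $\bigl(\frac1n\ell(Y_n)\bigr)_{n\ge 1}$ satisfies the weak large deviation principle (on the space $\mathbb{R}_{\ge 0}$) with a convex rate function $I\colon\mathbb{R}_{\ge 0}\to[0,\infty]$.
   Context: **Groups.** $G$ is non-elementary if it contains no cyclic subgroup of finite index. $e$ denotes the identity. The collection $\Omega$ of subgroups of $G$ is closed under conjugation by elements of $G$ and has finitely many conjugacy classes; $\{H_1,\dots,H_r\}$ contains one representative of each class. The word length is $\ell(e)=0$ and, for $g\ne e$, $\ell(g)=\inf\{n\ge 1:\ g=x_1\cdots x_n \text{ for some } x_1,\dots,x_n\in S\cup S^{-1}\cup\bigcup_{i}H_i\}$. **Relative hyperbolicity.** Let $\mathrm{Cay}(G,S)$ be the Cayley graph with respect to $S$, with graph distance $d'$, and let $\mathrm{Cay}(G,S\cup\bigcup_i H_i)$ be the Cayley graph with respect to $S\cup\bigcup_i H_i$, with graph distance $d$. Let $\Gamma$ be the geodesic metric space obtained from the latter by identifying every edge with the unit interval. $G$ is weakly relatively hyperbolic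 with respect to $\Omega$ if $\Gamma$ is a Gromov-hyperbolic metric space (this is independent of the choices of $S$ and of the $H_i$). A path is a finite sequence $(\gamma_1,\dots,\gamma_n)$ of successively adjacent vertices of $\mathrm{Cay}(G,S\cup\bigcup_i H_i)$. For $\lambda,c>0$ it is a relative $(\lambda,c)$-quasi geodesic path if $\lambda^{-1}|k-l|-c\le d(\gamma_k,\gamma_l)\le\lambda|k-l|+c$ for all $k,l\in\{1,\dots,n\}$. A path enters the left coset $gH_i$ if it has a vertex in $gH_i$ followed by an edge corresponding to an element of $H_i$. For such a path, a maximal subpath consisting of vertices in $gH_i$ and with edges labelled by elements of $H_i$ is called an $H_i$-component; its first and last vertices are the entering point and the exit point, and the path leaves $gH_i$ at the exit point. The path travels more than $R$ in $gH_i$ if the $d'$-distance between entering and exit point is larger than $R$. A path is without backtracking if it never goes back to a coset $gH_i$ once it has left it. The pair $(G,\Omega)$ satisfies the Bounded Coset Penetration property if for all $\lambda,c>0$ there is a constant $C_{\lambda,c}$ such that for every pair $(\alpha_1,\alpha_2)$ of relative $(\lambda,c)$-quasi geodesic paths without backtracking and with common end points: (1) if $\alpha_1$ travels more than $C_{\lambda,c}$ in a coset $gH_i$, then $\alpha_2$ enters $gH_i$; (2) if $\alpha_1$ and $\alpha_2$ enter the same coset $gH_i$, the two entering points and the two exit points are $C_{\lambda,c}$-close to each other in $\mathrm{Cay}(G,S)$. $G$ is hyperbolic relative to $\Omega$ if it is weakly relatively hyperbolic with respect to $\Omega$ and $(G,\Omega)$ satisfies the Bounded Coset Penetration property. **Random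 walk.** $G$ is viewed as a discrete group; a probability measure is a function $\mu\colon G\to[0,1]$ with $\sum_{g}\mu(g)=1$. Let $(X_i)_{i\ge 1}$ be independent $G$-valued random variables with law $\mu$; the right random walk issued from the identity is $Y_0=e$, $Y_n=X_1\cdots X_n$ for $n\ge1$. $\mu$ is admissible if for every $g\in G$ there is $n\ge 1$ with $\mathbb{P}(Y_n=g)>0$; equivalently, $\{g\in G:\mu(g)>0\}$ generates $G$ as a semigroup. No moment assumption is made on $\mu$. **Large deviations.** Let $X$ be a Hausdorff regular topological space, $I\colon X\to[0,\infty]$ a lower semicontinuous function (rate function), and $(\mu_n)_{n\ge1}$ Borel probability measures on $X$. The sequence satisfies the weak large deviation principle with rate function $I$ if for every Borel set $\Lambda\subset X$ with compact closure $$-\inf_{x\in\Lambda^\circ}I(x)\le\liminf_{n\to\infty}\tfrac1n\log\mu_n(\Lambda)\le\limsup_{n\to\infty}\tfrac1n\log\mu_n(\Lambda)\le-\inf_{x\in\overline\Lambda}I(x),$$ where $\Lambda^\circ$ and $\overline\Lambda$ are the interior and closure of $\Lambda$ (conventions: $\log 0=-\infty$, $\inf\emptyset=\infty$). A sequence of random variables satisfies the principle if the sequence of their laws does. *)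

theory Defs
  imports "HOL-Probability.Probability" "HOL-Algebra.Elementary_Groups"
begin

section \<open>Groups and peripheral subgroups\<close>

definition non_elementary :: "('a, 'b) monoid_scheme \<Rightarrow> bool" where
  "non_elementary G \<longleftrightarrow>
     \<not> (\<exists>K. subgroup K G \<and> cyclic_group (G\<lparr>carrier := K\<rparr>) \<and> finite (rcosets\<^bsub>G\<^esub> K))"

definition finite_generating_set :: "('a, 'b) monoid_scheme \<Rightarrow> 'a set \<Rightarrow> bool" where
  "finite_generating_set G S \<longleftrightarrow> finite S \<and> S \<subseteq> carrier G \<and> generate G S = carrier G"

definition conjugacy_class :: "('a, 'b) monoid_scheme \<Rightarrow> 'a set \<Rightarrow> 'a set set" where
  "conjugacy_class G H = {g <#\<^bsub>G\<^esub> (H #>\<^bsub>G\<^esub> inv\<^bsub>G\<^esub> g) | g. g \<in> carrier G}"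

definition peripheral_collection :: "('a, 'b) monoid_scheme \<Rightarrow> 'a set set \<Rightarrow> bool" where
  "peripheral_collection G \<Omega> \<longleftrightarrow>
     (\<forall>H\<in>\<Omega>. subgroup H G) \<and>
     (\<forall>H\<in>\<Omega>. conjugacy_class G H \<subseteq> \<Omega>) \<and>
     finite (conjugacy_class G ` \<Omega>)"

definition class_representatives ::
    "('a, 'b) monoid_scheme \<Rightarrow> 'a set set \<Rightarrow> 'a set set \<Rightarrow> bool" where
  "class_representatives G \<Omega> Hs \<longleftrightarrow>
     Hs \<subseteq> \<Omega> \<and> (\<forall>K\<in>\<Omega>. \<exists>!H. H \<in> Hs \<and> K \<in> conjugacy_class G H)"

definition word_length ::
    "('a, 'b) monoid_scheme \<Rightarrow> 'a set \<Rightarrow> 'a set set \<Rightarrow> 'a \<Rightarrow> nat" where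
  "word_length G S Hs g =
     (if g = \<one>\<^bsub>G\<^esub> then 0
      else Inf {n. n \<ge> 1 \<and> (\<exists>xs. length xs = n \<and>
                 set xs \<subseteq> S \<union> (\<lambda>s. inv\<^bsub>G\<^esub> s) ` S \<union> \<Union>Hs \<and>
                 g = foldr (\<lambda>x y. x \<otimes>\<^bsub>G\<^esub> y) xs \<one>\<^bsub>G\<^esub>)})"


section \<open>Graphs\<close>

text \<open>Cayley graphs are simple: adjacent vertices are distinct, even when the unit
  belongs to \<open>T\<close> (as it does as soon as \<open>T\<close> contains a subgroup).\<close>

definition cayley_adj :: "('a, 'b) monoid_scheme \<Rightarrow> 'a set \<Rightarrow> 'a \<Rightarrow> 'a \<Rightarrow> bool" where
  "cayley_adj G T x y \<longleftrightarrow>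
     x \<in> carrier G \<and> y \<in> carrier G \<and> x \<noteq> y \<and>
     (inv\<^bsub>G\<^esub> x \<otimes>\<^bsub>G\<^esub> y \<in> T \<or> inv\<^bsub>G\<^esub> y \<otimes>\<^bsub>G\<^esub> x \<in> T)"

text \<open>Length of a shortest path; meaningful when \<open>x\<close> and \<open>y\<close> are connected.\<close>

definition graph_dist :: "('a \<Rightarrow> 'a \<Rightarrow> bool) \<Rightarrow> 'a \<Rightarrow> 'a \<Rightarrow> nat" where
  "graph_dist adj x y = (LEAST n. (adj ^^ n) x y)"

text \<open>The geometric realization of a simple graph with vertex set \<open>V\<close>: a point is given by its
  barycentric coordinates, so that \<open>p\<close> on the edge \<open>{x, y}\<close> corresponds to the
  point of the unit interval at distance \<open>p y = 1 - p x\<close> from the end \<open>x\<close>.\<close>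

definition bary_support :: "('a \<Rightarrow> real) \<Rightarrow> 'a set" where
  "bary_support p = {v. p v \<noteq> 0}"

definition graph_simplices :: "'a set \<Rightarrow> ('a \<Rightarrow> 'a \<Rightarrow> bool) \<Rightarrow> 'a set set" where
  "graph_simplices V adj = {{x} | x. x \<in> V} \<union> {{x, y} | x y. x \<in> V \<and> y \<in> V \<and> adj x y}"

definition graph_points :: "'a set \<Rightarrow> ('a \<Rightarrow> 'a \<Rightarrow> bool) \<Rightarrow> ('a \<Rightarrow> real) set" where
  "graph_points V adj =
     {p. (\<forall>v. 0 \<le> p v) \<and> bary_support p \<in> graph_simplices V adj \<and> sum p (bary_support p) = 1}"

text \<open>The path metric. Within a closed edge it is the metric of the unit interval,
  which is half the \<open>l\<^sup>1\<close>-distance of the coordinates; otherwise a shortest path from \<open>p\<close> to \<open>q\<close>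
  leaves the edge of \<open>p\<close> at one of its ends \<open>x\<close>, at distance \<open>1 - p x\<close> from \<open>p\<close>, and reaches
  the edge of \<open>q\<close> at one of its ends \<open>y\<close>.\<close>

definition realization_dist ::
    "'a set \<Rightarrow> ('a \<Rightarrow> 'a \<Rightarrow> bool) \<Rightarrow> ('a \<Rightarrow> real) \<Rightarrow> ('a \<Rightarrow> real) \<Rightarrow> real" where
  "realization_dist V adj p q =
     (if bary_support p \<union> bary_support q \<in> graph_simplices V adj
      then (\<Sum>v\<in>bary_support p \<union> bary_support q. \<bar>p v - q v\<bar>) / 2
      else Min ((\<lambda>(x, y). (1 - p x) + real (graph_dist adj x y) + (1 - q y)) `
                (bary_support p \<times> bary_support q)))"


section \<open>Relative hyperbolicity\<close>

definition gromov_product :: "('c \<Rightarrow> 'c \<Rightarrow> real) \<Rightarrow> 'c \<Rightarrow> 'c \<Rightarrow> 'c \<Rightarrow> real" where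
  "gromov_product d w x y = (d x w + d y w - d x y) / 2"

definition gromov_hyperbolic :: "'c set \<Rightarrow> ('c \<Rightarrow> 'c \<Rightarrow> real) \<Rightarrow> bool" where
  "gromov_hyperbolic M d \<longleftrightarrow>
     (\<exists>\<delta>\<ge>0. \<forall>w\<in>M. \<forall>x\<in>M. \<forall>y\<in>M. \<forall>z\<in>M.
        min (gromov_product d w x y) (gromov_product d w y z) - \<delta> \<le> gromov_product d w x z)"

abbreviation rel_adj :: "('a, 'b) monoid_scheme \<Rightarrow> 'a set \<Rightarrow> 'a set set \<Rightarrow> 'a \<Rightarrow> 'a \<Rightarrow> bool" where
  "rel_adj G S Hs \<equiv> cayley_adj G (S \<union> \<Union>Hs)"

definition weakly_relatively_hyperbolic ::
    "('a, 'b) monoid_scheme \<Rightarrow> 'a set \<Rightarrow> 'a set set \<Rightarrow> bool" where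
  "weakly_relatively_hyperbolic G S Hs \<longleftrightarrow>
     gromov_hyperbolic (graph_points (carrier G) (rel_adj G S Hs))
       (realization_dist (carrier G) (rel_adj G S Hs))"

definition rel_path :: "('a, 'b) monoid_scheme \<Rightarrow> 'a set \<Rightarrow> 'a set set \<Rightarrow> 'a list \<Rightarrow> bool" where
  "rel_path G S Hs p \<longleftrightarrow>
     p \<noteq> [] \<and> set p \<subseteq> carrier G \<and> successively (rel_adj G S Hs) p"

definition rel_quasi_geodesic ::
    "('a, 'b) monoid_scheme \<Rightarrow> 'a set \<Rightarrow> 'a set set \<Rightarrow> real \<Rightarrow> real \<Rightarrow> 'a list \<Rightarrow> bool" where
  "rel_quasi_geodesic G S Hs lam c p \<longleftrightarrow>
     rel_path G S Hs p \<and>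
     (\<forall>k<length p. \<forall>l<length p.
        inverse lam * \<bar>real k - real l\<bar> - c \<le> real (graph_dist (rel_adj G S Hs) (p ! k) (p ! l)) \<and>
        real (graph_dist (rel_adj G S Hs) (p ! k) (p ! l)) \<le> lam * \<bar>real k - real l\<bar> + c)"

text \<open>The \<open>k\<close>-th edge of \<open>p\<close> starts in \<open>g H\<close> and is labelled by an element of \<open>H\<close>.\<close>

definition edge_in_coset ::
    "('a, 'b) monoid_scheme \<Rightarrow> 'a \<Rightarrow> 'a set \<Rightarrow> 'a list \<Rightarrow> nat \<Rightarrow> bool" where
  "edge_in_coset G g H p k \<longleftrightarrow>
     Suc k < length p \<and> p ! k \<in> g <#\<^bsub>G\<^esub> H \<and> inv\<^bsub>G\<^esub> (p ! k) \<otimes>\<^bsub>G\<^esub> p ! Suc k \<in> H"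

definition enters_coset ::
    "('a, 'b) monoid_scheme \<Rightarrow> 'a \<Rightarrow> 'a set \<Rightarrow> 'a list \<Rightarrow> bool" where
  "enters_coset G g H p \<longleftrightarrow> (\<exists>k. edge_in_coset G g H p k)"

text \<open>The vertices \<open>p ! a, \<dots>, p ! b\<close> form an \<open>H\<close>-component of \<open>p\<close> in \<open>g H\<close>, with entering point
  \<open>p ! a\<close> and exit point \<open>p ! b\<close>. A component contains at least one edge.\<close>

definition coset_component ::
    "('a, 'b) monoid_scheme \<Rightarrow> 'a \<Rightarrow> 'a set \<Rightarrow> 'a list \<Rightarrow> nat \<Rightarrow> nat \<Rightarrow> bool" where
  "coset_component G g H p a b \<longleftrightarrow>
     a < b \<and> (\<forall>k\<in>{a..<b}. edge_in_coset G g H p k) \<and>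
     (a = 0 \<or> \<not> edge_in_coset G g H p (a - 1)) \<and> \<not> edge_in_coset G g H p b"

definition without_backtracking ::
    "('a, 'b) monoid_scheme \<Rightarrow> 'a set set \<Rightarrow> 'a list \<Rightarrow> bool" where
  "without_backtracking G Hs p \<longleftrightarrow>
     (\<forall>g\<in>carrier G. \<forall>H\<in>Hs. \<forall>a b. coset_component G g H p a b \<longrightarrow>
        (\<forall>k. b < k \<and> k < length p \<longrightarrow> p ! k \<notin> g <#\<^bsub>G\<^esub> H))"

definition bounded_coset_penetration ::
    "('a, 'b) monoid_scheme \<Rightarrow> 'a set \<Rightarrow> 'a set set \<Rightarrow> bool" where
  "bounded_coset_penetration G S Hs \<longleftrightarrow>
     (\<forall>lam>0. \<forall>c>0. \<exists>C::real. \<forall>p q.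
        rel_quasi_geodesic G S Hs lam c p \<and> without_backtracking G Hs p \<and>
        rel_quasi_geodesic G S Hs lam c q \<and> without_backtracking G Hs q \<and>
        hd p = hd q \<and> last p = last q \<longrightarrow>
        (\<forall>g\<in>carrier G. \<forall>H\<in>Hs.
           (\<forall>a b. coset_component G g H p a b \<and>
                  real (graph_dist (cayley_adj G S) (p ! a) (p ! b)) > C \<longrightarrow>
                  enters_coset G g H q) \<and>
           (\<forall>a b a' b'. coset_component G g H p a b \<and> coset_component G g H q a' b' \<longrightarrow>
                  real (graph_dist (cayley_adj G S) (p ! a) (q ! a')) \<le> C \<and>
                  real (graph_dist (cayley_adj G S) (p ! b) (q ! b')) \<le> C)))"

text \<open>The notion belongs to the pair formed by \<open>G\<close> and its peripheral collection \<open>\<Omega>\<close>; the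
  finite generating set \<open>S\<close> and the set \<open>Hs\<close> of representatives enter through the
  graphs used to define it.\<close>

definition relatively_hyperbolic ::
    "('a, 'b) monoid_scheme \<Rightarrow> 'a set set \<Rightarrow> 'a set \<Rightarrow> 'a set set \<Rightarrow> bool" where
  "relatively_hyperbolic G \<Omega> S Hs \<longleftrightarrow>
     peripheral_collection G \<Omega> \<and> class_representatives G \<Omega> Hs \<and> finite_generating_set G S \<and>
     weakly_relatively_hyperbolic G S Hs \<and> bounded_coset_penetration G S Hs"


section \<open>Random walks\<close>

definition iid_increments ::
    "('a, 'b) monoid_scheme \<Rightarrow> 'w measure \<Rightarrow> 'a pmf \<Rightarrow> (nat \<Rightarrow> 'w \<Rightarrow> 'a) \<Rightarrow> bool" where
  "iid_increments G M \<mu> X \<longleftrightarrow>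
     prob_space M \<and>
     prob_space.indep_vars M (\<lambda>_. count_space (carrier G)) X {1..} \<and>
     (\<forall>i\<ge>1. \<forall>g\<in>carrier G. measure M {w \<in> space M. X i w = g} = pmf \<mu> g)"

primrec right_walk :: "('a, 'b) monoid_scheme \<Rightarrow> (nat \<Rightarrow> 'w \<Rightarrow> 'a) \<Rightarrow> nat \<Rightarrow> 'w \<Rightarrow> 'a" where
  "right_walk G X 0 w = \<one>\<^bsub>G\<^esub>"
| "right_walk G X (Suc n) w = right_walk G X n w \<otimes>\<^bsub>G\<^esub> X (Suc n) w"

text \<open>Admissibility of the common law of the increments \<open>X\<close>.\<close>

definition admissible_increments ::
    "('a, 'b) monoid_scheme \<Rightarrow> 'w measure \<Rightarrow> (nat \<Rightarrow> 'w \<Rightarrow> 'a) \<Rightarrow> bool" where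
  "admissible_increments G M X \<longleftrightarrow>
     (\<forall>g\<in>carrier G. \<exists>n\<ge>1. measure M {w \<in> space M. right_walk G X n w = g} > 0)"


section \<open>Large deviations\<close>

definition borel_of_topology :: "'c topology \<Rightarrow> 'c measure" where
  "borel_of_topology T = sigma (topspace T) {U. openin T U}"

definition rate_function :: "'c topology \<Rightarrow> ('c \<Rightarrow> ennreal) \<Rightarrow> bool" where
  "rate_function T I \<longleftrightarrow> (\<forall>a. closedin T {x \<in> topspace T. I x \<le> a})"

definition log_prob :: "real \<Rightarrow> ereal" where
  "log_prob p = (if p = 0 then - \<infinity> else ereal (ln p))"

definition weak_LDP :: "'c topology \<Rightarrow> (nat \<Rightarrow> 'c measure) \<Rightarrow> ('c \<Rightarrow> ennreal) \<Rightarrow> bool" where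
  "weak_LDP T \<nu> I \<longleftrightarrow>
     rate_function T I \<and>
     (\<forall>n\<ge>1. prob_space (\<nu> n) \<and> sets (\<nu> n) = sets (borel_of_topology T)) \<and>
     (\<forall>\<Lambda>\<in>sets (borel_of_topology T). compactin T (T closure_of \<Lambda>) \<longrightarrow>
        - (INF x\<in>T interior_of \<Lambda>. enn2ereal (I x))
          \<le> liminf (\<lambda>n. ereal (1 / real n) * log_prob (measure (\<nu> n) \<Lambda>)) \<and>
        limsup (\<lambda>n. ereal (1 / real n) * log_prob (measure (\<nu> n) \<Lambda>))
          \<le> - (INF x\<in>T closure_of \<Lambda>. enn2ereal (I x)))"

definition weak_LDP_variables ::
    "'c topology \<Rightarrow> 'w measure \<Rightarrow> (nat \<Rightarrow> 'w \<Rightarrow> 'c) \<Rightarrow> ('c \<Rightarrow> ennreal) \<Rightarrow> bool" where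
  "weak_LDP_variables T M Z I \<longleftrightarrow>
     (\<forall>n\<ge>1. Z n \<in> measurable M (borel_of_topology T)) \<and>
     weak_LDP T (\<lambda>n. distr M (borel_of_topology T) (Z n)) I"

text \<open>In \<open>ennreal\<close>, \<open>0 * \<infinity> = 0\<close>, so the end points \<open>t = 0\<close> and \<open>t = 1\<close> impose nothing.\<close>

definition convex_ennreal_on :: "real set \<Rightarrow> (real \<Rightarrow> ennreal) \<Rightarrow> bool" where
  "convex_ennreal_on D I \<longleftrightarrow>
     convex D \<and>
     (\<forall>x\<in>D. \<forall>y\<in>D. \<forall>t\<in>{0..1}.
        I ((1 - t) * x + t * y) \<le> ennreal (1 - t) * I x + ennreal t * I y)"

end

theory Submission
  imports Defs
begin

text \<open>
  The key fact is a gluing property: there are a finite set \<open>F\<close> and a constant \<open>C\<close> such that all \<open>g\<close>, \<open>h\<close>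
  admit \<open>f \<in> F\<close> with \<open>\<ell>(g) + \<ell>(h) \<le> \<ell>(g f h) + C\<close>. By hyperbolicity it is enough to find \<open>F\<close> such that
  every \<open>h\<close> has a bounded Gromov product, based at the unit, with \<open>f h\<close> for some \<open>f \<in> F\<close>. Otherwise
  there are points \<open>h\<close> which look almost fixed by arbitrarily large finite subsets of \<open>G\<close>. On such a
  subset \<open>f \<mapsto> \<ell>(f h) - \<ell>(h)\<close> is a quasi-morphism, and elements of small value move the middle part of a geodesic
  from the unit to \<open>h\<close> by a bounded distance. Bounded coset penetration bounds the number of such elements, so \<open>G\<close> would
  be virtually cyclic.

  Since the elements of \<open>F\<close> are reached by the walk with positive probability, the probabilities of
  \<open>{\<ell>(Y\<^sub>n) \<in> [a, b]}\<close> are super-multiplicative up to constants and bounded shifts of \<open>n\<close>, \<open>a\<close> and \<open>b\<close>. The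
  Ruelle-Lanford subadditivity argument then yields the weak large deviation principle and convexity.
\<close>

section \<open>Cayley graphs\<close>

text \<open>Relative balls are infinite once a peripheral subgroup is infinite, so a bound on
  relative displacement leaves infinitely many candidates. Counting becomes possible when closeness
  is transferred to the locally finite graph of \<open>S\<close>. Bounded coset penetration does
  this for quasi-geodesics with the same two end points, whereas a geodesic and its translate need
  not share any. Therefore paths are spliced, and two such geodesics are compared through a third
  one sharing an end with each. The point \<open>h\<close> of the contradiction depends on the
  finite set that looks almost fixed, and no limit point at infinity is taken. The number of
  elements of small value must thus be bounded independently of that set and of \<open>h\<close>;
  all finite sets can then be fixed before \<open>h\<close>. Non-elementarity enters as an unlimited
  supply of cosets of every cyclic subgroup. In the probabilistic part the rate is defined through
  lower bounds valid at all large times. Super-multiplicativity upgrades infinitely many times to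
  all large times, so failure of such a bound at a point gives an upper bound at all large times
  nearby, and finite covers extend it to compact sets.\<close>

locale cayley_graph = group G for G (structure) +
  fixes T :: "'a set"
  assumes T_subset: "T \<subseteq> carrier G" and T_generates: "generate G T = carrier G"
begin

abbreviation adj :: "'a \<Rightarrow> 'a \<Rightarrow> bool" where
  "adj \<equiv> cayley_adj G T"

definition d :: "'a \<Rightarrow> 'a \<Rightarrow> nat" where
  "d x y = graph_dist adj x y"

lemma adj_carrier: "adj x y \<Longrightarrow> x \<in> carrier G \<and> y \<in> carrier G"
  by (auto simp: cayley_adj_def)

lemma adj_sym: "adj x y \<Longrightarrow> adj y x"
  by (auto simp: cayley_adj_def)

lemma inv_mult_translate:
  assumes "x \<in> carrier G" "y \<in> carrier G" "z \<in> carrier G"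
  shows "inv (z \<otimes> x) \<otimes> (z \<otimes> y) = inv x \<otimes> y"
proof -
  have "inv (z \<otimes> x) \<otimes> (z \<otimes> y) = inv x \<otimes> ((inv z \<otimes> z) \<otimes> y)"
    using assms by (simp only: inv_mult_group m_assoc inv_closed m_closed)
  then show ?thesis using assms by simp
qed

lemma adj_translate:
  assumes "adj x y" "z \<in> carrier G"
  shows "adj (z \<otimes> x) (z \<otimes> y)"
  using assms by (auto simp: cayley_adj_def inv_mult_translate)

lemma relpowp_adj_translate:
  assumes "(adj ^^ n) x y" "z \<in> carrier G"
  shows "(adj ^^ n) (z \<otimes> x) (z \<otimes> y)"
  using assms(1)
proof (induction n arbitrary: y)
  case (Suc n)
  then obtain w where "(adj ^^ n) x w" "adj w y" by (blast elim: relpowp_Suc_E)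
  then show ?case using Suc.IH adj_translate[OF _ assms(2)] by (blast intro: relpowp_Suc_I)
qed simp

lemma relpowp_adj_sym: "(adj ^^ n) x y \<Longrightarrow> (adj ^^ n) y x"
proof (induction n arbitrary: y)
  case (Suc n)
  then obtain w where "(adj ^^ n) x w" "adj w y" by (blast elim: relpowp_Suc_E)
  then show ?case using Suc.IH adj_sym by (blast intro: relpowp_Suc_I2)
qed simp

lemma adj_one_gen:
  assumes "h \<in> T" shows "\<exists>n. (adj ^^ n) \<one> h"
proof (cases "h = \<one>")
  case True then show ?thesis by (intro exI[of _ 0]) simp
next
  case False
  then have "adj \<one> h" using assms T_subset by (auto simp: cayley_adj_def)
  then have "(adj ^^ 1) \<one> h" by (simp only: relpowp_1)
  then show ?thesis by blast
qed

lemma connected_one: "g \<in> generate G T \<Longrightarrow> \<exists>n. (adj ^^ n) \<one> g"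
proof (induction rule: generate.induct)
  case one then show ?case by (intro exI[of _ 0]) simp
next
  case (incl h) then show ?case by (rule adj_one_gen)
next
  case (inv h)
  then obtain n where "(adj ^^ n) \<one> h" using adj_one_gen by blast
  moreover have "h \<in> carrier G" using inv T_subset by auto
  ultimately have "(adj ^^ n) (inv h) \<one>"
    using relpowp_adj_translate[of n \<one> h "inv h"] by simp
  then show ?case using relpowp_adj_sym by blast
next
  case (eng h1 h2)
  then obtain n m where nm: "(adj ^^ n) \<one> h1" "(adj ^^ m) \<one> h2" by blast
  have "h1 \<in> carrier G" using eng T_generates by simp
  then have "(adj ^^ m) h1 (h1 \<otimes> h2)" using relpowp_adj_translate[OF nm(2)] by force
  then show ?case using relpowp_trans[OF nm(1)] by blast
qed

lemma connected:
  assumes "x \<in> carrier G" "y \<in> carrier G" shows "\<exists>n. (adj ^^ n) x y"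
proof -
  have "inv x \<otimes> y \<in> generate G T" using assms T_generates by simp
  then obtain n where "(adj ^^ n) \<one> (inv x \<otimes> y)" using connected_one by blast
  then have "(adj ^^ n) (x \<otimes> \<one>) (x \<otimes> (inv x \<otimes> y))"
    using relpowp_adj_translate assms by blast
  then show ?thesis using assms by (auto simp flip: m_assoc)
qed

lemma d_le: "(adj ^^ n) x y \<Longrightarrow> d x y \<le> n"
  unfolding d_def graph_dist_def by (rule Least_le)

lemma relpowp_d:
  assumes "x \<in> carrier G" "y \<in> carrier G" shows "(adj ^^ d x y) x y"
  using connected[OF assms] unfolding d_def graph_dist_def by (metis LeastI)

lemma d_self [simp]: "d x x = 0"
  using d_le[of 0 x x] by simp

lemma d_eq_0:
  assumes "x \<in> carrier G" "y \<in> carrier G" "d x y = 0" shows "x = y"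
  using relpowp_d[OF assms(1,2)] assms(3) by simp

lemma d_sym:
  assumes "x \<in> carrier G" "y \<in> carrier G" shows "d x y = d y x"
  using d_le[OF relpowp_adj_sym[OF relpowp_d]] assms by (intro antisym)

lemma d_triangle:
  assumes "x \<in> carrier G" "y \<in> carrier G" "z \<in> carrier G" shows "d x z \<le> d x y + d y z"
  by (rule d_le[OF relpowp_trans[OF relpowp_d relpowp_d]]) (use assms in auto)

lemma d_translate:
  assumes "x \<in> carrier G" "y \<in> carrier G" "z \<in> carrier G" shows "d (z \<otimes> x) (z \<otimes> y) = d x y"
proof (rule antisym)
  show "d (z \<otimes> x) (z \<otimes> y) \<le> d x y"
    by (intro d_le relpowp_adj_translate relpowp_d assms)
  have "(adj ^^ d (z \<otimes> x) (z \<otimes> y)) (inv z \<otimes> (z \<otimes> x)) (inv z \<otimes> (z \<otimes> y))"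
    by (intro relpowp_adj_translate relpowp_d m_closed inv_closed assms)
  then show "d x y \<le> d (z \<otimes> x) (z \<otimes> y)"
    using assms by (intro d_le) (simp flip: m_assoc)
qed

lemma d_adj: "adj x y \<Longrightarrow> d x y \<le> 1"
  using d_le[of 1 x y] by (simp only: relpowp_1)

lemma d_eq_1:
  assumes "x \<in> carrier G" "y \<in> carrier G" "d x y = 1" shows "adj x y"
  using relpowp_d[OF assms(1,2)] assms(3) by (simp only: relpowp_1)

lemma d_walk:
  assumes "\<And>k. i \<le> k \<Longrightarrow> k < j \<Longrightarrow> adj (p k) (p (Suc k))" "i \<le> j"
  shows "d (p i) (p j) \<le> j - i"
proof -
  have "(adj ^^ (j - i)) (p i) (p j)"
    unfolding relpowp_fun_conv using assms by (intro exI[of _ "\<lambda>k. p (i + k)"]) auto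
  then show ?thesis by (rule d_le)
qed

text \<open>A vertex of the next sphere is a vertex of the ball times a letter or an inverse letter.
  Applied to the finite set \<open>S\<close>, this is the source of all later cardinality bounds on
  sets of translations.\<close>

lemma finite_ball:
  assumes "finite T" "x \<in> carrier G"
  shows "finite {y \<in> carrier G. d x y \<le> n}"
proof (induction n)
  case 0
  have "{y \<in> carrier G. d x y \<le> 0} \<subseteq> {x}" using d_eq_0 assms(2) by auto
  then show ?case using finite_subset by blast
next
  case (Suc n)
  let ?B = "{y \<in> carrier G. d x y \<le> n}"
  have "{y \<in> carrier G. d x y \<le> Suc n} \<subseteq> insert x ((\<lambda>(y, t). y \<otimes> t) ` (?B \<times> (T \<union> m_inv G ` T)))"
  proof
    fix y assume y: "y \<in> {y \<in> carrier G. d x y \<le> Suc n}"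
    show "y \<in> insert x ((\<lambda>(y, t). y \<otimes> t) ` (?B \<times> (T \<union> m_inv G ` T)))"
    proof (cases "d x y")
      case 0 then show ?thesis using y d_eq_0 assms(2) by auto
    next
      case (Suc k)
      then obtain z where z: "(adj ^^ k) x z" "adj z y"
        using relpowp_d[of x y] assms(2) y by (auto elim: relpowp_Suc_E)
      have zc: "z \<in> carrier G" "y \<in> carrier G" using z(2) adj_carrier by auto
      have "d x z \<le> n" using d_le[OF z(1)] Suc y by auto
      moreover have "inv z \<otimes> y \<in> T \<union> m_inv G ` T"
      proof (cases "inv z \<otimes> y \<in> T")
        case False
        then have "inv y \<otimes> z \<in> T" using z(2) by (auto simp: cayley_adj_def)
        moreover have "inv z \<otimes> y = inv (inv y \<otimes> z)" using zc by (simp add: inv_mult_group)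
        ultimately show ?thesis by blast
      qed simp
      moreover have "y = z \<otimes> (inv z \<otimes> y)" using zc by (simp flip: m_assoc)
      ultimately have "y \<in> (\<lambda>(y, t). y \<otimes> t) ` (?B \<times> (T \<union> m_inv G ` T))"
        using zc by (intro image_eqI[of _ _ "(z, inv z \<otimes> y)"]) auto
      then show ?thesis by blast
    qed
  qed
  then show ?case by (rule finite_subset) (use Suc assms(1) in auto)
qed

definition geodesic :: "(nat \<Rightarrow> 'a) \<Rightarrow> nat \<Rightarrow> bool" where
  "geodesic p n \<longleftrightarrow> (\<forall>i\<le>n. p i \<in> carrier G) \<and> (\<forall>i j. i \<le> j \<longrightarrow> j \<le> n \<longrightarrow> d (p i) (p j) = j - i)"

lemma geodesic_carrier: "geodesic p n \<Longrightarrow> i \<le> n \<Longrightarrow> p i \<in> carrier G"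
  by (simp add: geodesic_def)

lemma geodesic_d: "geodesic p n \<Longrightarrow> i \<le> j \<Longrightarrow> j \<le> n \<Longrightarrow> d (p i) (p j) = j - i"
  by (simp add: geodesic_def)

lemma geodesic_adj: "geodesic p n \<Longrightarrow> i < n \<Longrightarrow> adj (p i) (p (Suc i))"
  by (intro d_eq_1) (auto simp: geodesic_def)

text \<open>Along a walk of minimal length the three consecutive subwalks have distances at most
  their numbers of edges, and these numbers add up to the total distance. Hence no bound is
  strict.\<close>

lemma geodesic_exists:
  assumes "x \<in> carrier G" "y \<in> carrier G"
  obtains p where "geodesic p (d x y)" "p 0 = x" "p (d x y) = y"
proof -
  obtain p where p: "p 0 = x" "p (d x y) = y" "\<And>i. i < d x y \<Longrightarrow> adj (p i) (p (Suc i))"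
    using relpowp_d[OF assms] unfolding relpowp_fun_conv by blast
  have pc: "p i \<in> carrier G" if "i \<le> d x y" for i
    using that p(2) p(3)[of i] adj_carrier assms(2) by (cases "i = d x y") auto
  have "d (p i) (p j) = j - i" if ij: "i \<le> j" "j \<le> d x y" for i j
  proof -
    have "d x y \<le> d (p 0) (p i) + (d (p i) (p j) + d (p j) (p (d x y)))"
      using d_triangle[of "p 0" "p i" "p (d x y)"] d_triangle[of "p i" "p j" "p (d x y)"]
        pc[of 0] pc[of i] pc[of j] pc[of "d x y"] ij p(1,2) by auto
    moreover have "d (p 0) (p i) \<le> i - 0" using p(3) ij by (intro d_walk) auto
    moreover have "d (p i) (p j) \<le> j - i" using p(3) ij by (intro d_walk) auto
    moreover have "d (p j) (p (d x y)) \<le> d x y - j" using p(3) ij by (intro d_walk) auto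
    ultimately show ?thesis using ij by linarith
  qed
  then have "geodesic p (d x y)" using pc by (simp add: geodesic_def)
  then show thesis using that p(1,2) by blast
qed

lemma geodesic_rev:
  assumes "geodesic p n" shows "geodesic (\<lambda>i. p (n - i)) n"
  unfolding geodesic_def
proof (intro conjI allI impI)
  fix i j assume "i \<le> j" "j \<le> n"
  then show "d (p (n - i)) (p (n - j)) = j - i"
    using geodesic_d[OF assms, of "n - j" "n - i"] geodesic_carrier[OF assms] d_sym by simp
qed (use geodesic_carrier[OF assms] in auto)

lemma geodesic_translate:
  assumes "geodesic p n" "g \<in> carrier G" shows "geodesic (\<lambda>i. g \<otimes> p i) n"
  using assms by (auto simp: geodesic_def d_translate)

lemma geodesic_shift:
  assumes "geodesic p n" "k + m \<le> n" shows "geodesic (\<lambda>i. p (k + i)) m"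
  using assms by (auto simp: geodesic_def)

end

section \<open>Geodesics in the relative Cayley graph\<close>

locale relative_cayley_graph = group G for G (structure) +
  fixes S :: "'a set" and Hs :: "'a set set"
  assumes S_finite: "finite S" and S_subset: "S \<subseteq> carrier G" and S_generates: "generate G S = carrier G"
    and Hs_subgroup: "H \<in> Hs \<Longrightarrow> subgroup H G"
begin

lemma Hs_subset: "\<Union>Hs \<subseteq> carrier G"
  using Hs_subgroup subgroup.subset by blast

text \<open>Two metrics live on the same vertices: \<open>S.d\<close> has finite balls, while
  \<open>R.d\<close> is the one entering hyperbolicity and word length. They are related by
  \<open>R.d \<le> S.d\<close> only.\<close>

sublocale S: cayley_graph G S
  by unfold_locales (rule S_subset S_generates)+

sublocale R: cayley_graph G "S \<union> \<Union>Hs"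
proof unfold_locales
  show "S \<union> \<Union>Hs \<subseteq> carrier G" using S_subset Hs_subset by blast
  then show "generate G (S \<union> \<Union>Hs) = carrier G"
    using mono_generate[of S "S \<union> \<Union>Hs"] generate_incl S_generates by blast
qed

lemma R_d_le_S_d:
  assumes "x \<in> carrier G" "y \<in> carrier G" shows "R.d x y \<le> S.d x y"
proof -
  have "(R.adj ^^ S.d x y) x y"
    using relpowp_mono[OF _ S.relpowp_d[OF assms], of R.adj] by (auto simp: cayley_adj_def)
  then show ?thesis by (rule R.d_le)
qed

lemma letter_inv: "h \<in> \<Union>Hs \<Longrightarrow> inv h \<in> \<Union>Hs"
  using Hs_subgroup subgroup.m_inv_closed by fastforce

lemma R_d_letter:
  assumes "x \<in> carrier G" "y \<in> carrier G" "inv x \<otimes> y \<in> insert \<one> (\<Union>Hs)"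
  shows "R.d x y \<le> 1"
proof (cases "x = y")
  case False
  then have "inv x \<otimes> y \<noteq> \<one>" using assms(1,2) by (metis inv_equality inv_inv inv_closed)
  then have "R.adj x y" using assms False by (auto simp: cayley_adj_def)
  then show ?thesis by (rule R.d_adj)
qed simp

text \<open>From words to walks, left invariance peels off the first letter; a letter equal to the
  unit costs a letter but no edge, since the graph has no loops. From walks to words, an edge whose
  label appears in the opposite orientation contributes an inverse letter, which is again an
  admissible letter.\<close>

lemma word_length_eq:
  assumes "g \<in> carrier G" shows "word_length G S Hs g = R.d \<one> g"
proof (cases "g = \<one>")
  case False
  define A where "A = S \<union> m_inv G ` S \<union> \<Union>Hs"
  define W where "W = {n. n \<ge> 1 \<and> (\<exists>xs. length xs = n \<and> set xs \<subseteq> A \<and> g = foldr (\<otimes>) xs \<one>)}"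
  have A_sub: "A \<subseteq> carrier G" using S_subset Hs_subset by (auto simp: A_def)
  have foldr_carrier: "foldr (\<otimes>) xs \<one> \<in> carrier G" if "set xs \<subseteq> A" for xs
    using that A_sub by (induction xs) auto
  have word_d: "R.d \<one> (foldr (\<otimes>) xs \<one>) \<le> length xs" if "set xs \<subseteq> A" for xs
    using that
  proof (induction xs)
    case (Cons a xs)
    let ?w = "foldr (\<otimes>) xs \<one>"
    have w: "?w \<in> carrier G" and a: "a \<in> A" "a \<in> carrier G" using foldr_carrier Cons.prems A_sub by auto
    have "R.d \<one> a \<le> 1"
    proof (cases "a = \<one>")
      case False
      have "R.adj \<one> a" using a False S_subset by (auto simp: A_def cayley_adj_def subset_iff)
      then show ?thesis by (rule R.d_adj)
    qed simp
    moreover have "R.d a (a \<otimes> ?w) = R.d \<one> ?w"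
      using R.d_translate[of \<one> ?w a] w a by simp
    moreover have "R.d \<one> (a \<otimes> ?w) \<le> R.d \<one> a + R.d a (a \<otimes> ?w)"
      using w a by (intro R.d_triangle) auto
    ultimately show ?case using Cons by simp
  qed simp
  have d_word: "\<exists>xs. length xs = n \<and> set xs \<subseteq> A \<and> y = x \<otimes> foldr (\<otimes>) xs \<one>"
    if "(R.adj ^^ n) x y" "x \<in> carrier G" for n x y
    using that
  proof (induction n arbitrary: x)
    case 0 then show ?case by (auto intro!: exI[of _ "[]"])
  next
    case (Suc n)
    then obtain z where z: "R.adj x z" "(R.adj ^^ n) z y" by (blast elim: relpowp_Suc_E2)
    then have zc: "z \<in> carrier G" using R.adj_carrier by blast
    from Suc.IH[OF z(2) zc] obtain xs where
      xs: "length xs = n" "set xs \<subseteq> A" "y = z \<otimes> foldr (\<otimes>) xs \<one>" by blast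
    have "inv x \<otimes> z \<in> A"
    proof (cases "inv x \<otimes> z \<in> S \<union> \<Union>Hs")
      case False
      then have "inv z \<otimes> x \<in> S \<union> \<Union>Hs" using z(1) by (auto simp: cayley_adj_def)
      moreover have "inv x \<otimes> z = inv (inv z \<otimes> x)"
        using zc Suc.prems by (simp add: inv_mult_group)
      ultimately show ?thesis using letter_inv by (auto simp: A_def)
    qed (auto simp: A_def)
    moreover have "y = x \<otimes> ((inv x \<otimes> z) \<otimes> foldr (\<otimes>) xs \<one>)"
      using xs zc Suc.prems foldr_carrier[OF xs(2)] by (simp flip: m_assoc)
    ultimately show ?case using xs by (intro exI[of _ "(inv x \<otimes> z) # xs"]) auto
  qed
  obtain xs where xs: "length xs = R.d \<one> g" "set xs \<subseteq> A" "g = \<one> \<otimes> foldr (\<otimes>) xs \<one>"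
    using d_word[OF R.relpowp_d[OF one_closed assms]] by auto
  have "R.d \<one> g \<noteq> 0" using False R.d_eq_0[OF one_closed assms] by auto
  then have "R.d \<one> g \<in> W" using xs foldr_carrier[OF xs(2)] by (auto simp: W_def)
  moreover have "R.d \<one> g \<le> n" if "n \<in> W" for n using that word_d by (auto simp: W_def)
  ultimately have "Inf W = R.d \<one> g" by (intro cInf_eq_minimum)
  then show ?thesis using False by (simp add: word_length_def W_def A_def)
qed (simp add: word_length_def)

text \<open>Stronger than the absence of backtracking: a coset meets the path in at most two
  vertices, which are then consecutive. All components become single edges, so no bookkeeping of
  entering and exit times is left.\<close>

definition no_backtrack :: "(nat \<Rightarrow> 'a) \<Rightarrow> nat \<Rightarrow> bool" where
  "no_backtrack p n \<longleftrightarrow> (\<forall>i j. i + 2 \<le> j \<longrightarrow> j \<le> n \<longrightarrow> inv (p i) \<otimes> p j \<notin> \<Union>Hs)"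

text \<open>Multiplicative constant 1 suffices for spliced geodesics. The upper estimate follows
  from adjacency of consecutive vertices, so only the lower one is recorded.\<close>

definition quasi_geodesic :: "nat \<Rightarrow> (nat \<Rightarrow> 'a) \<Rightarrow> nat \<Rightarrow> bool" where
  "quasi_geodesic c p n \<longleftrightarrow>
     (\<forall>i\<le>n. p i \<in> carrier G) \<and> (\<forall>i<n. R.adj (p i) (p (Suc i))) \<and>
     (\<forall>i j. i \<le> j \<longrightarrow> j \<le> n \<longrightarrow> j - i \<le> R.d (p i) (p j) + c)"

lemma geodesic_no_backtrack:
  assumes "R.geodesic p n" shows "no_backtrack p n"
  unfolding no_backtrack_def
proof (intro allI impI notI)
  fix i j assume ij: "i + 2 \<le> j" "j \<le> n" "inv (p i) \<otimes> p j \<in> \<Union>Hs"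
  then have "R.d (p i) (p j) \<le> 1" using R.geodesic_carrier[OF assms] by (intro R_d_letter) auto
  then show False using R.geodesic_d[OF assms, of i j] ij by simp
qed

lemma geodesic_quasi_geodesic: "R.geodesic p n \<Longrightarrow> quasi_geodesic c p n"
  using R.geodesic_adj R.geodesic_carrier by (auto simp: quasi_geodesic_def R.geodesic_d)

section \<open>From indexed paths to vertex lists and their coset components\<close>

abbreviation vertices :: "(nat \<Rightarrow> 'a) \<Rightarrow> nat \<Rightarrow> 'a list" where
  "vertices p n \<equiv> map p [0..<Suc n]"

lemma vertices_nth: "k \<le> n \<Longrightarrow> vertices p n ! k = p k"
  by (simp add: nth_map_upt del: upt_Suc)

lemma quasi_geodesic_vertices:
  assumes "quasi_geodesic c p n" shows "rel_quasi_geodesic G S Hs 1 (real c) (vertices p n)"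
proof -
  have carr: "p i \<in> carrier G" if "i \<le> n" for i using assms that by (simp add: quasi_geodesic_def)
  have adj: "R.adj (p i) (p (Suc i))" if "i < n" for i using assms that by (simp add: quasi_geodesic_def)
  have "rel_path G S Hs (vertices p n)"
    unfolding rel_path_def successively_conv_nth
    using carr adj by (auto simp: nth_map_upt simp del: upt_Suc)
  moreover have *: "real (l - k) - c \<le> R.d (p k) (p l) \<and> R.d (p k) (p l) \<le> real (l - k) + c"
    if "k \<le> l" "l \<le> n" for k l
  proof -
    have "l - k \<le> R.d (p k) (p l) + c" using assms that by (simp add: quasi_geodesic_def)
    moreover have "R.d (p k) (p l) \<le> l - k" using adj that by (intro R.d_walk) auto
    ultimately show ?thesis using of_nat_mono by linarith
  qed
  moreover have "\<bar>real k - real l\<bar> - c \<le> R.d (p k) (p l) \<and> R.d (p k) (p l) \<le> \<bar>real k - real l\<bar> + c"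
    if "k \<le> n" "l \<le> n" for k l
  proof (cases "k \<le> l")
    case True
    have "\<bar>real k - real l\<bar> = real (l - k)" using True by (simp add: of_nat_diff)
    then show ?thesis using *[OF True that(2)] by simp
  next
    case False
    have "\<bar>real k - real l\<bar> = real (k - l)" using False by (simp add: of_nat_diff)
    then show ?thesis using *[of l k] R.d_sym[OF carr carr, of k l] False that by simp
  qed
  ultimately show ?thesis
    unfolding rel_quasi_geodesic_def by (auto simp: nth_map_upt R.d_def simp del: upt_Suc)
qed

lemma l_coset_iff:
  assumes "g \<in> carrier G" "x \<in> carrier G" "H \<in> Hs"
  shows "x \<in> g <# H \<longleftrightarrow> inv g \<otimes> x \<in> H"
proof
  assume "x \<in> g <# H"
  then obtain h where "h \<in> H" "x = g \<otimes> h" by (auto simp: l_coset_def)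
  then show "inv g \<otimes> x \<in> H"
    using assms Hs_subset by (metis UnionI inv_solve_left subsetD)
next
  assume *: "inv g \<otimes> x \<in> H"
  have "x = g \<otimes> (inv g \<otimes> x)" using assms by (simp flip: m_assoc)
  then show "x \<in> g <# H" using * by (auto simp: l_coset_def)
qed

lemma coset_diff:
  assumes "g \<in> carrier G" "x \<in> carrier G" "y \<in> carrier G" "H \<in> Hs" "x \<in> g <# H" "y \<in> g <# H"
  shows "inv x \<otimes> y \<in> H"
proof -
  have "inv (inv g \<otimes> x) \<otimes> (inv g \<otimes> y) \<in> H"
    using assms Hs_subgroup[OF assms(4)] by (simp add: l_coset_iff subgroup.m_closed subgroup.m_inv_closed)
  then show ?thesis using assms by (simp add: S.inv_mult_translate)
qed

lemma edge_coset_end: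
  assumes "g \<in> carrier G" "H \<in> Hs" "\<And>i. i < length P \<Longrightarrow> P ! i \<in> carrier G" "edge_in_coset G g H P k"
  shows "P ! k \<in> g <# H" "P ! Suc k \<in> g <# H"
proof -
  show k: "P ! k \<in> g <# H" using assms by (simp add: edge_in_coset_def)
  have c: "P ! k \<in> carrier G" "P ! Suc k \<in> carrier G" using assms by (auto simp: edge_in_coset_def)
  have "(inv g \<otimes> P ! k) \<otimes> (inv (P ! k) \<otimes> P ! Suc k) \<in> H"
    by (rule subgroup.m_closed[OF Hs_subgroup[OF assms(2)]])
      (use k c assms in \<open>auto simp: l_coset_iff edge_in_coset_def\<close>)
  moreover have "(inv g \<otimes> P ! k) \<otimes> (inv (P ! k) \<otimes> P ! Suc k) = inv g \<otimes> (P ! k \<otimes> inv (P ! k)) \<otimes> P ! Suc k"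
    using c assms by (simp only: m_assoc inv_closed m_closed)
  ultimately show "P ! Suc k \<in> g <# H" using c assms by (simp add: l_coset_iff)
qed

text \<open>If a neighbouring edge lay in the same coset, two vertices two steps apart would differ
  by an element of \<open>H\<close>.\<close>

lemma no_backtrack_component:
  assumes nb: "no_backtrack p n" and carr: "\<And>i. i \<le> n \<Longrightarrow> p i \<in> carrier G"
    and g: "g \<in> carrier G" "H \<in> Hs" and e: "edge_in_coset G g H (vertices p n) k"
  shows "coset_component G g H (vertices p n) k (Suc k)"
proof -
  let ?P = "vertices p n"
  have kn: "k < n" using e by (simp add: edge_in_coset_def)
  have Pc: "\<And>i. i < length ?P \<Longrightarrow> ?P ! i \<in> carrier G"
    using carr by (auto simp: vertices_nth simp del: upt_Suc)
  have far: False if "i + 2 \<le> j" "j \<le> n" "?P ! i \<in> g <# H" "?P ! j \<in> g <# H" for i j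
    using coset_diff[of g "p i" "p j" H] that carr g nb
    by (auto simp: no_backtrack_def vertices_nth simp del: upt_Suc)
  have "\<not> edge_in_coset G g H ?P (k - 1)" if "k \<noteq> 0"
  proof
    assume "edge_in_coset G g H ?P (k - 1)"
    from edge_coset_end(1)[OF g Pc this] edge_coset_end(2)[OF g Pc e] far[of "k - 1" "Suc k"] that kn
    show False by simp
  qed
  moreover have "\<not> edge_in_coset G g H ?P (Suc k)"
  proof
    assume e': "edge_in_coset G g H ?P (Suc k)"
    then have "Suc (Suc k) \<le> n" by (simp add: edge_in_coset_def)
    with edge_coset_end(2)[OF g Pc e'] edge_coset_end(1)[OF g Pc e] far[of k "Suc (Suc k)"]
    show False by simp
  qed
  ultimately show ?thesis using e by (auto simp: coset_component_def less_Suc_eq_le simp del: upt_Suc)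
qed

lemma no_backtrack_vertices:
  assumes nb: "no_backtrack p n" and carr: "\<And>i. i \<le> n \<Longrightarrow> p i \<in> carrier G"
  shows "without_backtracking G Hs (vertices p n)"
  unfolding without_backtracking_def
proof (intro ballI allI impI notI)
  fix g H a b k
  let ?P = "vertices p n"
  assume g: "g \<in> carrier G" "H \<in> Hs" and comp: "coset_component G g H ?P a b"
    and k: "b < k \<and> k < length ?P" "?P ! k \<in> g <# H"
  have "?P ! a \<in> g <# H" using comp by (auto simp: coset_component_def edge_in_coset_def simp del: upt_Suc)
  then have "inv (p a) \<otimes> p k \<in> H"
    using coset_diff[of g "p a" "p k" H] k g carr comp
    by (auto simp: vertices_nth coset_component_def simp del: upt_Suc)
  moreover have "a + 2 \<le> k" using comp k by (auto simp: coset_component_def)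
  ultimately show False using nb g k by (auto simp: no_backtrack_def)
qed

lemma quasi_geodesic_mono: "quasi_geodesic c p n \<Longrightarrow> c \<le> c' \<Longrightarrow> quasi_geodesic c' p n"
  unfolding quasi_geodesic_def by (meson add_left_mono le_trans)

text \<open>An edge of the relative graph that is not an edge for \<open>S\<close> carries a
  peripheral label in one orientation, hence in both, as subgroups contain inverses.\<close>

lemma long_edge_coset:
  assumes "R.adj x y" "S.d x y > 1"
  obtains H where "H \<in> Hs" "inv x \<otimes> y \<in> H"
proof -
  have xy: "x \<in> carrier G" "y \<in> carrier G" "x \<noteq> y" using assms(1) by (auto simp: cayley_adj_def)
  have "\<not> S.adj x y" using S.d_adj assms(2) by fastforce
  then have "inv x \<otimes> y \<notin> S" "inv y \<otimes> x \<notin> S" using xy by (auto simp: cayley_adj_def)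
  then have "inv x \<otimes> y \<in> \<Union>Hs \<or> inv y \<otimes> x \<in> \<Union>Hs" using assms(1) by (auto simp: cayley_adj_def)
  moreover have "inv x \<otimes> y = inv (inv y \<otimes> x)" using xy by (simp add: inv_mult_group)
  ultimately have "inv x \<otimes> y \<in> \<Union>Hs" using letter_inv by auto
  then show thesis using that by blast
qed

section \<open>Bounded coset penetration for geodesics\<close>

text \<open>The orientation is part of the notion, because entering points are compared with
  entering points and exit points with exit points.\<close>

definition matched :: "nat \<Rightarrow> 'a \<Rightarrow> 'a \<Rightarrow> (nat \<Rightarrow> 'a) \<Rightarrow> nat \<Rightarrow> bool" where
  "matched C x y q m \<longleftrightarrow> (\<exists>l<m. S.d x (q l) \<le> C \<and> S.d y (q (Suc l)) \<le> C)"

text \<open>This merges both clauses of bounded coset penetration: the first makes \<open>q\<close>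
  enter the coset of a long edge of \<open>p\<close>, the second locates the edge of
  \<open>q\<close> in that coset.\<close>

definition penetration :: "nat \<Rightarrow> nat \<Rightarrow> bool" where
  "penetration c C \<longleftrightarrow> (\<forall>p n q m k. quasi_geodesic c p n \<longrightarrow> no_backtrack p n \<longrightarrow>
     quasi_geodesic c q m \<longrightarrow> no_backtrack q m \<longrightarrow> p 0 = q 0 \<longrightarrow> p n = q m \<longrightarrow> k < n \<longrightarrow>
     S.d (p k) (p (Suc k)) > C \<longrightarrow> matched C (p k) (p (Suc k)) q m)"

lemma penetrationD:
  "\<lbrakk>penetration c C; quasi_geodesic c p n; no_backtrack p n; quasi_geodesic c q m; no_backtrack q m;
    p 0 = q 0; p n = q m; k < n; S.d (p k) (p (Suc k)) > C\<rbrakk> \<Longrightarrow> matched C (p k) (p (Suc k)) q m"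
  unfolding penetration_def by blast

lemma penetration_exists:
  assumes bcp: "bounded_coset_penetration G S Hs" and "c > 0"
  obtains C where "penetration c C"
proof -
  have c: "real c > 0" using assms(2) by simp
  obtain C :: real where C: "\<forall>p q.
      rel_quasi_geodesic G S Hs 1 (real (c)) p \<and> without_backtracking G Hs p \<and>
      rel_quasi_geodesic G S Hs 1 (real (c)) q \<and> without_backtracking G Hs q \<and>
      hd p = hd q \<and> last p = last q \<longrightarrow> (\<forall>g\<in>carrier G. \<forall>H\<in>Hs.
      (\<forall>a b. coset_component G g H p a b \<and> real (S.d (p ! a) (p ! b)) > C \<longrightarrow> enters_coset G g H q) \<and>
      (\<forall>a b a' b'. coset_component G g H p a b \<and> coset_component G g H q a' b' \<longrightarrow>
         real (S.d (p ! a) (q ! a')) \<le> C \<and> real (S.d (p ! b) (q ! b')) \<le> C))"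
    using bcp[unfolded bounded_coset_penetration_def, rule_format, OF zero_less_one c]
    unfolding S.d_def by (rule exE)
  \<comment> \<open>The lower bound 1 ensures that an edge longer than \<open>C'\<close> is not an
    edge for \<open>S\<close>, so that it has a peripheral coset.\<close>
  define C' where "C' = max 1 (nat \<lceil>C\<rceil>)"
  have C': "C' \<ge> 1" "\<And>k. real k \<le> C \<Longrightarrow> k \<le> C'" "\<And>k. k > C' \<Longrightarrow> real k > C"
    unfolding C'_def by linarith+
  have "penetration c C'"
    unfolding penetration_def
  proof (intro allI impI)
    fix p n q m k
    assume p: "quasi_geodesic (c) p n" "no_backtrack p n"
      and q: "quasi_geodesic (c) q m" "no_backtrack q m"
      and ends: "p 0 = q 0" "p n = q m" and k: "k < n" "S.d (p k) (p (Suc k)) > C'"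
    let ?p = "vertices p n" and ?q = "vertices q m"
    have pc: "p i \<in> carrier G" if "i \<le> n" for i using p that by (simp add: quasi_geodesic_def)
    have qc: "q i \<in> carrier G" if "i \<le> m" for i using q that by (simp add: quasi_geodesic_def)
    have "R.adj (p k) (p (Suc k))" using p k by (simp add: quasi_geodesic_def)
    moreover have "S.d (p k) (p (Suc k)) > 1" using k(2) C'(1) by linarith
    ultimately obtain H where H: "H \<in> Hs" "inv (p k) \<otimes> p (Suc k) \<in> H"
      by (rule long_edge_coset)
    have g: "p k \<in> carrier G" using pc k by simp
    have "p k \<in> p k <# H" using H Hs_subgroup[OF H(1)] g by (simp add: l_coset_iff subgroup.one_closed)
    then have e: "edge_in_coset G (p k) H ?p k"
      using k H by (simp add: edge_in_coset_def vertices_nth del: upt_Suc)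
    then have comp: "coset_component G (p k) H ?p k (Suc k)"
      using no_backtrack_component[OF p(2) pc g H(1)] by blast
    have *: "rel_quasi_geodesic G S Hs 1 (real (c)) ?p \<and> without_backtracking G Hs ?p \<and>
      rel_quasi_geodesic G S Hs 1 (real (c)) ?q \<and> without_backtracking G Hs ?q \<and>
      hd ?p = hd ?q \<and> last ?p = last ?q"
      using quasi_geodesic_vertices[OF p(1)] quasi_geodesic_vertices[OF q(1)]
        no_backtrack_vertices[OF p(2) pc] no_backtrack_vertices[OF q(2) qc] ends
      by (simp add: hd_map last_map del: upt_Suc)
    have "real (S.d (?p ! k) (?p ! Suc k)) > C"
      using C'(3)[OF k(2)] k by (simp add: vertices_nth del: upt_Suc)
    then have "enters_coset G (p k) H ?q" using C[THEN spec, THEN spec, THEN mp, OF *, THEN bspec, OF g, THEN bspec, OF H(1)] comp by blast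
    then obtain l where l: "edge_in_coset G (p k) H ?q l" by (auto simp: enters_coset_def)
    then have "coset_component G (p k) H ?q l (Suc l)"
      using no_backtrack_component[OF q(2) qc g H(1)] by blast
    then have "real (S.d (?p ! k) (?q ! l)) \<le> C \<and> real (S.d (?p ! Suc k) (?q ! Suc l)) \<le> C"
      using C[THEN spec, THEN spec, THEN mp, OF *, THEN bspec, OF g, THEN bspec, OF H(1)] comp by blast
    moreover have "l < m" using l by (simp add: edge_in_coset_def)
    ultimately show "matched C' (p k) (p (Suc k)) q m"
      unfolding matched_def using C'(2) k by (auto simp: vertices_nth simp del: upt_Suc)
  qed
  then show thesis by (rule that)
qed

text \<open>The path follows \<open>\<alpha>\<close> up to the first vertex sharing a coset with some vertex of \<open>\<eta>\<close>, and continues along \<open>\<eta>\<close>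
  from the last such vertex. These two choices exclude backtracking.\<close>

lemma splice_geodesics:
  assumes \<alpha>: "R.geodesic \<alpha> n" and \<eta>: "R.geodesic \<eta> k" and join: "\<eta> 0 = \<alpha> n"
  obtains \<pi> N a where "a \<le> n" "a \<le> N" "N \<le> a + k + 1" "\<And>i. i \<le> a \<Longrightarrow> \<pi> i = \<alpha> i" "\<pi> N = \<eta> k"
    "quasi_geodesic (2 * k + 2) \<pi> N" "no_backtrack \<pi> N"
proof -
  \<comment> \<open>The unit lets equal vertices count as sharing a coset. The common vertex
    \<open>\<eta> 0 = \<alpha> n\<close> is then a candidate even if there is no peripheral
    subgroup.\<close>
  define K where "K = insert \<one> (\<Union>Hs)"
  have \<alpha>c: "\<alpha> i \<in> carrier G" if "i \<le> n" for i using R.geodesic_carrier[OF \<alpha>] that .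
  have \<eta>c: "\<eta> i \<in> carrier G" if "i \<le> k" for i using R.geodesic_carrier[OF \<eta>] that .
  define P where "P a j \<longleftrightarrow> j \<le> k \<and> inv (\<alpha> a) \<otimes> \<eta> j \<in> K" for a j
  have "P n 0" using \<alpha>c[of n] join by (simp add: P_def K_def)
  define a where "a = (LEAST a. \<exists>j. P a j)"
  have a_ex: "\<exists>j. P a j" and a_le: "a \<le> n"
    unfolding a_def using \<open>P n 0\<close> by (auto intro: LeastI Least_le)
  have a_min: "\<not> P i j" if "i < a" for i j using not_less_Least[of i "\<lambda>a. \<exists>j. P a j"] that a_def by blast
  define j where "j = (GREATEST j. P a j)"
  have bd: "\<And>j. P a j \<Longrightarrow> j \<le> k" by (simp add: P_def)
  have j: "P a j" unfolding j_def using a_ex bd GreatestI_ex_nat[of "P a" k] by blast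
  have j_max: "j' \<le> j" if "P a j'" for j' unfolding j_def using that bd by (rule Greatest_le_nat)
  have jk: "j \<le> k" using j by (simp add: P_def)
  \<comment> \<open>The number of connecting edges: none if the two chosen vertices coincide,
    otherwise one peripheral edge. The index shift in \<open>\<pi>\<close> compensates for
    it.\<close>
  define e where "e = (if \<alpha> a = \<eta> j then 0 else 1 :: nat)"
  define N where "N = a + (k - j) + e"
  define \<pi> where "\<pi> i = (if i \<le> a then \<alpha> i else \<eta> (i + j - a - e))" for i
  have \<pi>c: "\<pi> i \<in> carrier G" if "i \<le> N" for i
    using that \<alpha>c \<eta>c a_le jk by (auto simp: \<pi>_def N_def)
  have adj: "R.adj (\<pi> i) (\<pi> (Suc i))" if "i < N" for i
  proof -
    consider "Suc i \<le> a" | "i = a" | "i > a" by linarith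
    then show ?thesis
    proof cases
      case 1 then show ?thesis using R.geodesic_adj[OF \<alpha>, of i] a_le by (simp add: \<pi>_def)
    next
      case 2
      show ?thesis
      proof (cases "\<alpha> a = \<eta> j")
        case True
        then show ?thesis using R.geodesic_adj[OF \<eta>, of j] 2 that by (simp add: \<pi>_def e_def N_def)
      next
        case False
        have "inv (\<alpha> a) \<otimes> \<eta> j \<noteq> \<one>"
          using False \<alpha>c[OF a_le] \<eta>c[OF jk] by (metis inv_equality inv_inv inv_closed)
        then have "R.adj (\<alpha> a) (\<eta> j)" using j False \<alpha>c[OF a_le] \<eta>c[OF jk] by (auto simp: P_def K_def cayley_adj_def)
        then show ?thesis using False 2 by (simp add: \<pi>_def e_def)
      qed
    next
      case 3
      have "Suc i + j - a - e = Suc (i + j - a - e)" using 3 by (auto simp: e_def)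
      moreover have "i + j - a - e < k" using 3 that by (auto simp: e_def N_def split: if_splits)
      ultimately show ?thesis using R.geodesic_adj[OF \<eta>, of "i + j - a - e"] 3 by (simp add: \<pi>_def)
    qed
  qed
  have N: "a \<le> N" "N \<le> a + k + 1" by (auto simp: N_def e_def)
  have \<pi>\<alpha>: "\<pi> i = \<alpha> i" if "i \<le> a" for i using that by (simp add: \<pi>_def)
  \<comment> \<open>At most \<open>k + 1\<close> edges follow index \<open>a\<close>. Moving
    \<open>i'\<close> back to \<open>a\<close> loses their number twice, once in the index
    difference and once in the distance; this gives the constant \<open>2 k + 2\<close>.\<close>
  have "i' - i \<le> R.d (\<pi> i) (\<pi> i') + (2 * k + 2)" if "i \<le> i'" "i' \<le> N" for i i'
  proof -
    consider "i' \<le> a" | "i \<le> a" "a < i'" | "a < i" by linarith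
    then show ?thesis
    proof cases
      case 1 then show ?thesis using R.geodesic_d[OF \<alpha>, of i i'] that a_le \<pi>\<alpha> by simp
    next
      case 2
      have "R.d (\<alpha> i) (\<alpha> a) \<le> R.d (\<alpha> i) (\<pi> i') + R.d (\<pi> i') (\<alpha> a)"
        using 2 a_le that by (intro R.d_triangle \<alpha>c \<pi>c) auto
      moreover have "R.d (\<pi> i') (\<alpha> a) = R.d (\<alpha> a) (\<pi> i')"
        using a_le that by (intro R.d_sym \<alpha>c \<pi>c) auto
      moreover have "R.d (\<pi> a) (\<pi> i') \<le> i' - a" using 2 that adj by (intro R.d_walk) auto
      moreover have "R.d (\<alpha> i) (\<alpha> a) = a - i" using R.geodesic_d[OF \<alpha>] 2 a_le by simp
      ultimately show ?thesis using 2 that N \<pi>\<alpha> by simp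
    next
      case 3 then show ?thesis using that N by simp
    qed
  qed
  then have "quasi_geodesic (2 * k + 2) \<pi> N" using \<pi>c adj by (simp add: quasi_geodesic_def)
  moreover have "no_backtrack \<pi> N"
    unfolding no_backtrack_def
  proof (intro allI impI)
    fix i i' assume ii: "i + 2 \<le> i'" "i' \<le> N"
    consider "i' \<le> a" | "i \<le> a" "a < i'" | "a < i" by linarith
    then show "inv (\<pi> i) \<otimes> \<pi> i' \<notin> \<Union>Hs"
    proof cases
      case 1
      then show ?thesis using geodesic_no_backtrack[OF \<alpha>] ii a_le by (simp add: no_backtrack_def \<pi>_def)
    next
      case 2
      have \<pi>': "\<pi> i' = \<eta> (i' + j - a - e)" using 2 by (simp add: \<pi>_def)
      have le: "i' + j - a - e \<le> k" using 2 ii jk by (auto simp: N_def)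
      have "\<not> P i (i' + j - a - e)"
      proof (cases "i = a")
        case True
        then have "j < i' + j - a - e" using ii by (auto simp: e_def)
        then show ?thesis using j_max True by fastforce
      qed (use a_min 2 in auto)
      then show ?thesis using le \<pi>' 2 by (auto simp: P_def K_def \<pi>_def)
    next
      case 3
      then have "i + j - a - e + 2 \<le> i' + j - a - e" "i' + j - a - e \<le> k"
        using ii jk by (auto simp: e_def N_def split: if_splits)
      then show ?thesis using geodesic_no_backtrack[OF \<eta>] 3 ii by (auto simp: no_backtrack_def \<pi>_def)
    qed
  qed
  moreover have "\<pi> N = \<eta> k"
  proof (cases "N = a")
    case True
    then have "k = j" "\<alpha> a = \<eta> j" using jk by (auto simp: N_def e_def split: if_splits)
    then show ?thesis using True by (simp add: \<pi>_def)
  next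
    case False
    then have "N > a" using N by simp
    moreover have "N + j - a - e = k" using jk by (simp add: N_def)
    ultimately show ?thesis by (simp add: \<pi>_def)
  qed
  ultimately show thesis using that[OF a_le N \<pi>\<alpha>] by blast
qed

section \<open>Geodesics with one common end and nearby other ends\<close>

lemma S_d_quadrilateral:
  assumes "x \<in> carrier G" "y \<in> carrier G" "x' \<in> carrier G" "y' \<in> carrier G"
    and "S.d x x' \<le> r" "S.d y y' \<le> s"
  shows "S.d x y \<le> S.d x' y' + r + s"
proof -
  have "S.d x y \<le> S.d x x' + (S.d x' y' + S.d y' y)"
    using S.d_triangle[of x x' y] S.d_triangle[of x' y' y] assms(1-4) by linarith
  then show ?thesis using assms S.d_sym[of y y'] by linarith
qed

text \<open>Near the non-common ends a long edge may be matched by the connecting piece of the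
  splice instead of \<open>\<beta>\<close>. The margin \<open>C + k + 1\<close> keeps the edge away
  from that piece.\<close>

definition matching :: "nat \<Rightarrow> nat \<Rightarrow> bool" where
  "matching k C \<longleftrightarrow> (\<forall>\<alpha> n \<beta> m i. R.geodesic \<alpha> n \<longrightarrow> R.geodesic \<beta> m \<longrightarrow> \<alpha> 0 = \<beta> 0 \<longrightarrow>
     R.d (\<alpha> n) (\<beta> m) \<le> k \<longrightarrow> i + C + k + 1 < n \<longrightarrow> S.d (\<alpha> i) (\<alpha> (Suc i)) > C \<longrightarrow>
     matched C (\<alpha> i) (\<alpha> (Suc i)) \<beta> m)"

lemma matching_exists:
  assumes "bounded_coset_penetration G S Hs"
  obtains C where "matching k C"
proof -
  obtain C where C: "penetration (2 * k + 2) C" using penetration_exists[OF assms, of "2 * k + 2"] by auto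
  have "matched C (\<alpha> i) (\<alpha> (Suc i)) \<beta> m"
    if \<alpha>: "R.geodesic \<alpha> n" and \<beta>: "R.geodesic \<beta> m" and ends: "\<alpha> 0 = \<beta> 0" "R.d (\<alpha> n) (\<beta> m) \<le> k"
      and i: "i + C + k + 1 < n" and long: "S.d (\<alpha> i) (\<alpha> (Suc i)) > C" for \<alpha> n \<beta> m i
  proof -
    note \<alpha>c = R.geodesic_carrier[OF \<alpha>] and \<beta>c = R.geodesic_carrier[OF \<beta>]
    define k' where "k' = R.d (\<beta> m) (\<alpha> n)"
    have k': "k' \<le> k" using ends(2) R.d_sym \<alpha>c \<beta>c by (simp add: k'_def)
    obtain \<eta> where \<eta>: "R.geodesic \<eta> k'" "\<eta> 0 = \<beta> m" "\<eta> k' = \<alpha> n"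
      unfolding k'_def using R.geodesic_exists \<alpha>c \<beta>c by blast
    obtain \<pi> N a where \<pi>: "a \<le> m" "a \<le> N" "N \<le> a + k' + 1" "\<And>i. i \<le> a \<Longrightarrow> \<pi> i = \<beta> i" "\<pi> N = \<eta> k'"
      "quasi_geodesic (2 * k' + 2) \<pi> N" "no_backtrack \<pi> N"
      using splice_geodesics[OF \<beta> \<eta>(1,2)] by metis
    have \<pi>q: "quasi_geodesic (2 * k + 2) \<pi> N" by (rule quasi_geodesic_mono[OF \<pi>(6)]) (use k' in simp)
    have "matched C (\<alpha> i) (\<alpha> (Suc i)) \<pi> N"
      by (rule penetrationD[OF C geodesic_quasi_geodesic[OF \<alpha>] geodesic_no_backtrack[OF \<alpha>] \<pi>q \<pi>(7)])
        (use ends \<pi> \<eta> i long in auto)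
    then obtain l where l: "l < N" "S.d (\<alpha> i) (\<pi> l) \<le> C" "S.d (\<alpha> (Suc i)) (\<pi> (Suc l)) \<le> C"
      by (auto simp: matched_def)
    have \<pi>c: "\<pi> l \<in> carrier G" using \<pi>q l by (simp add: quasi_geodesic_def)
    \<comment> \<open>A partner on the appended part would be within \<open>k + 1\<close> of
      \<open>\<alpha> n\<close> and within \<open>C\<close> of \<open>\<alpha> i\<close>, but
      \<open>\<alpha> i\<close> is more than \<open>C + k + 1\<close> away from
      \<open>\<alpha> n\<close>.\<close>
    have "l < a"
    proof (rule ccontr)
      assume "\<not> l < a"
      have "R.d (\<pi> l) (\<pi> N) \<le> N - l" using \<pi>q l by (intro R.d_walk) (auto simp: quasi_geodesic_def)
      moreover have "R.d (\<alpha> i) (\<pi> l) \<le> C" using R_d_le_S_d[of "\<alpha> i" "\<pi> l"] \<alpha>c \<pi>c i l(2) by simp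
      moreover have "R.d (\<alpha> i) (\<alpha> n) \<le> R.d (\<alpha> i) (\<pi> l) + R.d (\<pi> l) (\<alpha> n)"
        using i by (intro R.d_triangle \<alpha>c \<pi>c) auto
      moreover have "R.d (\<alpha> i) (\<alpha> n) = n - i" using R.geodesic_d[OF \<alpha>] i by simp
      ultimately show False using \<pi>(3,5) \<eta>(3) k' i \<open>\<not> l < a\<close> by simp
    qed
    then show ?thesis using l \<pi>(1,4) by (auto simp: matched_def intro!: exI[of _ l])
  qed
  then have "matching k C" unfolding matching_def by blast
  then show thesis by (rule that)
qed

lemma matching_forward:
  "\<lbrakk>matching k C; R.geodesic \<alpha> n; R.geodesic \<beta> m; \<alpha> 0 = \<beta> 0; R.d (\<alpha> n) (\<beta> m) \<le> k;
    i + C + k + 1 < n; S.d (\<alpha> i) (\<alpha> (Suc i)) > C\<rbrakk> \<Longrightarrow> matched C (\<alpha> i) (\<alpha> (Suc i)) \<beta> m"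
  by (simp add: matching_def)

text \<open>Both geodesics are reversed. Edge \<open>i\<close> becomes edge
  \<open>n - Suc i\<close>, with its ends exchanged, and the partner is translated back in the same
  way.\<close>

lemma matching_backward:
  assumes mt: "matching k C" and \<alpha>: "R.geodesic \<alpha> n" and \<beta>: "R.geodesic \<beta> m"
    and ends: "\<alpha> n = \<beta> m" "R.d (\<alpha> 0) (\<beta> 0) \<le> k"
    and i: "C + k < i" "i < n" and long: "S.d (\<alpha> i) (\<alpha> (Suc i)) > C"
  shows "matched C (\<alpha> i) (\<alpha> (Suc i)) \<beta> m"
proof -
  define i' where "i' = n - Suc i"
  have i': "n - i' = Suc i" "n - Suc i' = i" using i by (auto simp: i'_def)
  have "S.d (\<alpha> (Suc i)) (\<alpha> i) > C"
    using long S.d_sym[of "\<alpha> i" "\<alpha> (Suc i)"] R.geodesic_carrier[OF \<alpha>] i by simp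
  then have "matched C (\<alpha> (Suc i)) (\<alpha> i) (\<lambda>j. \<beta> (m - j)) m"
    using matching_forward[OF mt R.geodesic_rev[OF \<alpha>] R.geodesic_rev[OF \<beta>], of i'] ends i i'
    by (simp add: i'_def)
  then obtain l where l: "l < m" "S.d (\<alpha> (Suc i)) (\<beta> (m - l)) \<le> C" "S.d (\<alpha> i) (\<beta> (m - Suc l)) \<le> C"
    by (auto simp: matched_def)
  moreover have "Suc (m - Suc l) = m - l" using l(1) by simp
  ultimately show ?thesis unfolding matched_def by (intro exI[of _ "m - Suc l"]) auto
qed

lemma S_d_chain:
  assumes "\<And>i. a \<le> i \<Longrightarrow> i \<le> b \<Longrightarrow> p i \<in> carrier G" "\<And>i. a \<le> i \<Longrightarrow> i < b \<Longrightarrow> S.d (p i) (p (Suc i)) \<le> E"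
    and "a \<le> b"
  shows "S.d (p a) (p b) \<le> (b - a) * E"
  using assms(3,1,2)
proof (induction b rule: dec_induct)
  case (step n)
  have "S.d (p a) (p (Suc n)) \<le> S.d (p a) (p n) + S.d (p n) (p (Suc n))"
    using step.hyps by (intro S.d_triangle step.prems) auto
  moreover have "S.d (p a) (p n) \<le> (n - a) * E" using step by simp
  moreover have "S.d (p n) (p (Suc n)) \<le> E" using step by simp
  ultimately show ?case using step.hyps by (simp add: Suc_diff_le)
qed simp

text \<open>Relatively close points can be arbitrarily far apart for \<open>S\<close>, because one
  peripheral edge can be that long. The remedy is to ask for \<open>S\<close>-short edges on both
  geodesics along their last \<open>B\<close> steps.\<close>

definition close_ends :: "nat \<Rightarrow> nat \<Rightarrow> nat \<Rightarrow> nat \<Rightarrow> bool" where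
  "close_ends k L B D \<longleftrightarrow> (\<forall>\<alpha> n \<beta> m. R.geodesic \<alpha> n \<longrightarrow> R.geodesic \<beta> m \<longrightarrow> \<alpha> 0 = \<beta> 0 \<longrightarrow>
     R.d (\<alpha> n) (\<beta> m) \<le> k \<longrightarrow>
     (\<forall>i<n. n \<le> i + B \<longrightarrow> S.d (\<alpha> i) (\<alpha> (Suc i)) \<le> L) \<longrightarrow>
     (\<forall>i<m. m \<le> i + B \<longrightarrow> S.d (\<beta> i) (\<beta> (Suc i)) \<le> L) \<longrightarrow> S.d (\<alpha> n) (\<beta> m) \<le> D)"

lemma close_ends_exists:
  assumes "bounded_coset_penetration G S Hs"
  obtains B D where "close_ends k L B D"
proof -
  obtain C where C: "penetration (2 * k + 2) C" using penetration_exists[OF assms, of "2 * k + 2"] by auto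
  \<comment> \<open>A matched edge loses at most \<open>C\<close> at each end, so a partner of an
    edge longer than \<open>E\<close> is longer than \<open>L\<close>.\<close>
  define E where "E = L + 2 * C"
  \<comment> \<open>The window covers partners on \<open>\<beta>\<close>, which are at most
    \<open>C + k + 1\<close> steps from its end, and the at most \<open>2 k + 1\<close> edges that
    the splice cuts off from \<open>\<alpha>\<close>. The bound on the distance adds that cut-off
    piece and the at most \<open>k + 1\<close> edges of the splice after index
    \<open>a\<close>.\<close>
  have "close_ends k L (C + 2 * k + 3) ((2 * k + 1) * E + (k + 1) * E)"
    unfolding close_ends_def
  proof (intro allI impI)
    fix \<alpha> n \<beta> m
    assume \<alpha>: "R.geodesic \<alpha> n" and \<beta>: "R.geodesic \<beta> m" and ends: "\<alpha> 0 = \<beta> 0" "R.d (\<alpha> n) (\<beta> m) \<le> k"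
      and short\<alpha>: "\<forall>i<n. n \<le> i + (C + 2 * k + 3) \<longrightarrow> S.d (\<alpha> i) (\<alpha> (Suc i)) \<le> L"
      and short\<beta>: "\<forall>i<m. m \<le> i + (C + 2 * k + 3) \<longrightarrow> S.d (\<beta> i) (\<beta> (Suc i)) \<le> L"
    note \<alpha>c = R.geodesic_carrier[OF \<alpha>] and \<beta>c = R.geodesic_carrier[OF \<beta>]
    define k' where "k' = R.d (\<alpha> n) (\<beta> m)"
    have k': "k' \<le> k" using ends(2) by (simp add: k'_def)
    obtain \<eta> where \<eta>: "R.geodesic \<eta> k'" "\<eta> 0 = \<alpha> n" "\<eta> k' = \<beta> m"
      unfolding k'_def using R.geodesic_exists \<alpha>c \<beta>c by blast
    obtain \<pi> N a where \<pi>: "a \<le> n" "a \<le> N" "N \<le> a + k' + 1" "\<And>i. i \<le> a \<Longrightarrow> \<pi> i = \<alpha> i" "\<pi> N = \<eta> k'"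
      "quasi_geodesic (2 * k' + 2) \<pi> N" "no_backtrack \<pi> N"
      using splice_geodesics[OF \<alpha> \<eta>(1,2)] by metis
    have \<pi>q: "quasi_geodesic (2 * k + 2) \<pi> N" by (rule quasi_geodesic_mono[OF \<pi>(6)]) (use k' in simp)
    have \<pi>c: "\<pi> i \<in> carrier G" if "i \<le> N" for i using \<pi>q that by (simp add: quasi_geodesic_def)
    have \<pi>walk: "R.d (\<pi> i) (\<beta> m) \<le> N - i" if "i \<le> N" for i
      using R.d_walk[of i N \<pi>] \<pi>q that \<pi>(5) \<eta>(3) by (simp add: quasi_geodesic_def)
    have edge: "S.d (\<pi> i) (\<pi> (Suc i)) \<le> E" if i: "a \<le> i" "i < N" for i
    proof (rule ccontr)
      assume *: "\<not> S.d (\<pi> i) (\<pi> (Suc i)) \<le> E"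
      have "matched C (\<pi> i) (\<pi> (Suc i)) \<beta> m"
        by (rule penetrationD[OF C \<pi>q \<pi>(7) geodesic_quasi_geodesic[OF \<beta>] geodesic_no_backtrack[OF \<beta>]])
          (use ends \<pi> \<eta> i * in \<open>auto simp: E_def\<close>)
      then obtain l where l: "l < m" "S.d (\<pi> i) (\<beta> l) \<le> C" "S.d (\<pi> (Suc i)) (\<beta> (Suc l)) \<le> C"
        by (auto simp: matched_def)
      have "S.d (\<pi> i) (\<pi> (Suc i)) \<le> S.d (\<beta> l) (\<beta> (Suc l)) + C + C"
        using l i by (intro S_d_quadrilateral \<pi>c \<beta>c) auto
      then have "S.d (\<beta> l) (\<beta> (Suc l)) > L" using * by (simp add: E_def)
      moreover have "m - l \<le> C + 2 * k + 3"
      proof -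
        have "R.d (\<beta> l) (\<beta> m) \<le> R.d (\<beta> l) (\<pi> i) + R.d (\<pi> i) (\<beta> m)"
          using l i by (intro R.d_triangle \<pi>c \<beta>c) auto
        moreover have "R.d (\<beta> l) (\<pi> i) \<le> C"
          using R_d_le_S_d[of "\<pi> i" "\<beta> l"] R.d_sym[of "\<pi> i" "\<beta> l"] \<pi>c \<beta>c i l by simp
        moreover have "R.d (\<pi> i) (\<beta> m) \<le> k + 1" using \<pi>walk[of i] i \<pi>(3) k' by simp
        moreover have "R.d (\<beta> l) (\<beta> m) = m - l" using R.geodesic_d[OF \<beta>] l by simp
        ultimately show ?thesis by simp
      qed
      ultimately show False using short\<beta>[rule_format, of l] l(1) by linarith
    qed
    have "n - a \<le> 2 * k + 1"
    proof -
      have "R.d (\<alpha> a) (\<alpha> n) \<le> R.d (\<alpha> a) (\<beta> m) + R.d (\<beta> m) (\<alpha> n)"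
        using \<pi>(1) by (intro R.d_triangle \<alpha>c \<beta>c) auto
      moreover have "R.d (\<alpha> a) (\<beta> m) \<le> k + 1" using \<pi>walk[of a] \<pi>(2,3,4) k' by simp
      moreover have "R.d (\<beta> m) (\<alpha> n) \<le> k" using ends(2) R.d_sym[of "\<beta> m" "\<alpha> n"] \<alpha>c \<beta>c by simp
      moreover have "R.d (\<alpha> a) (\<alpha> n) = n - a" using R.geodesic_d[OF \<alpha>] \<pi>(1) by simp
      ultimately show ?thesis by simp
    qed
    moreover have "S.d (\<alpha> a) (\<alpha> n) \<le> (n - a) * L"
      using calculation by (intro S_d_chain) (use \<alpha>c short\<alpha> \<pi>(1) in auto)
    ultimately have "S.d (\<alpha> a) (\<alpha> n) \<le> (2 * k + 1) * E"
      using mult_le_mono[of "n - a" "2 * k + 1" L E] by (simp add: E_def)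
    moreover have "S.d (\<pi> a) (\<pi> N) \<le> (N - a) * E" using edge \<pi>c \<pi>(2) by (intro S_d_chain) auto
    moreover have "(N - a) * E \<le> (k + 1) * E" using \<pi>(3) k' by (intro mult_le_mono1) simp
    moreover have "S.d (\<alpha> n) (\<beta> m) \<le> S.d (\<alpha> a) (\<alpha> n) + S.d (\<alpha> a) (\<beta> m)"
      using S.d_triangle[of "\<alpha> n" "\<alpha> a" "\<beta> m"] S.d_sym[of "\<alpha> n" "\<alpha> a"] \<alpha>c \<beta>c \<pi>(1) by simp
    moreover have "\<pi> a = \<alpha> a" "\<pi> N = \<beta> m" using \<pi>(4,5) \<eta>(3) by auto
    ultimately show "S.d (\<alpha> n) (\<beta> m) \<le> (2 * k + 1) * E + (k + 1) * E" by (simp only:)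
  qed
  then show thesis by (rule that)
qed

text \<open>The element \<open>f\<close> can be recovered from
  \<open>inv x \<otimes> (f \<otimes> y)\<close>, which lies in the \<open>S\<close>-ball of radius
  \<open>r\<close> around the unit. Hence the bound does not depend on \<open>x\<close> and
  \<open>y\<close>.\<close>

lemma card_close:
  assumes "x \<in> carrier G" "y \<in> carrier G"
  shows "finite {f \<in> carrier G. S.d x (f \<otimes> y) \<le> r}"
    and "card {f \<in> carrier G. S.d x (f \<otimes> y) \<le> r} \<le> card {z \<in> carrier G. S.d \<one> z \<le> r}"
proof -
  let ?A = "{f \<in> carrier G. S.d x (f \<otimes> y) \<le> r}" and ?B = "{z \<in> carrier G. S.d \<one> z \<le> r}"
  let ?h = "\<lambda>f. inv x \<otimes> (f \<otimes> y)"
  have inj: "inj_on ?h ?A" using assms by (auto simp: inj_on_def)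
  have sub: "?h ` ?A \<subseteq> ?B"
  proof
    fix z assume "z \<in> ?h ` ?A"
    then obtain f where f: "f \<in> carrier G" "S.d x (f \<otimes> y) \<le> r" "z = ?h f" by auto
    then have "S.d \<one> z = S.d x (f \<otimes> y)"
      using S.d_translate[of x "f \<otimes> y" "inv x"] assms by simp
    then show "z \<in> ?B" using f assms by simp
  qed
  have fin: "finite ?B" by (intro S.finite_ball S_finite one_closed)
  show "finite ?A" using inj sub fin by (meson finite_imageD finite_subset)
  show "card ?A \<le> card ?B" using card_inj_on_le[OF inj sub fin] .
qed

text \<open>If the geodesic
  has a long edge away from its ends, then a translate that stays close to it contains an edge which is
  \<open>S\<close>-close to that edge. Otherwise the two geodesics are \<open>S\<close>-close at a vertex far from the ends.\<close>

lemma coarse_stabilizer_bounded: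
  assumes bcp: "bounded_coset_penetration G S Hs"
  shows "\<exists>W M. \<forall>\<gamma>. R.geodesic \<gamma> W \<longrightarrow>
    finite {f \<in> carrier G. \<forall>i\<le>W. R.d (f \<otimes> \<gamma> i) (\<gamma> i) \<le> k} \<and>
    card {f \<in> carrier G. \<forall>i\<le>W. R.d (f \<otimes> \<gamma> i) (\<gamma> i) \<le> k} \<le> M"
proof -
  obtain C where C: "matching k C" using matching_exists[OF bcp] .
  obtain B D where BD: "close_ends k (5 * C) B D" using close_ends_exists[OF bcp] .
  \<comment> \<open>The margins: from index \<open>w\<close> on, a partner is still more than
    \<open>C + k\<close> steps from the start; after \<open>t\<close> there remain
    \<open>w + 1\<close> steps for matching forward; and the last \<open>B\<close> edges before
    \<open>t\<close>, together with the errors of two comparisons, stay clear of the first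
    \<open>w\<close> edges.\<close>
  define w where "w = 2 * C + k + 5"
  define t where "t = w + B + 2 * C + 2 * k + 5"
  define W where "W = t + w + 1"
  define V where "V r = card {z \<in> carrier G. S.d \<one> z \<le> r}" for r
  have "finite {f \<in> carrier G. \<forall>i\<le>W. R.d (f \<otimes> \<gamma> i) (\<gamma> i) \<le> k} \<and>
    card {f \<in> carrier G. \<forall>i\<le>W. R.d (f \<otimes> \<gamma> i) (\<gamma> i) \<le> k} \<le> W * V (2 * C) + V D"
    if \<gamma>: "R.geodesic \<gamma> W" for \<gamma>
  proof -
    let ?\<Phi> = "{f \<in> carrier G. \<forall>i\<le>W. R.d (f \<otimes> \<gamma> i) (\<gamma> i) \<le> k}"
    note \<gamma>c = R.geodesic_carrier[OF \<gamma>]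
    have f\<gamma>: "R.geodesic (\<lambda>i. f \<otimes> \<gamma> i) W" if "f \<in> carrier G" for f
      using R.geodesic_translate[OF \<gamma> that] .
    have shift: "R.d (\<gamma> i) (f \<otimes> \<gamma> i) \<le> k" if "f \<in> ?\<Phi>" "i \<le> W" for f i
      using that(1) R.d_sym[of "f \<otimes> \<gamma> i" "\<gamma> i"] \<gamma>c[OF that(2)] that(2) by fastforce
    \<comment> \<open>Every passage to a partner costs at most \<open>2 C\<close> of
      \<open>S\<close>-length. The thresholds \<open>3 C\<close> here and \<open>5 C\<close> below
      leave an edge longer than \<open>C\<close>, respectively \<open>3 C\<close>, after one
      passage.\<close>
    show ?thesis
    proof (cases "\<exists>i. w \<le> i \<and> i < t \<and> S.d (\<gamma> i) (\<gamma> (Suc i)) > 3 * C")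
      case True
      then obtain i where i: "w \<le> i" "i < t" "S.d (\<gamma> i) (\<gamma> (Suc i)) > 3 * C" by blast
      have "?\<Phi> \<subseteq> (\<Union>j<W. {f \<in> carrier G. S.d (\<gamma> i) (f \<otimes> \<gamma> j) \<le> 2 * C})"
      proof
        fix f assume f: "f \<in> ?\<Phi>"
        then have fc: "f \<in> carrier G" by simp
        define m where "m = R.d (\<gamma> 0) (f \<otimes> \<gamma> W)"
        \<comment> \<open>The geodesics \<open>\<gamma>\<close> and its translate by
          \<open>f\<close> need not share an end. The auxiliary \<open>\<zeta>\<close> shares its
          start with the former and its end with the latter, so an edge is carried over in two
          matchings.\<close>
        obtain \<zeta> where \<zeta>: "R.geodesic \<zeta> m" "\<zeta> 0 = \<gamma> 0" "\<zeta> m = f \<otimes> \<gamma> W"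
          unfolding m_def using R.geodesic_exists[of "\<gamma> 0" "f \<otimes> \<gamma> W"] \<gamma>c fc by auto
        note \<zeta>c = R.geodesic_carrier[OF \<zeta>(1)]
        have "matched C (\<gamma> i) (\<gamma> (Suc i)) \<zeta> m"
          by (rule matching_forward[OF C \<gamma> \<zeta>(1)]) (use \<zeta> shift[OF f] i in \<open>auto simp: W_def w_def\<close>)
        then obtain l where l: "l < m" "S.d (\<gamma> i) (\<zeta> l) \<le> C" "S.d (\<gamma> (Suc i)) (\<zeta> (Suc l)) \<le> C"
          by (auto simp: matched_def)
        have iW: "i \<le> W" "Suc i \<le> W" using i by (auto simp: W_def)
        have "S.d (\<gamma> i) (\<gamma> (Suc i)) \<le> S.d (\<zeta> l) (\<zeta> (Suc l)) + C + C"
          using l iW by (intro S_d_quadrilateral \<gamma>c \<zeta>c) auto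
        then have long: "S.d (\<zeta> l) (\<zeta> (Suc l)) > C" using i(3) by simp
        have "R.d (\<gamma> 0) (\<zeta> l) = l" using R.geodesic_d[OF \<zeta>(1), of 0 l] \<zeta>(2) l by simp
        moreover have "R.d (\<gamma> 0) (\<gamma> i) = i" using R.geodesic_d[OF \<gamma>, of 0 i] iW by simp
        moreover have "R.d (\<gamma> 0) (\<gamma> i) \<le> R.d (\<gamma> 0) (\<zeta> l) + R.d (\<zeta> l) (\<gamma> i)"
          using l iW by (intro R.d_triangle \<gamma>c \<zeta>c) auto
        moreover have "R.d (\<zeta> l) (\<gamma> i) \<le> C"
          using R_d_le_S_d[of "\<gamma> i" "\<zeta> l"] R.d_sym[of "\<zeta> l" "\<gamma> i"] \<gamma>c[of i] \<zeta>c[of l] iW l by simp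
        ultimately have "C + k < l" using i(1) by (simp add: w_def)
        then have "matched C (\<zeta> l) (\<zeta> (Suc l)) (\<lambda>i. f \<otimes> \<gamma> i) W"
          using \<zeta> shift[OF f, of 0] l long by (intro matching_backward[OF C \<zeta>(1) f\<gamma>[OF fc]]) auto
        then obtain j where j: "j < W" "S.d (\<zeta> l) (f \<otimes> \<gamma> j) \<le> C" by (auto simp: matched_def)
        have "S.d (\<gamma> i) (f \<otimes> \<gamma> j) \<le> S.d (\<gamma> i) (\<zeta> l) + S.d (\<zeta> l) (f \<otimes> \<gamma> j)"
          using \<gamma>c[of i] \<gamma>c[of j] \<zeta>c[of l] fc iW l j by (intro S.d_triangle) auto
        then show "f \<in> (\<Union>j<W. {f \<in> carrier G. S.d (\<gamma> i) (f \<otimes> \<gamma> j) \<le> 2 * C})"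
          using fc j l(2) by (intro UN_I[of j]) auto
      qed
      moreover have "finite (\<Union>j<W. {f \<in> carrier G. S.d (\<gamma> i) (f \<otimes> \<gamma> j) \<le> 2 * C})"
        using card_close(1) \<gamma>c i(2) by (auto simp: W_def)
      moreover have "card (\<Union>j<W. {f \<in> carrier G. S.d (\<gamma> i) (f \<otimes> \<gamma> j) \<le> 2 * C}) \<le> W * V (2 * C)"
      proof -
        have "card (\<Union>j<W. {f \<in> carrier G. S.d (\<gamma> i) (f \<otimes> \<gamma> j) \<le> 2 * C})
          \<le> (\<Sum>j<W. card {f \<in> carrier G. S.d (\<gamma> i) (f \<otimes> \<gamma> j) \<le> 2 * C})" by (rule card_UN_le) simp
        also have "\<dots> \<le> (\<Sum>j<W. V (2 * C))"
          using card_close(2) \<gamma>c i(2) unfolding V_def by (intro sum_mono) (auto simp: W_def)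
        finally show ?thesis by simp
      qed
      ultimately show ?thesis by (meson card_mono finite_subset le_trans le_add1)
    next
      case False
      then have short: "S.d (\<gamma> i) (\<gamma> (Suc i)) \<le> 3 * C" if "w \<le> i" "i < t" for i using that by force
      have tW: "t \<le> W" by (simp add: W_def)
      have \<gamma>t: "R.geodesic \<gamma> t" using R.geodesic_shift[OF \<gamma>, of 0 t] tW by simp
      have "?\<Phi> \<subseteq> {f \<in> carrier G. S.d (\<gamma> t) (f \<otimes> \<gamma> t) \<le> D}"
      proof
        fix f assume f: "f \<in> ?\<Phi>"
        then have fc: "f \<in> carrier G" by simp
        have f\<gamma>t: "R.geodesic (\<lambda>i. f \<otimes> \<gamma> i) t" using R.geodesic_translate[OF \<gamma>t fc] .
        define m where "m = R.d (\<gamma> 0) (f \<otimes> \<gamma> t)"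
        obtain \<zeta> where \<zeta>: "R.geodesic \<zeta> m" "\<zeta> 0 = \<gamma> 0" "\<zeta> m = f \<otimes> \<gamma> t"
          unfolding m_def using R.geodesic_exists[of "\<gamma> 0" "f \<otimes> \<gamma> t"] \<gamma>c tW fc by auto
        note \<zeta>c = R.geodesic_carrier[OF \<zeta>(1)]
        have "R.d (\<gamma> 0) (\<gamma> t) \<le> R.d (\<gamma> 0) (f \<otimes> \<gamma> t) + R.d (f \<otimes> \<gamma> t) (\<gamma> t)"
          using \<gamma>c tW fc by (intro R.d_triangle) auto
        moreover have "R.d (\<gamma> 0) (\<gamma> t) = t" using R.geodesic_d[OF \<gamma>t, of 0 t] by simp
        ultimately have mt: "t \<le> m + k" using f tW unfolding m_def by fastforce
        have "S.d (\<gamma> t) (\<zeta> m) \<le> D"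
        proof (rule BD[unfolded close_ends_def, rule_format, OF \<gamma>t \<zeta>(1)])
          show "\<gamma> 0 = \<zeta> 0" "R.d (\<gamma> t) (\<zeta> m) \<le> k" using \<zeta> shift[OF f tW] by auto
          show "S.d (\<gamma> i) (\<gamma> (Suc i)) \<le> 5 * C" if "i < t" "t \<le> i + B" for i
            using short[of i] that by (simp add: t_def)
          fix l assume l: "l < m" "m \<le> l + B"
          show "S.d (\<zeta> l) (\<zeta> (Suc l)) \<le> 5 * C"
          proof (rule ccontr)
            assume *: "\<not> S.d (\<zeta> l) (\<zeta> (Suc l)) \<le> 5 * C"
            have "matched C (\<zeta> l) (\<zeta> (Suc l)) (\<lambda>i. f \<otimes> \<gamma> i) t"
              using \<zeta> shift[OF f, of 0] l mt * by (intro matching_backward[OF C \<zeta>(1) f\<gamma>t]) (auto simp: t_def)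
            then obtain j where j: "j < t" "S.d (\<zeta> l) (f \<otimes> \<gamma> j) \<le> C" "S.d (\<zeta> (Suc l)) (f \<otimes> \<gamma> (Suc j)) \<le> C"
              by (auto simp: matched_def)
            have jc: "\<gamma> j \<in> carrier G" "\<gamma> (Suc j) \<in> carrier G" "\<gamma> t \<in> carrier G" using \<gamma>c j(1) tW by auto
            have "S.d (\<zeta> l) (\<zeta> (Suc l)) \<le> S.d (f \<otimes> \<gamma> j) (f \<otimes> \<gamma> (Suc j)) + C + C"
              using l j jc fc by (intro S_d_quadrilateral \<zeta>c) auto
            then have "S.d (\<gamma> j) (\<gamma> (Suc j)) > 3 * C" using * S.d_translate[OF jc(1,2) fc] by simp
            \<comment> \<open>All edges between \<open>w\<close> and \<open>t\<close> are too short
              to be this partner. But an edge before \<open>w\<close> is too far from index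
              \<open>t\<close>, since edge \<open>l\<close> is at most \<open>B\<close> steps from
              the end of \<open>\<zeta>\<close>.\<close>
            then have "j < w" using short[of j] j by fastforce
            moreover have "R.d (f \<otimes> \<gamma> j) (f \<otimes> \<gamma> t) \<le> R.d (f \<otimes> \<gamma> j) (\<zeta> l) + R.d (\<zeta> l) (\<zeta> m)"
              using R.d_triangle[of "f \<otimes> \<gamma> j" "\<zeta> l" "\<zeta> m"] \<zeta>c l jc fc \<zeta>(3) by simp
            moreover have "R.d (f \<otimes> \<gamma> j) (\<zeta> l) \<le> C"
              using R_d_le_S_d[of "\<zeta> l" "f \<otimes> \<gamma> j"] R.d_sym[of "\<zeta> l" "f \<otimes> \<gamma> j"] \<zeta>c[of l] l j jc fc by simp
            moreover have "R.d (\<zeta> l) (\<zeta> m) = m - l" using R.geodesic_d[OF \<zeta>(1)] l by simp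
            moreover have "R.d (f \<otimes> \<gamma> j) (f \<otimes> \<gamma> t) = t - j" using R.geodesic_d[OF f\<gamma>t, of j t] j by simp
            ultimately show False using l by (simp add: t_def)
          qed
        qed
        then show "f \<in> {f \<in> carrier G. S.d (\<gamma> t) (f \<otimes> \<gamma> t) \<le> D}" using fc \<zeta>(3) by simp
      qed
      moreover note card_close[OF \<gamma>c[OF tW] \<gamma>c[OF tW], of D]
      ultimately show ?thesis unfolding V_def by (meson card_mono finite_subset le_trans le_add2)
    qed
  qed
  then show ?thesis by blast
qed

section \<open>Hyperbolicity and gluing\<close>

text \<open>Hyperbolicity is given for the geometric realization and applied at vertices, which are
  the indicator functions there. Adjacent vertices fall under the half-\<open>l1\<close> formula,
  distinct non-adjacent ones under the minimum over a single pair of ends.\<close>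

lemma realization_dist_vertices:
  assumes "x \<in> carrier G" "y \<in> carrier G"
  shows "realization_dist (carrier G) R.adj (indicator {x}) (indicator {y}) = R.d x y"
proof -
  have supp: "bary_support (indicator {z} :: 'a \<Rightarrow> real) = {z}" for z
    by (auto simp: bary_support_def indicator_def)
  show ?thesis
  proof (cases "x = y")
    case True
    then show ?thesis using assms by (auto simp: realization_dist_def supp graph_simplices_def)
  next
    case xy: False
    show ?thesis
    proof (cases "R.adj x y")
      case True
      have "R.d x y \<noteq> 0" using R.d_eq_0 assms xy by blast
      then have "R.d x y = 1" using R.d_adj[OF True] by simp
      moreover have "{x, y} \<in> graph_simplices (carrier G) R.adj" using True assms by (auto simp: graph_simplices_def)
      ultimately show ?thesis using xy by (auto simp: realization_dist_def supp insert_commute)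
    next
      case False
      then have "\<not> R.adj y x" using R.adj_sym by blast
      then have "{y, x} \<notin> graph_simplices (carrier G) R.adj"
        using xy False by (auto simp: graph_simplices_def doubleton_eq_iff)
      then show ?thesis by (simp add: realization_dist_def supp R.d_def)
    qed
  qed
qed

lemma vertex_graph_point:
  assumes "x \<in> carrier G" shows "(indicator {x} :: 'a \<Rightarrow> real) \<in> graph_points (carrier G) R.adj"
proof -
  have supp: "bary_support (indicator {x} :: 'a \<Rightarrow> real) = {x}"
    by (auto simp: bary_support_def indicator_def)
  show ?thesis unfolding graph_points_def mem_Collect_eq supp using assms by (auto simp: graph_simplices_def)
qed

section \<open>Gromov products at the unit and the drift of a translation\<close>

definition gp :: "'a \<Rightarrow> 'a \<Rightarrow> real" where
  "gp x y = gromov_product (\<lambda>x y. real (R.d x y)) \<one> x y"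

definition four_point :: "real \<Rightarrow> bool" where
  "four_point \<delta> \<longleftrightarrow> \<delta> \<ge> 0 \<and> (\<forall>x\<in>carrier G. \<forall>y\<in>carrier G. \<forall>z\<in>carrier G. min (gp x y) (gp y z) - \<delta> \<le> gp x z)"

lemma four_point_exists:
  assumes "weakly_relatively_hyperbolic G S Hs" obtains \<delta> where "four_point \<delta>"
proof -
  obtain \<delta> where \<delta>: "\<delta> \<ge> 0" "\<forall>w\<in>graph_points (carrier G) R.adj. \<forall>x\<in>graph_points (carrier G) R.adj.
    \<forall>y\<in>graph_points (carrier G) R.adj. \<forall>z\<in>graph_points (carrier G) R.adj.
        min (gromov_product (realization_dist (carrier G) R.adj) w x y)
          (gromov_product (realization_dist (carrier G) R.adj) w y z) - \<delta>
          \<le> gromov_product (realization_dist (carrier G) R.adj) w x z"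
    using assms unfolding weakly_relatively_hyperbolic_def gromov_hyperbolic_def by blast
  have "gromov_product (realization_dist (carrier G) R.adj) (indicator {\<one>}) (indicator {x}) (indicator {y}) = gp x y"
    if "x \<in> carrier G" "y \<in> carrier G" for x y
    using that by (simp add: gromov_product_def gp_def realization_dist_vertices)
  then have "four_point \<delta>"
    unfolding four_point_def using \<delta>(1) \<delta>(2)[rule_format, OF vertex_graph_point vertex_graph_point vertex_graph_point vertex_graph_point, of \<one>]
    by simp
  then show thesis by (rule that)
qed

abbreviation len :: "'a \<Rightarrow> real" where
  "len g \<equiv> real (R.d \<one> g)"

lemma gp_eq:
  assumes "x \<in> carrier G" "y \<in> carrier G"
  shows "2 * gp x y = len x + len y - R.d x y"
  using R.d_sym[of x \<one>] R.d_sym[of y \<one>] assms by (simp add: gp_def gromov_product_def)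

lemma gp_sym: "x \<in> carrier G \<Longrightarrow> y \<in> carrier G \<Longrightarrow> gp x y = gp y x"
  using R.d_sym[of x y] by (simp add: gp_def gromov_product_def)

lemma gp_le_len:
  assumes "x \<in> carrier G" "y \<in> carrier G" shows "gp x y \<le> len x"
proof -
  have "len y \<le> len x + R.d x y" using R.d_triangle[of \<one> x y] assms of_nat_mono by fastforce
  then show ?thesis using gp_eq[OF assms] by simp
qed

lemma four_pointD:
  "\<lbrakk>four_point \<delta>; x \<in> carrier G; y \<in> carrier G; z \<in> carrier G\<rbrakk> \<Longrightarrow> min (gp x y) (gp y z) \<le> gp x z + \<delta>"
  by (fastforce simp: four_point_def)

text \<open>Left translation by \<open>x\<close> carries the triangle with vertices
  \<open>inv x\<close>, unit and \<open>y\<close> to the one with vertices unit, \<open>x\<close>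
  and \<open>x \<otimes> y\<close>. The length lost in a product is therefore twice a Gromov product
  at the unit.\<close>

lemma len_mult:
  assumes "x \<in> carrier G" "y \<in> carrier G"
  shows "len (x \<otimes> y) = len x + len y - 2 * gp (inv x) y"
proof -
  have "R.d \<one> (inv x) = R.d \<one> x"
    using R.d_translate[of \<one> "inv x" x] R.d_sym[of x \<one>] assms by simp
  moreover have "R.d (inv x) y = R.d \<one> (x \<otimes> y)" using R.d_translate[of "inv x" y x] assms by simp
  ultimately show ?thesis using gp_eq[of "inv x" y] assms by simp
qed

lemma len_inv: "x \<in> carrier G \<Longrightarrow> len (inv x) = len x"
  using R.d_translate[of \<one> "inv x" x] R.d_sym[of x \<one>] by simp

text \<open>Both products with \<open>x\<close> are at most \<open>len x\<close>, hence at most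
  \<open>gp g h\<close>. So in the four-point inequality, read in both directions, the minimum is a
  product with \<open>x\<close>.\<close>

lemma gp_stable:
  assumes "four_point \<delta>" "x \<in> carrier G" "g \<in> carrier G" "h \<in> carrier G" "gp g h \<ge> len x"
  shows "\<bar>gp x g - gp x h\<bar> \<le> \<delta>"
proof -
  have "min (gp x g) (gp g h) \<le> gp x h + \<delta>" "min (gp x h) (gp h g) \<le> gp x g + \<delta>"
    using four_pointD assms by auto
  then show ?thesis using gp_le_len[of x g] gp_le_len[of x h] gp_sym[of g h] assms by (auto simp: min_def split: if_splits)
qed

text \<open>A finite-distance version of a Busemann cocycle, with \<open>h\<close> in place of a
  boundary point.\<close>

definition drift :: "'a \<Rightarrow> 'a \<Rightarrow> real" where
  "drift h f = len (f \<otimes> h) - len h"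

lemma drift_bound:
  assumes "h \<in> carrier G" "f \<in> carrier G" shows "\<bar>drift h f\<bar> \<le> len f"
proof -
  have "0 \<le> gp (inv f) h"
    using gp_eq[of "inv f" h] R.d_triangle[of "inv f" \<one> h] R.d_sym[of "inv f" \<one>] assms by simp
  then show ?thesis
    using len_mult[of f h] gp_le_len[of "inv f" h] len_inv assms by (simp add: drift_def)
qed

text \<open>By \<open>len_mult\<close> the drift of \<open>f\<close> sees \<open>h\<close> only
  through \<open>gp (inv f) h\<close>. When \<open>h\<close> and \<open>g \<otimes> h\<close> agree
  beyond radius \<open>len f\<close>, replacing one by the other changes this product by at most
  \<open>\<delta>\<close>.\<close>

lemma drift_quasi_morphism:
  assumes "four_point \<delta>" "h \<in> carrier G" "f \<in> carrier G" "g \<in> carrier G" "gp h (g \<otimes> h) \<ge> len f"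
  shows "\<bar>drift h (f \<otimes> g) - drift h f - drift h g\<bar> \<le> 2 * \<delta>"
proof -
  have "\<bar>gp (inv f) h - gp (inv f) (g \<otimes> h)\<bar> \<le> \<delta>"
    using gp_stable[OF assms(1), of "inv f" h "g \<otimes> h"] assms len_inv by simp
  moreover have "drift h (f \<otimes> g) = len f + len (g \<otimes> h) - 2 * gp (inv f) (g \<otimes> h) - len h"
    using len_mult[of f "g \<otimes> h"] assms by (simp add: drift_def m_assoc)
  moreover have "drift h f = len f - 2 * gp (inv f) h" using len_mult[of f h] assms by (simp add: drift_def)
  ultimately show ?thesis by (simp add: drift_def)
qed

text \<open>As \<open>t \<ge> len f\<close>, the point \<open>\<gamma> t\<close> is as good as
  \<open>h\<close> for computing products with \<open>inv f\<close>, so its translate has length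
  about \<open>t + drift h f\<close>. The four-point inequality through
  \<open>f \<otimes> h\<close>, which agrees with \<open>h\<close> up to radius \<open>t\<close>,
  then bounds the product of \<open>\<gamma> t\<close> with its translate from below.\<close>

lemma fellow_travel:
  assumes fp: "four_point \<delta>" and \<gamma>: "R.geodesic \<gamma> n" "\<gamma> 0 = \<one>" "\<gamma> n = h" and f: "f \<in> carrier G"
    and t: "t \<le> n" "len f \<le> t" and far: "gp h (f \<otimes> h) \<ge> t"
  shows "R.d (f \<otimes> \<gamma> t) (\<gamma> t) \<le> \<bar>drift h f\<bar> + 8 * \<delta>"
proof -
  note \<gamma>c = R.geodesic_carrier[OF \<gamma>(1)]
  have c: "h \<in> carrier G" "\<gamma> t \<in> carrier G" using \<gamma>c[of n] \<gamma>c[of t] \<gamma>(3) t by auto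
  have \<delta>: "\<delta> \<ge> 0" using fp by (simp add: four_point_def)
  have lh: "len h = n" "len (\<gamma> t) = t" "real (R.d (\<gamma> t) h) = real n - real t"
    using R.geodesic_d[OF \<gamma>(1), of 0 n] R.geodesic_d[OF \<gamma>(1), of 0 t] R.geodesic_d[OF \<gamma>(1), of t n] \<gamma> t
    by (auto simp: of_nat_diff)
  have gpt: "gp (\<gamma> t) h = t" using gp_eq[of "\<gamma> t" h] c lh t by simp
  have "\<bar>gp (inv f) (\<gamma> t) - gp (inv f) h\<bar> \<le> \<delta>"
    using gp_stable[OF fp, of "inv f" "\<gamma> t" h] c f len_inv gpt t by simp
  moreover have "len (f \<otimes> \<gamma> t) = len f + t - 2 * gp (inv f) (\<gamma> t)" using len_mult[of f "\<gamma> t"] f c lh by simp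
  moreover have j: "drift h f = len f - 2 * gp (inv f) h" using len_mult[of f h] f c by (simp add: drift_def)
  ultimately have l: "\<bar>len (f \<otimes> \<gamma> t) - t - drift h f\<bar> \<le> 2 * \<delta>" by linarith
  have "real (R.d (f \<otimes> \<gamma> t) (f \<otimes> h)) = real n - real t" using R.d_translate[of "\<gamma> t" h f] c f lh by simp
  then have g1: "gp (f \<otimes> \<gamma> t) (f \<otimes> h) \<ge> t + drift h f - \<delta>"
    using gp_eq[of "f \<otimes> \<gamma> t" "f \<otimes> h"] c f l lh by (simp add: drift_def)
  have "gp (f \<otimes> h) (\<gamma> t) \<ge> t - \<delta>"
    using four_pointD[OF fp, of "f \<otimes> h" h "\<gamma> t"] c f gpt far gp_sym[of h "f \<otimes> h"] gp_sym[of h "\<gamma> t"] by simp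
  moreover have "gp (f \<otimes> \<gamma> t) (f \<otimes> h) \<le> gp (f \<otimes> \<gamma> t) (\<gamma> t) + \<delta> \<or> gp (f \<otimes> h) (\<gamma> t) \<le> gp (f \<otimes> \<gamma> t) (\<gamma> t) + \<delta>"
    using four_pointD[OF fp, of "f \<otimes> \<gamma> t" "f \<otimes> h" "\<gamma> t"] c f unfolding min_le_iff_disj by simp
  ultimately have "gp (f \<otimes> \<gamma> t) (\<gamma> t) \<ge> t + drift h f - 2 * \<delta> \<or> gp (f \<otimes> \<gamma> t) (\<gamma> t) \<ge> t - 2 * \<delta>"
    using g1 by linarith
  moreover have "2 * gp (f \<otimes> \<gamma> t) (\<gamma> t) = len (f \<otimes> \<gamma> t) + t - R.d (f \<otimes> \<gamma> t) (\<gamma> t)"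
    using gp_eq[of "f \<otimes> \<gamma> t" "\<gamma> t"] c f lh by simp
  ultimately show ?thesis using l \<delta> by linarith
qed

text \<open>The order of quantifiers is the point: \<open>M\<close> depends on \<open>m\<close>
  alone, and only \<open>c\<close> depends on \<open>F\<close>. The segment of length
  \<open>W\<close> starting at the radius \<open>T\<close> of \<open>F\<close> on a geodesic to
  \<open>h\<close> is moved by a bounded relative distance, so the count of coarse stabilizers
  applies.\<close>

lemma small_drift_bounded:
  assumes fp: "four_point \<delta>" and bcp: "bounded_coset_penetration G S Hs"
  shows "\<exists>M. \<forall>F. finite F \<longrightarrow> F \<subseteq> carrier G \<longrightarrow>
    (\<exists>c. \<forall>h\<in>carrier G. (\<forall>f\<in>F. gp h (f \<otimes> h) \<ge> c) \<longrightarrow> card {f \<in> F. \<bar>drift h f\<bar> \<le> m} \<le> M)"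
proof -
  define \<Phi> where "\<Phi> W \<gamma> = {f \<in> carrier G. \<forall>i\<le>W. R.d (f \<otimes> \<gamma> i) (\<gamma> i) \<le> nat \<lceil>m + 8 * \<delta>\<rceil>}" for W :: nat and \<gamma>
  obtain W M where WM: "\<forall>\<gamma>. R.geodesic \<gamma> W \<longrightarrow> finite (\<Phi> W \<gamma>) \<and> card (\<Phi> W \<gamma>) \<le> M"
    using coarse_stabilizer_bounded[OF bcp] unfolding \<Phi>_def by blast
  have "\<exists>c. \<forall>h\<in>carrier G. (\<forall>f\<in>F. gp h (f \<otimes> h) \<ge> c) \<longrightarrow> card {f \<in> F. \<bar>drift h f\<bar> \<le> m} \<le> M"
    if F: "finite F" "F \<subseteq> carrier G" for F
  proof -
    obtain T where T: "\<And>f. f \<in> F \<Longrightarrow> R.d \<one> f \<le> T"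
      using finite_imageI[OF F(1), of "R.d \<one>"] unfolding finite_nat_set_iff_bounded_le by blast
    have "card {f \<in> F. \<bar>drift h f\<bar> \<le> m} \<le> M"
      if h: "h \<in> carrier G" and far: "\<And>f. f \<in> F \<Longrightarrow> gp h (f \<otimes> h) \<ge> real (T + W)" for h
    proof (cases "F = {}")
      case False
      then obtain f0 where "f0 \<in> F" by blast
      then have "real (T + W) \<le> len h" using far gp_le_len[of h "f0 \<otimes> h"] F h by fastforce
      then have TW: "T + W \<le> R.d \<one> h" by linarith
      obtain \<gamma> where \<gamma>: "R.geodesic \<gamma> (R.d \<one> h)" "\<gamma> 0 = \<one>" "\<gamma> (R.d \<one> h) = h"
        using R.geodesic_exists[of \<one> h] h by blast
      have \<gamma>W: "R.geodesic (\<lambda>i. \<gamma> (T + i)) W" using R.geodesic_shift[OF \<gamma>(1) TW] .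
      have "{f \<in> F. \<bar>drift h f\<bar> \<le> m} \<subseteq> \<Phi> W (\<lambda>i. \<gamma> (T + i))"
        unfolding \<Phi>_def
      proof (intro subsetI CollectI conjI allI impI)
        fix f i assume f: "f \<in> {f \<in> F. \<bar>drift h f\<bar> \<le> m}" and i: "i \<le> W"
        have "real (R.d (f \<otimes> \<gamma> (T + i)) (\<gamma> (T + i))) \<le> \<bar>drift h f\<bar> + 8 * \<delta>"
        proof (rule fellow_travel[OF fp \<gamma>])
          show "f \<in> carrier G" "T + i \<le> R.d \<one> h" "len f \<le> real (T + i)" using f i F T[of f] TW by auto
          show "real (T + i) \<le> gp h (f \<otimes> h)" using far[of f] f i by simp
        qed
        then show "R.d (f \<otimes> \<gamma> (T + i)) (\<gamma> (T + i)) \<le> nat \<lceil>m + 8 * \<delta>\<rceil>" using f by simp linarith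
      qed (use F in auto)
      then show ?thesis using WM[rule_format, OF \<gamma>W] by (meson card_mono le_trans)
    qed simp
    then show ?thesis by blast
  qed
  then show ?thesis by blast
qed

end

text \<open>After \<open>N\<close> steps the value is negative. The first negative value follows a
  nonnegative one and lies at most \<open>r\<close> below it.\<close>

lemma descent_through_zero:
  fixes b :: "nat \<Rightarrow> real" and N :: nat
  assumes "b 0 \<ge> 0" "b 0 < N" "\<And>k. k < N \<Longrightarrow> b (Suc k) \<le> b k - 1" "\<And>k. k < N \<Longrightarrow> b k - r \<le> b (Suc k)"
    and "r \<ge> 0"
  shows "\<exists>k\<le>N. \<bar>b k\<bar> \<le> r"
proof -
  have "b k \<le> b 0 - k" if "k \<le> N" for k
    using that
  proof (induction k)
    case (Suc k) then show ?case using assms(3)[of k] by simp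
  qed simp
  then have N: "b N < 0" using assms(2) by force
  define k where "k = (LEAST k. b k < 0)"
  have k: "b k < 0" "k \<le> N" unfolding k_def using N by (auto intro: LeastI Least_le)
  then obtain k' where k': "k = Suc k'" using assms(1) by (cases k) auto
  then have "b k' \<ge> 0" using not_less_Least[of k' "\<lambda>k. b k < 0"] unfolding k_def by simp
  then have "\<bar>b k\<bar> \<le> r" using assms(4)[of k'] k k' by simp
  then show ?thesis using k(2) by blast
qed

section \<open>Cosets of cyclic subgroups in a non-elementary group\<close>

lemma (in group) infinite_cyclic_cosets:
  assumes "non_elementary G" "g \<in> carrier G" shows "infinite (rcosets (generate G {g}))"
proof -
  let ?K = "generate G {g}"
  have K: "subgroup ?K G" using generate_is_subgroup[of "{g}"] assms(2) by simp
  have gK: "g \<in> ?K" by (simp add: generate.incl)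
  have "generate (G\<lparr>carrier := ?K\<rparr>) {g} = ?K"
    using generate_consistent[OF _ K, of "{g}"] gK by simp
  then have "cyclic_group (G\<lparr>carrier := ?K\<rparr>)"
    unfolding cyclic_group_def using gK
    by (intro bexI[of _ g]) (simp_all add: subgroup_generated_def)
  then show ?thesis using assms(1) K unfolding non_elementary_def by blast
qed

text \<open>The form in which non-elementarity is applied. For \<open>g = \<one>\<close> it provides
  finite subsets of any prescribed size.\<close>

lemma (in group) many_cyclic_cosets:
  assumes "non_elementary G" "g \<in> carrier G"
  shows "\<exists>A. finite A \<and> A \<subseteq> carrier G \<and> card A = n \<and> inj_on (\<lambda>f. generate G {g} #> f) A"
proof -
  let ?q = "\<lambda>f. generate G {g} #> f"
  have "infinite (?q ` carrier G)"
    using infinite_cyclic_cosets[OF assms] by (simp add: RCOSETS_def UNION_singleton_eq_range)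
  then obtain B where B: "finite B" "card B = n" "B \<subseteq> ?q ` carrier G"
    using infinite_arbitrarily_large by blast
  then obtain A where A: "A \<subseteq> carrier G" "inj_on ?q A" "B = ?q ` A" using subset_image_inj by metis
  then have "finite A" "card A = n" using B finite_imageD[of ?q A] card_image[of ?q A] by auto
  then show ?thesis using A by blast
qed

context relative_cayley_graph
begin

lemma nat_pow_in_generate:
  assumes "g \<in> carrier G" "u \<in> {g, inv g}" shows "u [^] (k::nat) \<in> generate G {g}"
proof (induction k)
  case 0 then show ?case by (simp add: generate.one)
next
  case (Suc k)
  have "u \<in> generate G {g}" using assms(2) by (auto intro: generate.incl generate.inv)
  then show ?case using Suc by (simp add: generate.eng)
qed

text \<open>If no finite set of translations separated the points \<open>h\<close> and \<open>f h\<close> as seen from the unit,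
  then \<open>drift h\<close> would be a quasi-morphism with uniformly finite fibres on arbitrarily large
  finite sets, and a cyclic subgroup on which it is unbounded would have finite index.\<close>

lemma finite_separation:
  assumes fp: "four_point \<delta>" and bcp: "bounded_coset_penetration G S Hs" and ne: "non_elementary G"
  obtains F c where "finite F" "F \<subseteq> carrier G" "\<forall>h\<in>carrier G. \<exists>f\<in>F. gp h (f \<otimes> h) < c"
proof (rule ccontr)
  assume "\<not> thesis"
  note separated = that
  have far: "\<exists>h\<in>carrier G. \<forall>f\<in>F. gp h (f \<otimes> h) \<ge> c" if F: "finite F" "F \<subseteq> carrier G" for F c
  proof (rule ccontr)
    assume "\<not> ?thesis"
    then have "\<forall>h\<in>carrier G. \<exists>f\<in>F. gp h (f \<otimes> h) < c" by (simp add: not_le)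
    then have thesis by (rule separated[OF F])
    then show False using \<open>\<not> thesis\<close> by blast
  qed
  \<comment> \<open>The defect of the quasi-morphism \<open>drift h\<close>.\<close>
  define \<epsilon> where "\<epsilon> = 2 * \<delta>"
  have \<epsilon>: "\<epsilon> \<ge> 0" using fp by (simp add: \<epsilon>_def four_point_def)
  \<comment> \<open>Two counts are prepared to be violated. \<open>F0\<close> outnumbers
    \<open>M1\<close>, so some \<open>g\<close> in it has drift beyond
    \<open>\<epsilon> + 1\<close>. For each such candidate \<open>A g\<close> meets more than
    \<open>M2\<close> cosets of its cyclic subgroup, and every coset will be shown to contain an
    element of drift at most \<open>r + \<epsilon>\<close>.\<close>
  obtain M1 where M1: "\<forall>F. finite F \<longrightarrow> F \<subseteq> carrier G \<longrightarrow> (\<exists>c. \<forall>h\<in>carrier G.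
      (\<forall>f\<in>F. gp h (f \<otimes> h) \<ge> c) \<longrightarrow> card {f \<in> F. \<bar>drift h f\<bar> \<le> \<epsilon> + 1} \<le> M1)"
    using small_drift_bounded[OF fp bcp] by (rule exE)
  obtain F0 where F0: "finite F0" "F0 \<subseteq> carrier G" "card F0 = Suc M1"
    using many_cyclic_cosets[OF ne one_closed, of "Suc M1"] by (elim exE conjE)
  obtain r :: nat where r: "\<And>g. g \<in> F0 \<Longrightarrow> R.d \<one> g \<le> r"
    using finite_imageI[OF F0(1), of "R.d \<one>"] unfolding finite_nat_set_iff_bounded_le by blast
  obtain M2 where M2: "\<forall>F. finite F \<longrightarrow> F \<subseteq> carrier G \<longrightarrow> (\<exists>c. \<forall>h\<in>carrier G.
      (\<forall>f\<in>F. gp h (f \<otimes> h) \<ge> c) \<longrightarrow> card {f \<in> F. \<bar>drift h f\<bar> \<le> r + \<epsilon>} \<le> M2)"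
    using small_drift_bounded[OF fp bcp] by (rule exE)
  have "\<forall>g\<in>F0. \<exists>A. finite A \<and> A \<subseteq> carrier G \<and> card A = Suc M2 \<and> inj_on (\<lambda>f. generate G {g} #> f) A"
    using many_cyclic_cosets[OF ne] F0(2) by blast
  then obtain A where A_ball: "\<forall>g\<in>F0. finite (A g) \<and> A g \<subseteq> carrier G \<and> card (A g) = Suc M2 \<and>
      inj_on (\<lambda>f. generate G {g} #> f) (A g)"
    by (rule bchoice[THEN exE])
  note A = A_ball[rule_format]
  obtain N :: nat where N: "\<And>f. f \<in> \<Union>(A ` F0) \<Longrightarrow> R.d \<one> f < N"
  proof -
    have "finite (R.d \<one> ` \<Union>(A ` F0))" using F0(1) A_ball by (intro finite_imageI finite_UN_I) auto
    then show thesis using that unfolding finite_nat_set_iff_bounded by blast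
  qed
  \<comment> \<open>Whole orbit segments are included, in both directions, so that the
    quasi-morphism inequality is available at each step of the descent.\<close>
  define F where "F = F0 \<union> (\<Union>g\<in>F0. (\<lambda>(u, k, f). u [^] k \<otimes> f) ` ({g, inv g} \<times> {..N} \<times> A g))"
  have "u [^] k \<otimes> f \<in> carrier G" if "g \<in> F0" "u \<in> {g, inv g}" "f \<in> A g" for g u f and k :: nat
    using that F0(2) A[OF that(1)] by (intro m_closed nat_pow_closed) auto
  then have F: "finite F" "F \<subseteq> carrier G" "F0 \<subseteq> F"
    using F0(1,2) A_ball unfolding F_def
    by (auto intro!: finite_UN_I finite_imageI finite_cartesian_product simp del: insert_iff)
  have orbit_F: "u [^] k \<otimes> f \<in> F" if "g \<in> F0" "u \<in> {g, inv g}" "k \<le> N" "f \<in> A g" for g u k f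
    unfolding F_def using that by (intro UnI2 UN_I[of g] image_eqI[of _ _ "(u, k, f)"]) auto
  obtain c1 where c1: "\<forall>h\<in>carrier G. (\<forall>f\<in>F. gp h (f \<otimes> h) \<ge> c1) \<longrightarrow> card {f \<in> F. \<bar>drift h f\<bar> \<le> \<epsilon> + 1} \<le> M1"
    using M1[rule_format, OF F(1,2)] by (rule exE)
  obtain c2 where c2: "\<forall>h\<in>carrier G. (\<forall>f\<in>F. gp h (f \<otimes> h) \<ge> c2) \<longrightarrow> card {f \<in> F. \<bar>drift h f\<bar> \<le> r + \<epsilon>} \<le> M2"
    using M2[rule_format, OF F(1,2)] by (rule exE)
  obtain h where h: "h \<in> carrier G" "\<forall>f\<in>F. gp h (f \<otimes> h) \<ge> max (real r) (max c1 c2)"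
    using far[OF F(1,2)] by blast
  have card1: "card {f \<in> F. \<bar>drift h f\<bar> \<le> \<epsilon> + 1} \<le> M1" by (rule c1[rule_format]) (use h in auto)
  have card2: "card {f \<in> F. \<bar>drift h f\<bar> \<le> r + \<epsilon>} \<le> M2" by (rule c2[rule_format]) (use h in auto)
  have "\<exists>g\<in>F0. \<bar>drift h g\<bar> > \<epsilon> + 1"
  proof (rule ccontr)
    assume "\<not> ?thesis"
    then have "F0 \<subseteq> {f \<in> F. \<bar>drift h f\<bar> \<le> \<epsilon> + 1}" using F(3) by (auto simp: not_less)
    moreover have "finite {f \<in> F. \<bar>drift h f\<bar> \<le> \<epsilon> + 1}" using F(1) by simp
    ultimately have "card F0 \<le> card {f \<in> F. \<bar>drift h f\<bar> \<le> \<epsilon> + 1}" by (intro card_mono)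
    then show False using F0(3) card1 by simp
  qed
  then obtain g where g: "g \<in> F0" "\<bar>drift h g\<bar> > \<epsilon> + 1" by blast
  have gc: "g \<in> carrier G" using g F0 by blast
  have gr: "\<bar>drift h g\<bar> \<le> r" using drift_bound[OF h(1) gc] r[OF g(1)] by simp
  have qm: "\<bar>drift h (g \<otimes> x) - drift h g - drift h x\<bar> \<le> \<epsilon>" if "x \<in> F" for x
  proof -
    have "x \<in> carrier G" "gp h (x \<otimes> h) \<ge> r" using h(2) that F(2) by auto
    then show ?thesis unfolding \<epsilon>_def using r[OF g(1)] by (intro drift_quasi_morphism[OF fp h(1) gc]) auto
  qed
  have "\<exists>y\<in>{x \<in> F. \<bar>drift h x\<bar> \<le> r + \<epsilon>}. y \<in> generate G {g} #> f" if f: "f \<in> A g" for f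
  proof -
    \<comment> \<open>The sign \<open>s\<close> makes the descent start at a nonnegative value, and
      \<open>u\<close> is whichever of \<open>g\<close> and its inverse decreases that
      value.\<close>
    define s :: real where "s = (if drift h f \<ge> 0 then 1 else -1)"
    define u where "u = (if s * drift h g < 0 then g else inv g)"
    have u: "u \<in> {g, inv g}" "u \<in> carrier G" using gc by (auto simp: u_def)
    have fc: "f \<in> carrier G" using A[OF g(1)] f by blast
    define b where "b k = s * drift h (u [^] k \<otimes> f)" for k :: nat
    have b_abs: "\<bar>b k\<bar> = \<bar>drift h (u [^] k \<otimes> f)\<bar>" for k by (simp add: b_def s_def)
    have step: "b (Suc k) \<le> b k - 1 \<and> b k - (r + \<epsilon>) \<le> b (Suc k)" if k: "k < N" for k
    proof -
      let ?x = "u [^] k \<otimes> f"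
      have u_Suc: "u [^] Suc k \<otimes> f = u \<otimes> ?x"
        by (simp only: nat_pow_Suc2[OF u(2)] m_assoc[OF u(2) nat_pow_closed[OF u(2)] fc])
      have xF: "?x \<in> F" "u \<otimes> ?x \<in> F"
        using orbit_F[OF g(1) u(1) _ f, of k] orbit_F[OF g(1) u(1) _ f, of "Suc k"] k
        unfolding u_Suc by simp_all
      have bS: "b (Suc k) = s * drift h (u \<otimes> ?x)" by (simp only: b_def u_Suc)
      have bk: "b k = s * drift h ?x" by (simp only: b_def)
      have xc: "?x \<in> carrier G" using u fc by simp
      show ?thesis
      proof (cases "s * drift h g < 0")
        case True
        then have "u = g" by (simp add: u_def)
        then have "\<bar>drift h (u \<otimes> ?x) - drift h g - drift h ?x\<bar> \<le> \<epsilon>" using qm[OF xF(1)] by simp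
        then show ?thesis using True g(2) gr unfolding bS bk s_def by (auto split: if_splits)
      next
        case False
        then have u': "u = inv g" by (simp add: u_def)
        \<comment> \<open>The inequality \<open>qm\<close> concerns left multiplication by
          \<open>g\<close>. For \<open>u = inv g\<close> it is therefore read at the later point of
          the orbit.\<close>
        have "g \<otimes> (u \<otimes> ?x) = ?x" using gc xc u' by (simp flip: m_assoc)
        then have "\<bar>drift h ?x - drift h g - drift h (u \<otimes> ?x)\<bar> \<le> \<epsilon>" using qm[OF xF(2)] by simp
        then show ?thesis using False g(2) gr unfolding bS bk s_def by (auto split: if_splits)
      qed
    qed
    have "\<exists>k\<le>N. \<bar>b k\<bar> \<le> r + \<epsilon>"
    proof (rule descent_through_zero)
      show "b 0 \<ge> 0" using fc by (simp add: b_def s_def)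
      have "\<bar>drift h f\<bar> \<le> len f" using drift_bound h fc by blast
      moreover have "len f < N" using N[of f] f g(1) by force
      ultimately show "b 0 < N" using fc by (auto simp: b_def s_def)
    qed (use step \<epsilon> in auto)
    then obtain k where k: "k \<le> N" "\<bar>drift h (u [^] k \<otimes> f)\<bar> \<le> r + \<epsilon>" using b_abs by auto
    have "u [^] k \<otimes> f \<in> generate G {g} #> f"
      using nat_pow_in_generate[OF gc u(1)] generate_incl[of "{g}"] gc fc by (intro rcosI) auto
    then show ?thesis using k orbit_F[OF g(1) u(1) k(1) f] by blast
  qed
  then have "\<forall>f\<in>A g. \<exists>y. y \<in> {x \<in> F. \<bar>drift h x\<bar> \<le> r + \<epsilon>} \<and> y \<in> generate G {g} #> f" by blast
  then obtain \<phi> where \<phi>_ball: "\<forall>f\<in>A g. \<phi> f \<in> {x \<in> F. \<bar>drift h x\<bar> \<le> r + \<epsilon>} \<and> \<phi> f \<in> generate G {g} #> f"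
    by (rule bchoice[THEN exE])
  note \<phi> = \<phi>_ball[rule_format]
  have "inj_on \<phi> (A g)"
  proof (rule inj_onI)
    fix f f' assume ff: "f \<in> A g" "f' \<in> A g" "\<phi> f = \<phi> f'"
    have K: "subgroup (generate G {g}) G" using generate_is_subgroup[of "{g}"] gc by simp
    have "f \<in> carrier G" "f' \<in> carrier G" using A[OF g(1)] ff by auto
    then have "generate G {g} #> f = generate G {g} #> \<phi> f" "generate G {g} #> f' = generate G {g} #> \<phi> f'"
      using repr_independence[OF _ _ K] \<phi> ff by blast+
    then show "f = f'" using ff A[OF g(1)] unfolding inj_on_def by simp
  qed
  then have "card (A g) \<le> card {x \<in> F. \<bar>drift h x\<bar> \<le> r + \<epsilon>}" using \<phi> F(1) by (intro card_inj_on_le[of \<phi>]) auto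
  then show False using card2 A[OF g(1)] by simp
qed

text \<open>If \<open>inv g\<close> and \<open>h\<close> have a small product, the unit glues, which
  is why it is added to \<open>F\<close>. Otherwise \<open>inv g\<close> and \<open>h\<close> point
  in the same direction; an \<open>f\<close> separating \<open>f \<otimes> h\<close> from
  \<open>h\<close> then separates it from \<open>inv g\<close> as well, by the four-point
  inequality.\<close>

lemma length_gluing:
  assumes "weakly_relatively_hyperbolic G S Hs" "bounded_coset_penetration G S Hs" "non_elementary G"
  obtains F C where "finite F" "F \<subseteq> carrier G"
    "\<forall>g\<in>carrier G. \<forall>h\<in>carrier G. \<exists>f\<in>F. R.d \<one> g + R.d \<one> h \<le> R.d \<one> (g \<otimes> f \<otimes> h) + C"
proof -
  obtain \<delta> where fp: "four_point \<delta>" using four_point_exists[OF assms(1)] .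
  obtain F c where F: "finite F" "F \<subseteq> carrier G" "\<forall>h\<in>carrier G. \<exists>f\<in>F. gp h (f \<otimes> h) < c"
    using finite_separation[OF fp assms(2,3)] .
  obtain r :: nat where r: "\<And>f. f \<in> F \<Longrightarrow> R.d \<one> f \<le> r"
    using finite_imageI[OF F(1), of "R.d \<one>"] unfolding finite_nat_set_iff_bounded_le by blast
  define C where "C = nat \<lceil>r + 2 * (c + \<delta>)\<rceil>"
  have "\<exists>f\<in>insert \<one> F. R.d \<one> g + R.d \<one> h \<le> R.d \<one> (g \<otimes> f \<otimes> h) + C"
    if gh: "g \<in> carrier G" "h \<in> carrier G" for g h
  proof (cases "gp (inv g) h \<le> c + \<delta>")
    case True
    then have "len g + len h \<le> len (g \<otimes> h) + 2 * (c + \<delta>)" using len_mult[OF gh] by simp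
    then have "R.d \<one> g + R.d \<one> h \<le> R.d \<one> (g \<otimes> h) + C" unfolding C_def by linarith
    then show ?thesis using gh by simp
  next
    case False
    obtain f where f: "f \<in> F" "gp h (f \<otimes> h) < c" using F(3) gh by blast
    have fc: "f \<in> carrier G" using f F by blast
    have "gp h (inv g) \<le> gp h (f \<otimes> h) + \<delta> \<or> gp (inv g) (f \<otimes> h) \<le> gp h (f \<otimes> h) + \<delta>"
      using four_pointD[OF fp, of h "inv g" "f \<otimes> h"] gh fc unfolding min_le_iff_disj by simp
    then have "gp (inv g) (f \<otimes> h) \<le> c + \<delta>" using False f(2) gp_sym[of h "inv g"] gh by auto
    moreover have "len h \<le> len (f \<otimes> h) + r"
      using drift_bound[OF gh(2) fc] r[OF f(1)] by (simp add: drift_def)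
    moreover have "len (g \<otimes> f \<otimes> h) = len g + len (f \<otimes> h) - 2 * gp (inv g) (f \<otimes> h)"
      using len_mult[of g "f \<otimes> h"] gh fc by (simp add: m_assoc)
    ultimately have "len g + len h \<le> len (g \<otimes> f \<otimes> h) + (r + 2 * (c + \<delta>))"
      by (smt (verit))
    then have "R.d \<one> g + R.d \<one> h \<le> R.d \<one> (g \<otimes> f \<otimes> h) + C" unfolding C_def by linarith
    then show ?thesis using f(1) by blast
  qed
  then show thesis using that[of "insert \<one> F" C] F(1,2) by auto
qed

end

section \<open>Super-multiplicative sequences of laws\<close>

abbreviation pmf_prob :: "'c pmf \<Rightarrow> 'c set \<Rightarrow> real" where
  "pmf_prob p A \<equiv> measure (measure_pmf p) A"

definition window :: "nat \<Rightarrow> real \<Rightarrow> real \<Rightarrow> real set" where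
  "window n x e = {real n * (x - e)..real n * (x + e)}"

text \<open>This says that the local exponential decay rate at \<open>x\<close>, computed with lower
  limits in time, is at most \<open>s\<close>, without logarithms of possibly vanishing
  probabilities.\<close>

definition attained :: "(nat \<Rightarrow> real pmf) \<Rightarrow> real \<Rightarrow> real \<Rightarrow> bool" where
  "attained Q x s \<longleftrightarrow> (\<forall>e>0. \<forall>\<delta>>0. \<forall>\<^sub>F n in sequentially. exp (- (real n * (s + \<delta>))) \<le> pmf_prob (Q n) (window n x e))"

lemma attained_mono:
  assumes "attained Q x s" "s \<le> s'" shows "attained Q x s'"
  unfolding attained_def
proof (intro allI impI)
  fix e \<delta> :: real assume "e > 0" "\<delta> > 0"
  then have "\<forall>\<^sub>F n in sequentially. exp (- (real n * (s + \<delta>))) \<le> pmf_prob (Q n) (window n x e)"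
    using assms(1) by (simp add: attained_def)
  then show "\<forall>\<^sub>F n in sequentially. exp (- (real n * (s' + \<delta>))) \<le> pmf_prob (Q n) (window n x e)"
  proof eventually_elim
    case (elim n)
    have "exp (- (real n * (s' + \<delta>))) \<le> exp (- (real n * (s + \<delta>)))"
      using assms(2) by (simp add: mult_left_mono)
    then show ?case using elim by linarith
  qed
qed

lemma attained_closed:
  assumes "\<And>\<eta>. \<eta> > 0 \<Longrightarrow> attained Q x (s + \<eta>)" shows "attained Q x s"
  unfolding attained_def
proof (intro allI impI)
  fix e \<delta> :: real assume e: "e > 0" "\<delta> > 0"
  then have "\<forall>\<^sub>F n in sequentially. exp (- (real n * ((s + \<delta> / 2) + \<delta> / 2))) \<le> pmf_prob (Q n) (window n x e)"
    using assms[of "\<delta> / 2"] unfolding attained_def by (meson half_gt_zero)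
  moreover have "s + \<delta> / 2 + \<delta> / 2 = s + \<delta>" by simp
  ultimately show "\<forall>\<^sub>F n in sequentially. exp (- (real n * (s + \<delta>))) \<le> pmf_prob (Q n) (window n x e)"
    by simp
qed

lemma window_subset:
  assumes "\<bar>y - x\<bar> + e' \<le> e" shows "window n y e' \<subseteq> window n x e"
proof
  fix z assume z: "z \<in> window n y e'"
  have "real n * (x - e) \<le> real n * (y - e')" "real n * (y + e') \<le> real n * (x + e)"
    using assms by (auto intro!: mult_left_mono)
  then show "z \<in> window n x e" using z by (auto simp: window_def)
qed

lemma closed_attained: "closed {x. attained Q x s}"
proof -
  have "open (- {x. attained Q x s})"
    unfolding open_dist
  proof
    fix x assume "x \<in> - {x. attained Q x s}"
    then obtain e \<delta> where e: "e > 0" "\<delta> > 0"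
      "\<not> (\<forall>\<^sub>F n in sequentially. exp (- (real n * (s + \<delta>))) \<le> pmf_prob (Q n) (window n x e))"
      unfolding attained_def by auto
    have "y \<in> - {x. attained Q x s}" if "dist y x < e / 2" for y
    proof
      assume "y \<in> {x. attained Q x s}"
      then have "\<forall>\<^sub>F n in sequentially. exp (- (real n * (s + \<delta>))) \<le> pmf_prob (Q n) (window n y (e / 2))"
        using e by (simp add: attained_def)
      then have "\<forall>\<^sub>F n in sequentially. exp (- (real n * (s + \<delta>))) \<le> pmf_prob (Q n) (window n x e)"
      proof eventually_elim
        case (elim n)
        have "pmf_prob (Q n) (window n y (e / 2)) \<le> pmf_prob (Q n) (window n x e)"
          using that by (intro measure_pmf.finite_measure_mono window_subset) (auto simp: dist_real_def)
        then show ?case using elim by linarith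
      qed
      then show False using e by blast
    qed
    then show "\<exists>e>0. \<forall>y. dist y x < e \<longrightarrow> y \<in> - {x. attained Q x s}" using e by (intro exI[of _ "e / 2"]) simp
  qed
  then show ?thesis by (simp add: closed_def)
qed

lemma eventually_large:
  assumes "a > 0" shows "\<forall>\<^sub>F n in sequentially. B \<le> real n * a"
proof -
  have "\<forall>\<^sub>F n in sequentially. B / a \<le> real n"
    using filterlim_real_sequentially by (auto simp: filterlim_at_top)
  then show ?thesis by eventually_elim (use assms in \<open>simp add: field_simps\<close>)
qed

locale super_multiplicative =
  fixes Q :: "nat \<Rightarrow> real pmf" and K :: nat and C c :: real
  assumes c_pos: "c > 0" and C_nonneg: "C \<ge> 0"
    and super_mult: "c * pmf_prob (Q n) {a..b} * pmf_prob (Q m) {a'..b'} \<le> pmf_prob (Q (n + m + K)) {a + a' - C..b + b' + C}"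
begin

text \<open>Each of the \<open>q\<close> full blocks pays the factor \<open>c\<close>, the delay
  \<open>K\<close> and the error \<open>C\<close> once. The block of length \<open>m\<close> is
  reserved for the remainder of a division.\<close>

lemma super_mult_power:
  "pmf_prob (Q m) {a'..b'} * (c * pmf_prob (Q n) {a..b}) ^ q
    \<le> pmf_prob (Q (m + q * (n + K))) {a' + q * (a - C)..b' + q * (b + C)}"
proof (induction q)
  case (Suc q)
  let ?I = "{a' + q * (a - C)..b' + q * (b + C)}"
  have "pmf_prob (Q m) {a'..b'} * (c * pmf_prob (Q n) {a..b}) ^ Suc q
    \<le> c * pmf_prob (Q n) {a..b} * pmf_prob (Q (m + q * (n + K))) ?I"
    using mult_left_mono[OF Suc, of "c * pmf_prob (Q n) {a..b}"] c_pos by (simp add: mult_ac)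
  also have "\<dots> \<le> pmf_prob (Q (n + (m + q * (n + K)) + K)) {a + (a' + q * (a - C)) - C..b + (b' + q * (b + C)) + C}"
    by (rule super_mult)
  also have "n + (m + q * (n + K)) + K = m + Suc q * (n + K)" by (simp add: algebra_simps)
  also have "a + (a' + q * (a - C)) - C = a' + Suc q * (a - C)" by (simp add: algebra_simps)
  also have "b + (b' + q * (b + C)) + C = b' + Suc q * (b + C)" by (simp add: algebra_simps)
  finally show ?case .
qed simp

text \<open>The Ruelle-Lanford argument: a good bound at a single large time \<open>n\<close> propagates to all large times
  \<open>N = m + q (n + K)\<close> with \<open>m < n + K\<close>.\<close>

lemma attained_if_frequently:
  assumes x: "x \<ge> 0" and s: "s \<ge> 0"
    and freq: "\<And>e \<delta>. e > 0 \<Longrightarrow> \<delta> > 0 \<Longrightarrow>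
      \<exists>\<^sub>F n in sequentially. exp (- (real n * (s + \<delta>))) \<le> pmf_prob (Q n) (window n x e)"
  shows "attained Q x s"
  unfolding attained_def
proof (intro allI impI)
  fix e \<delta> :: real assume e: "e > 0" "\<delta> > 0"
  have "\<exists>\<^sub>F n in sequentially. exp (- (real n * (s + \<delta> / 2))) \<le> pmf_prob (Q n) (window n x (e / 2))"
    using e by (intro freq) auto
  \<comment> \<open>The budget: in space, \<open>e / 2\<close> goes to the window at time
    \<open>n\<close> and \<open>e / 8\<close> to each of the errors from \<open>B\<close>, from
    \<open>C\<close>, from the delays \<open>K\<close> and from the remainder \<open>m\<close>. In
    the exponent, \<open>\<delta> / 2\<close> goes to the bound at time \<open>n\<close> and
    \<open>\<delta> / 4\<close> to each of \<open>c\<close> and \<open>\<theta>\<close>.\<close>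
  moreover have "\<forall>\<^sub>F n in sequentially. 1 \<le> n \<and> - ln c \<le> real n * (\<delta> / 4) \<and> C \<le> real n * (e / 8) \<and> K * x \<le> real n * (e / 8)"
    using e by (intro eventually_conj eventually_large eventually_ge_at_top) auto
  ultimately obtain n where "(1 \<le> n \<and> - ln c \<le> real n * (\<delta> / 4) \<and> C \<le> real n * (e / 8) \<and> K * x \<le> real n * (e / 8)) \<and>
      exp (- (real n * (s + \<delta> / 2))) \<le> pmf_prob (Q n) (window n x (e / 2))"
    by (rule frequently_eventually_conj[THEN frequently_ex, THEN exE])
  then have n: "exp (- (real n * (s + \<delta> / 2))) \<le> pmf_prob (Q n) (window n x (e / 2))"
    "n \<ge> 1" "- ln c \<le> real n * (\<delta> / 4)" "C \<le> real n * (e / 8)" "K * x \<le> real n * (e / 8)"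
    by auto
  define L where "L = n + K"
  \<comment> \<open>Only finitely many remainders occur. One interval, from \<open>- B\<close> to
    \<open>B\<close>, has mass at least \<open>\<theta>\<close> under all their laws, without any
    moment bound.\<close>
  have "\<forall>m. \<exists>y. y \<in> set_pmf (Q m)" using set_pmf_not_empty by fast
  then obtain y where y: "\<And>m. y m \<in> set_pmf (Q m)" by metis
  define B where "B = Max ((\<lambda>m. \<bar>y m\<bar>) ` {..<L})"
  define \<theta> where "\<theta> = Min ((\<lambda>m. pmf (Q m) (y m)) ` {..<L})"
  have L: "L > 0" using n(2) by (simp add: L_def)
  have \<theta>: "\<theta> > 0" unfolding \<theta>_def using L y by (subst Min_gr_iff) (auto simp: pmf_positive)
  have base: "\<theta> \<le> pmf_prob (Q m) {-B..B}" if "m < L" for m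
  proof -
    have "\<theta> \<le> pmf (Q m) (y m)" unfolding \<theta>_def using that by (intro Min_le) auto
    also have "\<bar>y m\<bar> \<le> B" unfolding B_def using that by (intro Max_ge) auto
    then have "pmf_prob (Q m) {y m} \<le> pmf_prob (Q m) {-B..B}"
      by (intro measure_pmf.finite_measure_mono) auto
    then have "pmf (Q m) (y m) \<le> pmf_prob (Q m) {-B..B}" by (simp add: measure_pmf_single)
    finally show ?thesis .
  qed
  define P where "P = pmf_prob (Q n) (window n x (e / 2))"
  have cP: "exp (- (real n * (s + 3 * \<delta> / 4))) \<le> c * P"
  proof -
    have "exp (- (real n * (\<delta> / 4))) \<le> exp (ln c)" using n(3) by simp
    then have "exp (- (real n * (\<delta> / 4))) \<le> c" using c_pos by simp
    then have "exp (- (real n * (\<delta> / 4))) * exp (- (real n * (s + \<delta> / 2))) \<le> c * P"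
      using n(1) c_pos unfolding P_def by (intro mult_mono) auto
    then show ?thesis by (simp add: algebra_simps flip: exp_add)
  qed
  have "\<forall>\<^sub>F N in sequentially. B \<le> real N * (e / 8) \<and> - ln \<theta> \<le> real N * (\<delta> / 4) \<and> L * x \<le> real N * (e / 8)"
    using e by (intro eventually_conj eventually_large) auto
  then show "\<forall>\<^sub>F N in sequentially. exp (- (real N * (s + \<delta>))) \<le> pmf_prob (Q N) (window N x e)"
  proof eventually_elim
    case (elim N)
    define q m where "q = N div L" and "m = N mod L"
    have m: "m < L" using L by (simp add: m_def)
    have N: "N = m + q * (n + K)" unfolding q_def m_def L_def by (rule mod_div_mult_eq[symmetric])
    then have rN: "real N = m + q * n + q * K" by (simp add: algebra_simps)
    have qn: "real q * n \<le> N" unfolding rN by simp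
    have "exp (- (real N * (s + \<delta>))) \<le> exp (- (real N * (\<delta> / 4))) * exp (- (real q * n * (s + 3 * \<delta> / 4)))"
    proof -
      have "real q * n * (s + 3 * \<delta> / 4) \<le> N * (s + 3 * \<delta> / 4)"
        using qn s e by (intro mult_right_mono) auto
      then show ?thesis by (simp add: algebra_simps flip: exp_add)
    qed
    also have "exp (- (real N * (\<delta> / 4))) \<le> \<theta>"
    proof -
      have "exp (- (real N * (\<delta> / 4))) \<le> exp (ln \<theta>)" using elim by simp
      then show ?thesis using \<theta> by simp
    qed
    also have "exp (- (real q * n * (s + 3 * \<delta> / 4))) \<le> (c * P) ^ q"
      using power_mono[OF cP, of q] by (simp add: exp_of_nat_mult[symmetric] mult_ac)
    also have "\<theta> \<le> pmf_prob (Q m) {-B..B}" by (rule base[OF m])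
    also have "pmf_prob (Q m) {-B..B} * (c * P) ^ q \<le> pmf_prob (Q N)
        {-B + q * (real n * (x - e / 2) - C)..B + q * (real n * (x + e / 2) + C)}"
      unfolding N P_def window_def by (rule super_mult_power)
    also have "\<dots> \<le> pmf_prob (Q N) (window N x e)"
    proof (intro measure_pmf.finite_measure_mono)
      have qC: "real q * C \<le> N * (e / 8)"
      proof -
        have "real q * C \<le> real q * (n * (e / 8))" using n(4) by (intro mult_left_mono) auto
        also have "\<dots> \<le> N * (e / 8)" using mult_right_mono[OF qn, of "e / 8"] e by (simp add: mult_ac)
        finally show ?thesis .
      qed
      have qK: "real q * (K * x) \<le> N * (e / 8)"
      proof -
        have "real q * (K * x) \<le> real q * (n * (e / 8))" using n(5) by (intro mult_left_mono) auto
        also have "\<dots> \<le> N * (e / 8)" using mult_right_mono[OF qn, of "e / 8"] e by (simp add: mult_ac)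
        finally show ?thesis .
      qed
      have qe: "real q * n * (e / 2) \<le> N * (e / 2)" using qn e by (intro mult_right_mono) auto
      have qx: "real q * n * x \<le> N * x" using qn x by (intro mult_right_mono) auto
      have mx: "m * x \<le> N * (e / 8)"
      proof -
        have "m * x \<le> L * x" using m x by (intro mult_right_mono) auto
        then show ?thesis using elim by linarith
      qed
      have Nx: "N * x = m * x + real q * n * x + real q * (K * x)" unfolding rN by (simp add: algebra_simps)
      have "real N * (x - e) \<le> -B + q * (real n * (x - e / 2) - C)"
        using elim qC qK qe mx Nx by (simp add: algebra_simps)
      moreover have "B + q * (real n * (x + e / 2) + C) \<le> real N * (x + e)"
      proof -
        have "B + q * (real n * (x + e / 2) + C) = B + real q * n * x + real q * n * (e / 2) + real q * C"
          by (simp add: algebra_simps)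
        also have "\<dots> \<le> N * (e / 8) + N * x + N * (e / 2) + N * (e / 8)" using elim qC qe qx by linarith
        also have "\<dots> \<le> N * (x + e)" using e by (simp add: algebra_simps)
        finally show ?thesis .
      qed
      ultimately show "{-B + q * (real n * (x - e / 2) - C)..B + q * (real n * (x + e / 2) + C)} \<subseteq> window N x e"
        unfolding window_def by auto
    qed simp
    finally show ?case using \<theta> c_pos by (simp add: P_def mult_left_mono mult_right_mono)
  qed
qed

text \<open>Time \<open>N\<close> is split into about \<open>(1 - t) N\<close> steps with speed near
  \<open>x\<close> and \<open>t N\<close> steps with speed near \<open>y\<close>, up to the delay
  \<open>K\<close>. As \<open>t\<close> is strictly between 0 and 1, both durations tend to
  infinity, and rounding is absorbed in half of \<open>e\<close> and
  \<open>\<delta>\<close>.\<close>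

lemma attained_convex:
  assumes "attained Q x s" "attained Q y s'" "x \<ge> 0" "y \<ge> 0" "s \<ge> 0" "s' \<ge> 0" and t: "0 < t" "t < 1"
  shows "attained Q ((1 - t) * x + t * y) ((1 - t) * s + t * s')"
  unfolding attained_def
proof (intro allI impI)
  fix e \<delta> :: real assume e: "e > 0" "\<delta> > 0"
  define n where "n N = nat \<lfloor>(1 - t) * real N\<rfloor>" for N
  define m where "m N = N - K - n N" for N
  have n: "real (n N) \<le> (1 - t) * N" "(1 - t) * N - 1 \<le> n N" for N
    using t by (auto simp: n_def)
  have m: "real (m N) \<le> t * N + 1" "t * N - K \<le> m N" "N = n N + m N + K" if "K + 1 \<le> t * real N" for N
  proof -
    have "real (n N) + K \<le> N" using n[of N] that by (simp add: algebra_simps)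
    then have "n N + K \<le> N" by linarith
    then show "N = n N + m N + K" by (simp add: m_def)
    then have "real N = n N + m N + K" by (metis of_nat_add)
    then show "real (m N) \<le> t * N + 1" "t * N - K \<le> m N" using n[of N] by (auto simp: algebra_simps)
  qed
  have large: "\<forall>\<^sub>F N in sequentially. K + 1 \<le> t * real N"
    using eventually_large[OF t(1), of "K + 1"] by (simp add: mult.commute)
  have n_top: "filterlim n sequentially sequentially"
    unfolding filterlim_at_top
  proof
    fix Z
    have "\<forall>\<^sub>F N in sequentially. real Z + 1 \<le> real N * (1 - t)" using t by (intro eventually_large) simp
    then show "\<forall>\<^sub>F N in sequentially. Z \<le> n N"
    proof eventually_elim
      case (elim N)
      have "real Z \<le> n N" using n(2)[of N] elim by (simp add: algebra_simps)
      then show ?case by simp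
    qed
  qed
  have m_top: "filterlim m sequentially sequentially"
    unfolding filterlim_at_top
  proof
    fix Z
    have "\<forall>\<^sub>F N in sequentially. real Z + K \<le> real N * t" using t by (intro eventually_large) simp
    with large show "\<forall>\<^sub>F N in sequentially. Z \<le> m N"
    proof eventually_elim
      case (elim N)
      have "real Z \<le> m N" using m(2)[OF elim(1)] elim(2) by (simp add: algebra_simps)
      then show ?case by simp
    qed
  qed
  have "\<forall>\<^sub>F n in sequentially. exp (- (real n * (s + \<delta> / 2))) \<le> pmf_prob (Q n) (window n x (e / 2))"
    "\<forall>\<^sub>F n in sequentially. exp (- (real n * (s' + \<delta> / 2))) \<le> pmf_prob (Q n) (window n y (e / 2))"
    using assms(1,2) e by (auto simp: attained_def)
  then have "\<forall>\<^sub>F N in sequentially. exp (- (real (n N) * (s + \<delta> / 2))) \<le> pmf_prob (Q (n N)) (window (n N) x (e / 2))"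
    "\<forall>\<^sub>F N in sequentially. exp (- (real (m N) * (s' + \<delta> / 2))) \<le> pmf_prob (Q (m N)) (window (m N) y (e / 2))"
    using n_top m_top by (auto dest: eventually_compose_filterlim)
  moreover have "\<forall>\<^sub>F N in sequentially. s' - ln c \<le> real N * (\<delta> / 2) \<and> y + C \<le> real N * (e / 2) \<and> x + K * y + C \<le> real N * (e / 2)"
    using e by (intro eventually_conj eventually_large) auto
  ultimately show "\<forall>\<^sub>F N in sequentially. exp (- (real N * ((1 - t) * s + t * s' + \<delta>)))
      \<le> pmf_prob (Q N) (window N ((1 - t) * x + t * y) e)"
    using large
  proof eventually_elim
    case (elim N)
    note mN = m[OF elim(4)]
    let ?n = "real (n N)" and ?m = "real (m N)"
    have nm: "?n + ?m \<le> N" using mN(3) by linarith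
    have b: "(?n + ?m) * (\<delta> / 2) \<le> N * (\<delta> / 2)" "(?n + ?m) * (e / 2) \<le> N * (e / 2)"
      using nm e by (auto intro!: mult_right_mono)
    have ns: "?n * s \<le> (1 - t) * N * s" "?n * x \<le> (1 - t) * N * x" "((1 - t) * N - 1) * x \<le> ?n * x"
      using n[of N] assms by (auto intro!: mult_right_mono)
    have ms: "?m * s' \<le> (t * N + 1) * s'" "?m * y \<le> (t * N + 1) * y" "(t * N - K) * y \<le> ?m * y"
      using mN assms by (auto intro!: mult_right_mono)
    have "exp (- (real N * ((1 - t) * s + t * s' + \<delta>))) \<le> exp (ln c + (- (?n * (s + \<delta> / 2))) + (- (?m * (s' + \<delta> / 2))))"
      using b ns ms elim(3) by (simp add: algebra_simps)
    also have "\<dots> = c * exp (- (?n * (s + \<delta> / 2))) * exp (- (?m * (s' + \<delta> / 2)))"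
      using c_pos by (simp only: exp_add exp_ln)
    also have "\<dots> \<le> c * pmf_prob (Q (n N)) (window (n N) x (e / 2)) * pmf_prob (Q (m N)) (window (m N) y (e / 2))"
      using elim(1,2) c_pos by (intro mult_mono) auto
    also have "\<dots> \<le> pmf_prob (Q (n N + m N + K))
        {?n * (x - e / 2) + ?m * (y - e / 2) - C..?n * (x + e / 2) + ?m * (y + e / 2) + C}"
      unfolding window_def by (rule super_mult)
    also have "\<dots> \<le> pmf_prob (Q N) (window N ((1 - t) * x + t * y) e)"
      unfolding mN(3)[symmetric]
    proof (intro measure_pmf.finite_measure_mono)
      have "real N * ((1 - t) * x + t * y - e) \<le> ?n * (x - e / 2) + ?m * (y - e / 2) - C"
        using b ns ms elim(3) by (simp add: algebra_simps)
      moreover have "?n * (x + e / 2) + ?m * (y + e / 2) + C \<le> real N * ((1 - t) * x + t * y + e)"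
        using b ns ms elim(3) by (simp add: algebra_simps)
      ultimately show "{?n * (x - e / 2) + ?m * (y - e / 2) - C..?n * (x + e / 2) + ?m * (y + e / 2) + C}
        \<subseteq> window N ((1 - t) * x + t * y) e" unfolding window_def by auto
    qed simp
    finally show ?case .
  qed
qed

end

section \<open>The weak large deviation principle\<close>

definition rate :: "(nat \<Rightarrow> real pmf) \<Rightarrow> real \<Rightarrow> ennreal" where
  "rate Q x = Inf (ennreal ` {s. s \<ge> 0 \<and> attained Q x s})"

text \<open>The infimum defining the rate is achieved, by \<open>attained_closed\<close>. Sublevel
  sets of the rate are thus the sets treated in \<open>closed_attained\<close>.\<close>

lemma rate_le_iff:
  assumes "a \<ge> 0" shows "rate Q x \<le> ennreal a \<longleftrightarrow> attained Q x a"
proof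
  assume "attained Q x a"
  then show "rate Q x \<le> ennreal a" unfolding rate_def using assms by (intro Inf_lower) auto
next
  assume le: "rate Q x \<le> ennreal a"
  show "attained Q x a"
  proof (rule attained_closed)
    fix \<eta> :: real assume "\<eta> > 0"
    then have "rate Q x < ennreal (a + \<eta>)" using le assms by (intro le_less_trans[OF le]) (simp add: ennreal_less_iff)
    then obtain s where "s \<ge> 0" "attained Q x s" "ennreal s < ennreal (a + \<eta>)"
      unfolding rate_def by (auto simp: Inf_less_iff)
    then show "attained Q x (a + \<eta>)" using attained_mono[of Q x s "a + \<eta>"] by (auto simp: ennreal_less_iff)
  qed
qed

lemma rate_function_rate: "rate_function (top_of_set {0..}) (rate Q)"
  unfolding rate_function_def
proof
  fix a :: ennreal
  show "closedin (top_of_set {0..}) {x \<in> topspace (top_of_set {0..}). rate Q x \<le> a}"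
  proof (cases a)
    case (real r)
    have "{x \<in> topspace (top_of_set {0..}). rate Q x \<le> a} = {0..} \<inter> {x. attained Q x r}"
      using real by (auto simp: rate_le_iff)
    then show ?thesis using closed_attained by (simp add: closedin_closed_Int)
  next
    case top
    then have "{x \<in> topspace (top_of_set {0..}). rate Q x \<le> a} = topspace (top_of_set {0..})" by auto
    then show ?thesis by (simp only: closedin_topspace)
  qed
qed

lemma (in super_multiplicative) rate_convex: "convex_ennreal_on {0..} (rate Q)"
  unfolding convex_ennreal_on_def
proof (intro conjI ballI)
  fix x y t :: real assume xy: "x \<in> {0..}" "y \<in> {0..}" and t: "t \<in> {0..1}"
  consider "t = 0" | "t = 1" | "0 < t" "t < 1" using t by fastforce
  then show "rate Q ((1 - t) * x + t * y) \<le> ennreal (1 - t) * rate Q x + ennreal t * rate Q y"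
  proof cases
    case 3
    show ?thesis
    proof (cases "rate Q x = \<top> \<or> rate Q y = \<top>")
      case True
      then show ?thesis using 3 by (auto simp: ennreal_mult_top ennreal_mult_eq_top_iff)
    next
      case False
      then obtain a b where ab: "rate Q x = ennreal a" "a \<ge> 0" "rate Q y = ennreal b" "b \<ge> 0"
        by (metis ennreal_cases)
      then have "attained Q x a" "attained Q y b" by (auto simp flip: rate_le_iff)
      then have "attained Q ((1 - t) * x + t * y) ((1 - t) * a + t * b)"
        using attained_convex xy ab 3 by simp
      then have "rate Q ((1 - t) * x + t * y) \<le> ennreal ((1 - t) * a + t * b)"
        using ab 3 by (subst rate_le_iff) auto
      also have "\<dots> = ennreal (1 - t) * rate Q x + ennreal t * rate Q y"
        using ab 3 by (simp add: ennreal_mult ennreal_plus)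
      finally show ?thesis .
    qed
  qed simp_all
qed simp

section \<open>The two large deviation bounds\<close>

lemma log_prob_lower:
  assumes "n \<ge> 1" "exp (- (real n * r)) \<le> p"
  shows "ereal (- r) \<le> ereal (1 / real n) * log_prob p"
proof -
  have p: "p > 0" using assms(2) by (smt (verit) exp_gt_zero)
  then have "- (real n * r) \<le> ln p" using assms(2) by (simp add: ln_ge_iff)
  then have "- r \<le> ln p / n" using assms(1) by (simp add: field_simps)
  then show ?thesis using p by (simp add: log_prob_def)
qed

lemma log_prob_upper:
  assumes "n \<ge> 1" "p \<le> k * exp (- (real n * s))" "p \<ge> 0" "k > 0"
  shows "ereal (1 / real n) * log_prob p \<le> ereal (ln k / n - s)"
proof (cases "p = 0")
  case True then show ?thesis using assms(1) by (simp add: log_prob_def)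
next
  case False
  then have "ln p \<le> ln (k * exp (- (real n * s)))" using assms by simp
  also have "\<dots> = ln k - n * s" using assms(4) by (simp add: ln_mult)
  finally have "ln p / n \<le> ln k / n - s" using assms(1) by (simp add: field_simps)
  then show ?thesis using False by (simp add: log_prob_def)
qed

lemma liminf_interior:
  assumes supp: "\<And>n. set_pmf (Q n) \<subseteq> {0..}"
  shows "- (INF x\<in>(top_of_set {0..}) interior_of \<Lambda>. enn2ereal (rate Q x))
    \<le> liminf (\<lambda>n. ereal (1 / real n) * log_prob (pmf_prob (Q n) {y. y / real n \<in> \<Lambda>}))" (is "_ \<le> liminf ?f")
proof -
  have "- enn2ereal (rate Q x) \<le> liminf ?f" if "x \<in> (top_of_set {0..}) interior_of \<Lambda>" for x
  proof (cases "rate Q x")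
    case (real a)
    then have a: "attained Q x a" using rate_le_iff[of a Q x] by simp
    have "\<exists>U. openin (top_of_set {0..}) U \<and> x \<in> U \<and> U \<subseteq> \<Lambda>"
      using that by (simp only: interior_of_def mem_Collect_eq)
    then obtain U where U: "openin (top_of_set {0..}) U" "x \<in> U" "U \<subseteq> \<Lambda>" by (elim exE conjE)
    from U(1)[unfolded openin_euclidean_subtopology_iff, THEN conjunct2, THEN bspec, OF U(2)]
    obtain e where "e > 0" "\<forall>x'\<in>{0..}. dist x' x < e \<longrightarrow> x' \<in> U" by (elim exE conjE)
    then have e: "e > 0" "\<And>x'. x' \<ge> 0 \<Longrightarrow> dist x' x < e \<Longrightarrow> x' \<in> \<Lambda>" using U(3) by auto
    have "ereal (- a) \<le> liminf ?f + ereal \<delta>" if \<delta>: "\<delta> > 0" for \<delta>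
    proof -
      have "\<forall>\<^sub>F n in sequentially. exp (- (real n * (a + \<delta>))) \<le> pmf_prob (Q n) (window n x (e / 2))"
        using a e(1) \<delta> by (simp add: attained_def)
      moreover have "\<forall>\<^sub>F n in sequentially. 1 \<le> (n::nat)" by (rule eventually_ge_at_top)
      ultimately have "\<forall>\<^sub>F n in sequentially. ereal (- (a + \<delta>)) \<le> ?f n"
      proof eventually_elim
        case (elim n)
        \<comment> \<open>Neighbourhoods are relative to the half-line, so the window may contain
          negative numbers outside the set. They carry no mass, and intersecting with the support
          removes them.\<close>
        have "window n x (e / 2) \<inter> set_pmf (Q n) \<subseteq> {y. y / real n \<in> \<Lambda>}"
        proof
          fix y assume y: "y \<in> window n x (e / 2) \<inter> set_pmf (Q n)"
          then have y': "real n * (x - e / 2) \<le> y" "y \<le> real n * (x + e / 2)" "y \<ge> 0"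
            using supp[of n] by (auto simp: window_def)
          have n: "real n > 0" using elim(2) by simp
          have "x - e / 2 \<le> y / n" "y / n \<le> x + e / 2" "y / n \<ge> 0"
            using y' n by (simp_all add: pos_le_divide_eq pos_divide_le_eq mult.commute)
          then have "dist (y / n) x \<le> e / 2" unfolding dist_real_def by linarith
          then have "dist (y / n) x < e" using e(1) by linarith
          with \<open>y / n \<ge> 0\<close> show "y \<in> {y. y / real n \<in> \<Lambda>}" using e(2)[of "y / n"] by simp
        qed
        then have "pmf_prob (Q n) (window n x (e / 2) \<inter> set_pmf (Q n)) \<le> pmf_prob (Q n) {y. y / real n \<in> \<Lambda>}"
          by (intro measure_pmf.finite_measure_mono) auto
        then have "exp (- (real n * (a + \<delta>))) \<le> pmf_prob (Q n) {y. y / real n \<in> \<Lambda>}"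
          using elim(1) unfolding measure_Int_set_pmf by linarith
        then show ?case using elim(2) by (rule log_prob_lower[rotated])
      qed
      then have "ereal (- (a + \<delta>)) \<le> liminf ?f" by (rule Liminf_bounded)
      then have "ereal (- (a + \<delta>)) + ereal \<delta> \<le> liminf ?f + ereal \<delta>" by (rule add_right_mono)
      moreover have "ereal (- (a + \<delta>)) + ereal \<delta> = ereal (- a)" by simp
      ultimately show ?thesis by (simp only:)
    qed
    then have "ereal (- a) \<le> liminf ?f" by (rule ereal_le_epsilon2)
    then show ?thesis using real by (simp add: enn2ereal_ennreal)
  qed simp
  then have "- liminf ?f \<le> (INF x\<in>(top_of_set {0..}) interior_of \<Lambda>. enn2ereal (rate Q x))"
    by (intro INF_greatest) (rule ereal_uminus_le_reorder[THEN iffD1])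
  then show ?thesis by (rule ereal_uminus_le_reorder[THEN iffD1])
qed

lemma ereal_le_real_dense:
  fixes a b :: ereal
  assumes "\<And>s. ereal s < a \<Longrightarrow> ereal s \<le> b" shows "a \<le> b"
proof (rule ccontr)
  assume "\<not> a \<le> b"
  then have "b < a" by simp
  then obtain r where "b < ereal r" "ereal r < a" using ereal_dense2[of b a] by auto
  then show False using assms[of r] by simp
qed

text \<open>By contraposition of \<open>attained_if_frequently\<close>, a level \<open>s\<close>
  below the rate at \<open>x\<close> yields a window around \<open>x\<close> whose probability is
  small at all large times, not merely at infinitely many. Compactness reduces the set to finitely
  many such windows.\<close>

lemma (in super_multiplicative) limsup_compact:
  assumes K: "compactin (top_of_set {0..}) L" and sub: "\<Lambda> \<subseteq> L"
  shows "limsup (\<lambda>n. ereal (1 / real n) * log_prob (pmf_prob (Q n) {y. y / real n \<in> \<Lambda>}))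
    \<le> - (INF x\<in>L. enn2ereal (rate Q x))" (is "limsup ?f \<le> _")
proof -
  have L: "compact L" "L \<subseteq> {0..}" using K by (auto simp: compactin_subtopology)
  have "ereal s \<le> - limsup ?f" if s: "ereal s < (INF x\<in>L. enn2ereal (rate Q x))" for s
  proof (cases "s \<le> 0")
    case True
    have "\<forall>\<^sub>F n in sequentially. ?f n \<le> ereal (ln 1 / n - 0)"
      using eventually_ge_at_top[of 1]
      by eventually_elim (intro log_prob_upper, auto)
    then have "limsup ?f \<le> 0" by (intro Limsup_bounded) (simp add: zero_ereal_def)
    then have "0 \<le> - limsup ?f" by (simp only: ereal_0_le_uminus_iff)
    moreover have "ereal s \<le> 0" using True by simp
    ultimately show ?thesis by (rule order_trans[rotated])
  next
    case False
    have "\<exists>e>0. \<forall>\<^sub>F n in sequentially. pmf_prob (Q n) (window n x e) \<le> exp (- (real n * s))" if x: "x \<in> L" for x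
    proof -
      have "ereal s < enn2ereal (rate Q x)" by (rule less_le_trans[OF s INF_lower[OF x]])
      then have "\<not> rate Q x \<le> ennreal s" using False by (auto simp: less_eq_ennreal.rep_eq enn2ereal_ennreal)
      then have "\<not> attained Q x s" using False by (simp add: rate_le_iff)
      moreover have "x \<ge> 0" "s \<ge> 0" using x L False by auto
      ultimately have "\<exists>e>0. \<exists>\<delta>>0. \<not> (\<exists>\<^sub>F n in sequentially. exp (- (real n * (s + \<delta>))) \<le> pmf_prob (Q n) (window n x e))"
        using attained_if_frequently by blast
      then obtain e \<delta> where e: "e > 0" "\<delta> > 0"
        "\<not> (\<exists>\<^sub>F n in sequentially. exp (- (real n * (s + \<delta>))) \<le> pmf_prob (Q n) (window n x e))"
        by (elim exE conjE)
      then have "\<forall>\<^sub>F n in sequentially. \<not> exp (- (real n * (s + \<delta>))) \<le> pmf_prob (Q n) (window n x e)"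
        by (simp only: not_frequently)
      then have "\<forall>\<^sub>F n in sequentially. pmf_prob (Q n) (window n x e) \<le> exp (- (real n * s))"
      proof eventually_elim
        case (elim n)
        have "exp (- (real n * (s + \<delta>))) \<le> exp (- (real n * s))" using e by (simp add: algebra_simps)
        then show ?case using elim by linarith
      qed
      then show ?thesis using e(1) by blast
    qed
    then obtain e where e_ball: "\<forall>x\<in>L. e x > 0 \<and>
        (\<forall>\<^sub>F n in sequentially. pmf_prob (Q n) (window n x (e x)) \<le> exp (- (real n * s)))"
      by (rule bchoice[OF ballI, THEN exE])
    note e = e_ball[rule_format, THEN conjunct1] e_ball[rule_format, THEN conjunct2]
    have cover: "L \<subseteq> (\<Union>x\<in>L. ball x (e x))"
    proof
      fix x assume "x \<in> L"
      then show "x \<in> (\<Union>x\<in>L. ball x (e x))" using e(1)[of x] by (intro UN_I[of x]) auto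
    qed
    obtain D where D: "D \<subseteq> L" "finite D" "L \<subseteq> (\<Union>x\<in>D. ball x (e x))"
      by (rule compactE_image[OF L(1) _ cover]) auto
    have "\<forall>\<^sub>F n in sequentially. \<forall>x\<in>D. pmf_prob (Q n) (window n x (e x)) \<le> exp (- (real n * s))"
      using D e(2) by (intro eventually_ball_finite) auto
    \<comment> \<open>The added 1 keeps the logarithm's argument positive when the cover is empty;
      the constant disappears after division by \<open>n\<close>.\<close>
    then have "\<forall>\<^sub>F n in sequentially. ?f n \<le> ereal (ln (real (card D + 1)) / n - s)"
      using eventually_ge_at_top[of 1]
    proof eventually_elim
      case (elim n)
      have "{y. y / real n \<in> \<Lambda>} \<subseteq> (\<Union>x\<in>D. window n x (e x))"
      proof
        fix y assume "y \<in> {y. y / real n \<in> \<Lambda>}"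
        then obtain x where x: "x \<in> D" "y / n \<in> ball x (e x)" using D(3) sub by auto
        then have "\<bar>x - y / n\<bar> < e x" by (simp add: dist_real_def)
        then have "x - e x \<le> y / n" "y / n \<le> x + e x" by linarith+
        moreover have "real n > 0" using elim(2) by simp
        ultimately have "y \<in> window n x (e x)"
          by (simp add: window_def pos_le_divide_eq pos_divide_le_eq mult.commute)
        then show "y \<in> (\<Union>x\<in>D. window n x (e x))" using x by blast
      qed
      then have "pmf_prob (Q n) {y. y / real n \<in> \<Lambda>} \<le> pmf_prob (Q n) (\<Union>x\<in>D. window n x (e x))"
        by (intro measure_pmf.finite_measure_mono) auto
      also have "\<dots> \<le> (\<Sum>x\<in>D. pmf_prob (Q n) (window n x (e x)))"
        using D by (intro measure_pmf.finite_measure_subadditive_finite) auto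
      also have "\<dots> \<le> (\<Sum>x\<in>D. exp (- (real n * s)))" using elim by (intro sum_mono) auto
      also have "\<dots> \<le> real (card D + 1) * exp (- (real n * s))" by (simp add: algebra_simps)
      finally show ?case using elim(2) by (intro log_prob_upper) auto
    qed
    then have "limsup ?f \<le> limsup (\<lambda>n. ereal (ln (real (card D + 1)) / n - s))" by (rule Limsup_mono)
    moreover have "(\<lambda>n. ereal (ln (real (card D + 1)) / n - s)) \<longlonglongrightarrow> ereal (0 - s)"
      by (intro tendsto_ereal tendsto_diff tendsto_const lim_const_over_n)
    then have "limsup (\<lambda>n. ereal (ln (real (card D + 1)) / n - s)) = ereal (0 - s)"
      by (intro lim_imp_Limsup) auto
    ultimately have "limsup ?f \<le> - ereal s" by simp
    then show ?thesis by (subst ereal_minus_le_minus[symmetric]) simp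
  qed
  then have "(INF x\<in>L. enn2ereal (rate Q x)) \<le> - limsup ?f"
    by (rule ereal_le_real_dense)
  then show ?thesis by (subst ereal_minus_le_minus[symmetric]) simp
qed

lemma (in super_multiplicative) weak_LDP_rate:
  assumes supp: "\<And>n. set_pmf (Q n) \<subseteq> {0..}"
    and \<nu>: "\<And>n. n \<ge> 1 \<Longrightarrow> prob_space (\<nu> n)" "\<And>n. n \<ge> 1 \<Longrightarrow> sets (\<nu> n) = sets (borel_of_topology (top_of_set {0..}))"
    and \<nu>_Q: "\<And>n \<Lambda>. n \<ge> 1 \<Longrightarrow> \<Lambda> \<in> sets (borel_of_topology (top_of_set {0..})) \<Longrightarrow>
      measure (\<nu> n) \<Lambda> = pmf_prob (Q n) {y. y / real n \<in> \<Lambda>}"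
  shows "weak_LDP (top_of_set {0..}) \<nu> (rate Q)"
  unfolding weak_LDP_def
proof (intro conjI allI impI ballI)
  show "rate_function (top_of_set {0..}) (rate Q)" by (rule rate_function_rate)
next
  fix \<Lambda> :: "real set"
  assume \<Lambda>: "\<Lambda> \<in> sets (borel_of_topology (top_of_set {0..}))"
    and cpt: "compactin (top_of_set {0..}) ((top_of_set {0..}) closure_of \<Lambda>)"
  let ?f = "\<lambda>n. ereal (1 / real n) * log_prob (measure (\<nu> n) \<Lambda>)"
  let ?g = "\<lambda>n. ereal (1 / real n) * log_prob (pmf_prob (Q n) {y. y / real n \<in> \<Lambda>})"
  have "\<forall>\<^sub>F n in sequentially. ?f n = ?g n"
    using eventually_ge_at_top[of 1] by eventually_elim (simp add: \<nu>_Q \<Lambda>)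
  then have eq: "liminf ?f = liminf ?g" "limsup ?f = limsup ?g"
    by (rule Liminf_eq, rule Limsup_eq)
  show "- (INF x\<in>(top_of_set {0..}) interior_of \<Lambda>. enn2ereal (rate Q x)) \<le> liminf ?f"
    unfolding eq by (rule liminf_interior[OF supp])
  have "\<Lambda> \<subseteq> {0..}" using sets.sets_into_space[OF \<Lambda>] by (simp add: borel_of_topology_def space_measure_of_conv)
  then have "\<Lambda> \<subseteq> (top_of_set {0..}) closure_of \<Lambda>" by (intro closure_of_subset) simp
  then show "limsup ?f \<le> - (INF x\<in>(top_of_set {0..}) closure_of \<Lambda>. enn2ereal (rate Q x))"
    unfolding eq by (rule limsup_compact[OF cpt])
qed (use \<nu> in auto)

section \<open>The random walk\<close>

primrec walk_pmf :: "('a, 'b) monoid_scheme \<Rightarrow> 'a pmf \<Rightarrow> nat \<Rightarrow> 'a pmf" where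
  "walk_pmf G \<mu> 0 = return_pmf \<one>\<^bsub>G\<^esub>"
| "walk_pmf G \<mu> (Suc n) = bind_pmf (walk_pmf G \<mu> n) (\<lambda>y. map_pmf (\<lambda>x. y \<otimes>\<^bsub>G\<^esub> x) \<mu>)"

context group
begin

lemma set_walk_pmf:
  assumes "set_pmf \<mu> \<subseteq> carrier G" shows "set_pmf (walk_pmf G \<mu> n) \<subseteq> carrier G"
proof (induction n)
  case (Suc n)
  then show ?case using assms by (auto simp: subset_iff)
qed simp

lemma walk_pmf_add:
  assumes \<mu>: "set_pmf \<mu> \<subseteq> carrier G"
  shows "walk_pmf G \<mu> (n + m) = bind_pmf (walk_pmf G \<mu> n) (\<lambda>y. map_pmf (\<lambda>x. y \<otimes> x) (walk_pmf G \<mu> m))"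
proof (induction m)
  case 0
  have "bind_pmf (walk_pmf G \<mu> n) (\<lambda>y. return_pmf (y \<otimes> \<one>)) = bind_pmf (walk_pmf G \<mu> n) return_pmf"
    by (rule bind_pmf_cong) (use set_walk_pmf[OF \<mu>, of n] in auto)
  then show ?case by (simp add: bind_return_pmf')
next
  case (Suc m)
  have "bind_pmf (walk_pmf G \<mu> n) (\<lambda>y. bind_pmf (walk_pmf G \<mu> m) (\<lambda>z. map_pmf (\<lambda>x. (y \<otimes> z) \<otimes> x) \<mu>))
      = bind_pmf (walk_pmf G \<mu> n) (\<lambda>y. bind_pmf (walk_pmf G \<mu> m) (\<lambda>z. map_pmf (\<lambda>x. y \<otimes> (z \<otimes> x)) \<mu>))"
    by (intro bind_pmf_cong refl map_pmf_cong m_assoc) (use set_walk_pmf[OF \<mu>] \<mu> in auto)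
  then show ?case using Suc
    by (simp add: bind_assoc_pmf map_bind_pmf bind_map_pmf pmf.map_comp o_def)
qed

text \<open>The walk is viewed as a function of the increment coordinates, so that independence of
  disjoint blocks applies. Countability makes the product of the two discrete spaces discrete, hence
  multiplication measurable.\<close>

lemma right_walk_measurable_PiM:
  assumes cnt: "countable (carrier G)" and "\<And>i. 1 \<le> i \<Longrightarrow> i \<le> n \<Longrightarrow> i \<in> J"
  shows "(\<lambda>\<omega>. right_walk G (\<lambda>i \<omega>. \<omega> i) n \<omega>) \<in> measurable (PiM J (\<lambda>_. count_space (carrier G))) (count_space (carrier G))"
  using assms(2)
proof (induction n)
  case 0
  have "right_walk G (\<lambda>i \<omega>. \<omega> i) 0 = (\<lambda>_. \<one>)" by (rule ext) simp
  then show ?case by simp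
next
  case (Suc n)
  have "(\<lambda>\<omega>. \<omega> (Suc n)) \<in> measurable (PiM J (\<lambda>_. count_space (carrier G))) (count_space (carrier G))"
    using Suc.prems[of "Suc n"] by (intro measurable_component_singleton) auto
  moreover have "(\<lambda>\<omega>. right_walk G (\<lambda>i \<omega>. \<omega> i) n \<omega>) \<in> measurable (PiM J (\<lambda>_. count_space (carrier G))) (count_space (carrier G))"
    using Suc by auto
  moreover have "(\<lambda>(a, b). a \<otimes> b) \<in> measurable (count_space (carrier G) \<Otimes>\<^sub>M count_space (carrier G)) (count_space (carrier G))"
    using cnt by (simp add: pair_measure_countable) auto
  ultimately have "(\<lambda>\<omega>. (\<lambda>(a, b). a \<otimes> b) (right_walk G (\<lambda>i \<omega>. \<omega> i) n \<omega>, \<omega> (Suc n)))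
      \<in> measurable (PiM J (\<lambda>_. count_space (carrier G))) (count_space (carrier G))"
    by (intro measurable_compose[OF measurable_Pair]) auto
  then show ?case by simp
qed

lemma right_walk_restrict:
  assumes "\<And>i. 1 \<le> i \<Longrightarrow> i \<le> n \<Longrightarrow> i \<in> J"
  shows "right_walk G (\<lambda>i \<omega>. \<omega> i) n (\<lambda>i\<in>J. X i w) = right_walk G X n w"
  using assms by (induction n) auto

lemma right_walk_measurable:
  assumes cnt: "countable (carrier G)" and iid: "iid_increments G M \<mu> X"
  shows "right_walk G X n \<in> measurable M (count_space (carrier G))"
proof -
  interpret prob_space M using iid by (simp add: iid_increments_def)
  have ind: "indep_vars (\<lambda>_. count_space (carrier G)) X {1..}" using iid by (simp add: iid_increments_def)
  then have "(\<lambda>w. \<lambda>i\<in>{1..}. X i w) \<in> measurable M (PiM {1..} (\<lambda>_. count_space (carrier G)))"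
    by (intro measurable_restrict) (simp add: indep_vars_def)
  then have "(\<lambda>w. right_walk G (\<lambda>i \<omega>. \<omega> i) n (\<lambda>i\<in>{1..}. X i w)) \<in> measurable M (count_space (carrier G))"
    by (rule measurable_compose) (rule right_walk_measurable_PiM[OF cnt], simp)
  moreover have "(\<lambda>w. right_walk G (\<lambda>i \<omega>. \<omega> i) n (\<lambda>i\<in>{1..}. X i w)) = right_walk G X n"
    by (rule ext, rule right_walk_restrict) simp
  ultimately show ?thesis by (simp only:)
qed

lemma right_walk_indep:
  assumes cnt: "countable (carrier G)" and iid: "iid_increments G M \<mu> X"
  shows "prob_space.indep_var M (count_space (carrier G)) (right_walk G X n) (count_space (carrier G)) (X (Suc n))"
proof -
  interpret prob_space M using iid by (simp add: iid_increments_def)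
  have ind: "indep_vars (\<lambda>_. count_space (carrier G)) X {1..}" using iid by (simp add: iid_increments_def)
  have "indep_var (PiM {1..n} (\<lambda>_. count_space (carrier G))) (\<lambda>w. \<lambda>i\<in>{1..n}. X i w)
      (PiM {Suc n} (\<lambda>_. count_space (carrier G))) (\<lambda>w. \<lambda>i\<in>{Suc n}. X i w)"
    by (rule indep_var_restrict[OF ind]) auto
  then have "indep_var (count_space (carrier G)) ((\<lambda>\<omega>. right_walk G (\<lambda>i \<omega>. \<omega> i) n \<omega>) \<circ> (\<lambda>w. \<lambda>i\<in>{1..n}. X i w))
      (count_space (carrier G)) ((\<lambda>\<omega>. \<omega> (Suc n)) \<circ> (\<lambda>w. \<lambda>i\<in>{Suc n}. X i w))"
    by (rule indep_var_compose) (auto intro!: right_walk_measurable_PiM[OF cnt] measurable_component_singleton)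
  moreover have "(\<lambda>\<omega>. right_walk G (\<lambda>i \<omega>. \<omega> i) n \<omega>) \<circ> (\<lambda>w. \<lambda>i\<in>{1..n}. X i w) = right_walk G X n"
    unfolding o_def by (rule ext, rule right_walk_restrict) simp
  moreover have "(\<lambda>\<omega>. \<omega> (Suc n)) \<circ> (\<lambda>w. \<lambda>i\<in>{Suc n}. X i w) = X (Suc n)"
    by (simp add: o_def)
  ultimately show ?thesis by simp
qed

text \<open>The event is split according to the position at time \<open>n\<close>, which is
  independent of the next increment. Countably many positions make the resulting sum the convolution
  defining \<open>walk_pmf\<close>.\<close>

lemma prob_right_walk_at:
  assumes cnt: "countable (carrier G)" and iid: "iid_increments G M \<mu> X" and \<mu>: "set_pmf \<mu> \<subseteq> carrier G"
    and g: "g \<in> carrier G"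
  shows "measure M {w \<in> space M. right_walk G X n w = g} = pmf (walk_pmf G \<mu> n) g"
  using g
proof (induction n arbitrary: g)
  case 0
  interpret prob_space M using iid by (simp add: iid_increments_def)
  show ?case by (cases "g = \<one>") (auto simp: prob_space indicator_def)
next
  case (Suc n)
  interpret prob_space M using iid by (simp add: iid_increments_def)
  let ?Y = "right_walk G X n" and ?X = "X (Suc n)"
  have Y: "?Y \<in> measurable M (count_space (carrier G))" by (rule right_walk_measurable[OF cnt iid])
  have ind: "indep_var (count_space (carrier G)) ?Y (count_space (carrier G)) ?X"
    by (rule right_walk_indep[OF cnt iid])
  have X: "?X \<in> measurable M (count_space (carrier G))" using ind by (rule indep_var_rv2)
  have Yc: "?Y w \<in> carrier G" "?X w \<in> carrier G" if "w \<in> space M" for w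
    using measurable_space[OF Y that] measurable_space[OF X that] by auto
  define E where "E y = {w \<in> space M. ?Y w = y \<and> ?X w = inv y \<otimes> g}" for y
  have E_prob: "prob (E y) = pmf (walk_pmf G \<mu> n) y * pmf \<mu> (inv y \<otimes> g)" if y: "y \<in> carrier G" for y
  proof -
    have z: "inv y \<otimes> g \<in> carrier G" using y Suc.prems by simp
    have "prob ((\<lambda>w. (?Y w, ?X w)) -` ({y} \<times> {inv y \<otimes> g}) \<inter> space M)
      = prob (?Y -` {y} \<inter> space M) * prob (?X -` {inv y \<otimes> g} \<inter> space M)"
      using y z by (intro indep_varD[OF ind]) auto
    moreover have "(\<lambda>w. (?Y w, ?X w)) -` ({y} \<times> {inv y \<otimes> g}) \<inter> space M = E y" by (auto simp: E_def)
    moreover have "?Y -` {y} \<inter> space M = {w \<in> space M. ?Y w = y}" by auto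
    moreover have "?X -` {inv y \<otimes> g} \<inter> space M = {w \<in> space M. ?X w = inv y \<otimes> g}" by auto
    moreover have "prob {w \<in> space M. ?X w = inv y \<otimes> g} = pmf \<mu> (inv y \<otimes> g)"
      using iid z by (simp add: iid_increments_def)
    ultimately show ?thesis using Suc.IH[OF y] by simp
  qed
  have E_meas: "E y \<in> sets M" if "y \<in> carrier G" for y
  proof -
    have "?Y -` {y} \<inter> space M \<in> sets M" "?X -` {inv y \<otimes> g} \<inter> space M \<in> sets M"
      using Y X that Suc.prems by (auto intro!: measurable_sets)
    moreover have "E y = (?Y -` {y} \<inter> space M) \<inter> (?X -` {inv y \<otimes> g} \<inter> space M)" by (auto simp: E_def)
    ultimately show ?thesis by auto
  qed
  have "{w \<in> space M. right_walk G X (Suc n) w = g} = (\<Union>y\<in>carrier G. E y)"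
  proof (intro equalityI subsetI)
    fix w assume w: "w \<in> {w \<in> space M. right_walk G X (Suc n) w = g}"
    then have "?X w = inv (?Y w) \<otimes> g" using Yc[of w] by (auto simp flip: m_assoc)
    then show "w \<in> (\<Union>y\<in>carrier G. E y)" using w Yc[of w] by (auto simp: E_def)
  next
    fix w assume "w \<in> (\<Union>y\<in>carrier G. E y)"
    then obtain y where y: "y \<in> carrier G" "w \<in> space M" "?Y w = y" "?X w = inv y \<otimes> g" by (auto simp: E_def)
    then have "?Y w \<otimes> ?X w = g" using Suc.prems by (simp flip: m_assoc)
    then show "w \<in> {w \<in> space M. right_walk G X (Suc n) w = g}" using y by simp
  qed
  then have "emeasure M {w \<in> space M. right_walk G X (Suc n) w = g} = (\<integral>\<^sup>+y. emeasure M (E y) \<partial>count_space (carrier G))"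
    using cnt E_meas by (simp only:) (rule emeasure_UN_countable, auto simp: disjoint_family_on_def E_def)
  also have "\<dots> = (\<integral>\<^sup>+y. ennreal (pmf (walk_pmf G \<mu> n) y * pmf \<mu> (inv y \<otimes> g)) \<partial>count_space (carrier G))"
    using E_prob by (intro nn_integral_cong) (auto simp: emeasure_eq_measure)
  also have "\<dots> = (\<integral>\<^sup>+y. ennreal (pmf (walk_pmf G \<mu> n) y) * ennreal (pmf (map_pmf (\<lambda>x. y \<otimes> x) \<mu>) g) \<partial>count_space (carrier G))"
  proof (intro nn_integral_cong)
    fix y assume "y \<in> space (count_space (carrier G))"
    then have y: "y \<in> carrier G" by simp
    have "pmf (map_pmf (\<lambda>x. y \<otimes> x) \<mu>) g = measure \<mu> ((\<lambda>x. y \<otimes> x) -` {g} \<inter> set_pmf \<mu>)"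
      by (simp add: pmf_map measure_Int_set_pmf)
    also have "(\<lambda>x. y \<otimes> x) -` {g} \<inter> set_pmf \<mu> = {inv y \<otimes> g} \<inter> set_pmf \<mu>"
      using \<mu> y Suc.prems by (auto simp flip: m_assoc)
    also have "measure \<mu> ({inv y \<otimes> g} \<inter> set_pmf \<mu>) = pmf \<mu> (inv y \<otimes> g)"
      by (simp add: measure_Int_set_pmf measure_pmf_single)
    finally show "ennreal (pmf (walk_pmf G \<mu> n) y * pmf \<mu> (inv y \<otimes> g))
      = ennreal (pmf (walk_pmf G \<mu> n) y) * ennreal (pmf (map_pmf (\<lambda>x. y \<otimes> x) \<mu>) g)"
      by (simp add: ennreal_mult)
  qed
  also have "\<dots> = (\<integral>\<^sup>+y. ennreal (pmf (walk_pmf G \<mu> n) y) * ennreal (pmf (map_pmf (\<lambda>x. y \<otimes> x) \<mu>) g) \<partial>count_space UNIV)"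
    using set_walk_pmf[OF \<mu>, of n]
    by (intro nn_integral_count_space_eq) (auto simp: pmf_eq_0_set_pmf subset_iff)
  also have "\<dots> = ennreal (pmf (walk_pmf G \<mu> (Suc n)) g)"
    by (simp only: walk_pmf.simps ennreal_pmf_bind nn_integral_measure_pmf)
  finally show ?case by (simp add: emeasure_eq_measure)
qed

lemma prob_right_walk:
  assumes cnt: "countable (carrier G)" and iid: "iid_increments G M \<mu> X" and \<mu>: "set_pmf \<mu> \<subseteq> carrier G"
  shows "measure M {w \<in> space M. right_walk G X n w \<in> A} = pmf_prob (walk_pmf G \<mu> n) A"
proof -
  interpret prob_space M using iid by (simp add: iid_increments_def)
  let ?Y = "right_walk G X n" and ?A = "A \<inter> carrier G"
  have Y: "?Y \<in> measurable M (count_space (carrier G))" by (rule right_walk_measurable[OF cnt iid])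
  have meas: "{w \<in> space M. ?Y w = g} \<in> sets M" if "g \<in> carrier G" for g
  proof -
    have "?Y -` {g} \<inter> space M \<in> sets M" using Y that by (intro measurable_sets) auto
    moreover have "?Y -` {g} \<inter> space M = {w \<in> space M. ?Y w = g}" by auto
    ultimately show ?thesis by simp
  qed
  have "{w \<in> space M. ?Y w \<in> A} = (\<Union>g\<in>?A. {w \<in> space M. ?Y w = g})"
    using measurable_space[OF Y] by auto
  then have "emeasure M {w \<in> space M. ?Y w \<in> A} = (\<integral>\<^sup>+g. emeasure M {w \<in> space M. ?Y w = g} \<partial>count_space ?A)"
    using cnt meas by (simp only:) (rule emeasure_UN_countable, auto simp: disjoint_family_on_def)
  also have "\<dots> = (\<integral>\<^sup>+g. ennreal (pmf (walk_pmf G \<mu> n) g) \<partial>count_space ?A)"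
    using prob_right_walk_at[OF cnt iid \<mu>] by (intro nn_integral_cong) (simp add: emeasure_eq_measure)
  also have "\<dots> = emeasure (walk_pmf G \<mu> n) ?A" by (rule nn_integral_pmf)
  finally have "measure M {w \<in> space M. ?Y w \<in> A} = pmf_prob (walk_pmf G \<mu> n) ?A"
    by (simp add: emeasure_eq_measure measure_pmf.emeasure_eq_measure)
  also have "\<dots> = pmf_prob (walk_pmf G \<mu> n) (A \<inter> carrier G \<inter> set_pmf (walk_pmf G \<mu> n))"
    by (simp add: measure_Int_set_pmf)
  also have "A \<inter> carrier G \<inter> set_pmf (walk_pmf G \<mu> n) = A \<inter> set_pmf (walk_pmf G \<mu> n)"
    using set_walk_pmf[OF \<mu>, of n] by auto
  finally show ?thesis by (simp add: measure_Int_set_pmf)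
qed

text \<open>The factors stand in the order of the walk, but \<open>g\<close> and \<open>h\<close>
  are paired first, because the connector will be prescribed as a function of both. Independent
  draws may be reordered.\<close>

lemma walk_pmf_product:
  assumes \<mu>: "set_pmf \<mu> \<subseteq> carrier G"
  shows "walk_pmf G \<mu> (n + (k + (m + r))) = map_pmf (\<lambda>(((g, h), x), y). g \<otimes> (x \<otimes> (h \<otimes> y)))
    (pair_pmf (pair_pmf (pair_pmf (walk_pmf G \<mu> n) (walk_pmf G \<mu> m)) (walk_pmf G \<mu> k)) (walk_pmf G \<mu> r))"
proof -
  have "walk_pmf G \<mu> (n + (k + (m + r))) = bind_pmf (walk_pmf G \<mu> n) (\<lambda>g. bind_pmf (walk_pmf G \<mu> k) (\<lambda>x.
      bind_pmf (walk_pmf G \<mu> m) (\<lambda>h. bind_pmf (walk_pmf G \<mu> r) (\<lambda>y. return_pmf (g \<otimes> (x \<otimes> (h \<otimes> y)))))))"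
    unfolding walk_pmf_add[OF \<mu>] by (simp add: map_pmf_def bind_assoc_pmf bind_return_pmf)
  also have "\<dots> = bind_pmf (walk_pmf G \<mu> n) (\<lambda>g. bind_pmf (walk_pmf G \<mu> m) (\<lambda>h.
      bind_pmf (walk_pmf G \<mu> k) (\<lambda>x. bind_pmf (walk_pmf G \<mu> r) (\<lambda>y. return_pmf (g \<otimes> (x \<otimes> (h \<otimes> y)))))))"
    by (subst bind_commute_pmf) (rule refl)
  finally show ?thesis by (simp add: map_pmf_def pair_pmf_def bind_assoc_pmf bind_return_pmf)
qed

text \<open>The connecting elements \<open>f\<close> are reached at different times \<open>k f\<close>; appending a fixed element
  of the support of the walk at time \<open>K - k f\<close> makes the total time independent of \<open>f\<close>.\<close>

lemma super_multiplicative_walk: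
  fixes len :: "'a \<Rightarrow> nat"
  assumes \<mu>: "set_pmf \<mu> \<subseteq> carrier G"
    and sub: "\<And>g h. g \<in> carrier G \<Longrightarrow> h \<in> carrier G \<Longrightarrow> len (g \<otimes> h) \<le> len g + len h"
    and len_inv: "\<And>g. g \<in> carrier G \<Longrightarrow> len (inv g) = len g"
    and F: "finite F" "F \<subseteq> carrier G"
    and glue: "\<And>g h. g \<in> carrier G \<Longrightarrow> h \<in> carrier G \<Longrightarrow> \<exists>f\<in>F. len g + len h \<le> len (g \<otimes> f \<otimes> h) + C0"
    and adm: "\<And>f. f \<in> F \<Longrightarrow> \<exists>k. pmf (walk_pmf G \<mu> k) f > 0"
  obtains K C c where "super_multiplicative (\<lambda>n. map_pmf (\<lambda>g. real (len g)) (walk_pmf G \<mu> n)) K C c"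
proof -
  let ?W = "walk_pmf G \<mu>"
  have Wc: "g \<in> carrier G" if "g \<in> set_pmf (?W n)" for g n using set_walk_pmf[OF \<mu>] that by blast
  have F_ne: "F \<noteq> {}" using glue[of \<one> \<one>] by auto
  have "\<forall>f\<in>F. \<exists>k. pmf (?W k) f > 0" using adm by blast
  then obtain k where k: "\<forall>f\<in>F. pmf (?W (k f)) f > 0" by (rule bchoice[THEN exE])
  define K where "K = Max (k ` F)"
  have kK: "k f \<le> K" if "f \<in> F" for f unfolding K_def using F(1) that by (intro Max_ge) auto
  define a where "a j = (SOME y. y \<in> set_pmf (?W j))" for j
  have a: "a j \<in> set_pmf (?W j)" for j unfolding a_def by (rule some_in_eq[THEN iffD2, OF set_pmf_not_empty])
  have ac: "a j \<in> carrier G" for j using a Wc by blast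
  define A where "A = Max (len ` F \<union> (\<lambda>j. len (a j)) ` {..K})"
  have A: "len f \<le> A" "len (a j) \<le> A" if "f \<in> F" "j \<le> K" for f j
    unfolding A_def using F(1) that by (simp_all add: Max_ge)
  define \<theta> where "\<theta> f = pmf (?W (k f)) f * pmf (?W (K - k f)) (a (K - k f))" for f
  define p where "p = Min (\<theta> ` F)"
  have \<theta>: "\<theta> f > 0" if "f \<in> F" for f using k that a by (simp add: \<theta>_def pmf_positive)
  have p: "p > 0" "p \<le> \<theta> f" if "f \<in> F" for f
    unfolding p_def using F(1) F_ne \<theta> that by (simp_all add: Min_gr_iff)
  have p_pos: "p > 0" using p(1) F_ne by blast
  define C where "C = real (C0 + 2 * A)"
  define c where "c = p / card F"
  have cF: "real (card F) > 0" using F(1) F_ne by (simp add: card_gt_0_iff)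
  define good where "good g h f \<longleftrightarrow> f \<in> F \<and> len g + len h \<le> len (g \<otimes> f \<otimes> h) + C0" for g h f
  define \<phi> where "\<phi> g h = (SOME f. good g h f)" for g h
  have \<phi>: "good g h (\<phi> g h)" if gh: "g \<in> carrier G" "h \<in> carrier G" for g h
  proof -
    obtain f where "good g h f" using glue[OF gh] unfolding good_def by blast
    then show ?thesis unfolding \<phi>_def by (rule someI[of "good g h"])
  qed
  have "c * pmf_prob (map_pmf (\<lambda>g. real (len g)) (?W n)) {s..t} * pmf_prob (map_pmf (\<lambda>g. real (len g)) (?W m)) {s'..t'}
      \<le> pmf_prob (map_pmf (\<lambda>g. real (len g)) (?W (n + m + K))) {s + s' - C..t + t' + C}" for n m s t s' t'
  proof -
    let ?T = "(\<lambda>g. real (len g)) -` {s + s' - C..t + t' + C}"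
    define U where "U = (\<lambda>g. real (len g)) -` {s..t} \<inter> set_pmf (?W n)"
    define V where "V = (\<lambda>g. real (len g)) -` {s'..t'} \<inter> set_pmf (?W m)"
    have "U \<subseteq> carrier G" "V \<subseteq> carrier G" using Wc unfolding U_def V_def by blast+
    moreover have "countable U" "countable V" unfolding U_def V_def by (simp_all add: countable_Int2)
    ultimately have UV: "countable U" "countable V" "U \<subseteq> carrier G" "V \<subseteq> carrier G" by blast+
    \<comment> \<open>Pairs are sorted by their chosen connector. On one class the connector is
      constant, so hitting it is independent of the pair; summing over the classes costs the factor
      \<open>card F\<close> in \<open>c\<close>.\<close>
    define E where "E f = {(g, h) \<in> U \<times> V. \<phi> g h = f}" for f
    have cE: "countable (E f)" for f
    proof -
      have "E f \<subseteq> U \<times> V" by (auto simp: E_def)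
      then show ?thesis using countable_SIGMA[OF UV(1) UV(2)] by (rule countable_subset)
    qed
    have step: "pmf_prob (pair_pmf (?W n) (?W m)) (E f) * p \<le> pmf_prob (?W (n + m + K)) ?T" if f: "f \<in> F" for f
    proof -
      let ?r = "K - k f"
      let ?\<pi> = "\<lambda>(((g, h), x), y). g \<otimes> (x \<otimes> (h \<otimes> y))"
      let ?P = "pair_pmf (pair_pmf (pair_pmf (?W n) (?W m)) (?W (k f))) (?W ?r)"
      have N: "n + m + K = n + (k f + (m + ?r))" using kK[OF f] by simp
      have W: "?W (n + m + K) = map_pmf ?\<pi> ?P" unfolding N by (rule walk_pmf_product[OF \<mu>])
      have "(E f \<times> {f}) \<times> {a ?r} \<subseteq> ?\<pi> -` ?T"
      proof
        fix z assume "z \<in> (E f \<times> {f}) \<times> {a ?r}"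
        then obtain g h where z: "z = (((g, h), f), a ?r)" and gh: "(g, h) \<in> E f" by auto
        have ghc: "g \<in> carrier G" "h \<in> carrier G" using gh UV by (auto simp: E_def)
        have fc: "f \<in> carrier G" using f F by blast
        have rng: "s \<le> len g" "len g \<le> t" "s' \<le> len h" "len h \<le> t'"
          using gh by (auto simp: E_def U_def V_def)
        have "good g h f" using \<phi>[OF ghc] gh by (simp add: E_def)
        then have low: "len g + len h \<le> len (g \<otimes> f \<otimes> h) + C0" by (simp add: good_def)
        let ?w = "g \<otimes> (f \<otimes> (h \<otimes> a ?r))"
        have w: "?w = g \<otimes> f \<otimes> h \<otimes> a ?r" using ghc fc ac by (simp add: m_assoc)
        have "g \<otimes> f \<otimes> h = ?w \<otimes> inv (a ?r)" using ghc fc ac[of ?r] unfolding w by (simp add: m_assoc)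
        then have "len (g \<otimes> f \<otimes> h) \<le> len ?w + len (a ?r)"
          using sub[of ?w "inv (a ?r)"] len_inv[of "a ?r"] ghc fc ac by simp
        moreover have "len ?w \<le> len g + (len f + (len h + len (a ?r)))"
          using sub[of g "f \<otimes> (h \<otimes> a ?r)"] sub[of f "h \<otimes> a ?r"] sub[of h "a ?r"] ghc fc ac[of ?r] by simp
        moreover have "len f \<le> A" "len (a ?r) \<le> A" using A[OF f, of ?r] by auto
        ultimately have "len g + len h \<le> len ?w + (C0 + 2 * A)" "len ?w \<le> len g + len h + (C0 + 2 * A)"
          using low by linarith+
        then have "real (len g) + len h \<le> len ?w + C" "len ?w \<le> real (len g) + len h + C"
          unfolding C_def by linarith+
        then show "z \<in> ?\<pi> -` ?T" using rng by (auto simp: z)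
      qed
      then have "pmf_prob ?P ((E f \<times> {f}) \<times> {a ?r}) \<le> pmf_prob ?P (?\<pi> -` ?T)"
        by (intro measure_pmf.finite_measure_mono) auto
      also have "pmf_prob ?P ((E f \<times> {f}) \<times> {a ?r}) = pmf_prob (pair_pmf (?W n) (?W m)) (E f) * \<theta> f"
        using cE by (simp add: measure_pmf_prob_product \<theta>_def measure_pmf_single mult.assoc)
      also have "pmf_prob ?P (?\<pi> -` ?T) = pmf_prob (?W (n + m + K)) ?T" unfolding W by simp
      finally have "pmf_prob (pair_pmf (?W n) (?W m)) (E f) * \<theta> f \<le> pmf_prob (?W (n + m + K)) ?T" .
      moreover have "pmf_prob (pair_pmf (?W n) (?W m)) (E f) * p \<le> pmf_prob (pair_pmf (?W n) (?W m)) (E f) * \<theta> f"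
        using p(2)[OF f] by (intro mult_left_mono) auto
      ultimately show ?thesis by linarith
    qed
    have "U \<times> V \<subseteq> (\<Union>f\<in>F. E f)"
    proof
      fix z assume "z \<in> U \<times> V"
      then obtain g h where z: "z = (g, h)" "g \<in> U" "h \<in> V" by auto
      then have "\<phi> g h \<in> F" using \<phi>[of g h] UV by (auto simp: good_def)
      then show "z \<in> (\<Union>f\<in>F. E f)" using z by (auto simp: E_def)
    qed
    then have "pmf_prob (pair_pmf (?W n) (?W m)) (U \<times> V) \<le> pmf_prob (pair_pmf (?W n) (?W m)) (\<Union>f\<in>F. E f)"
      by (intro measure_pmf.finite_measure_mono) auto
    also have "\<dots> \<le> (\<Sum>f\<in>F. pmf_prob (pair_pmf (?W n) (?W m)) (E f))"
      using F(1) by (intro measure_pmf.finite_measure_subadditive_finite) auto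
    finally have "pmf_prob (?W n) U * pmf_prob (?W m) V * p \<le> (\<Sum>f\<in>F. pmf_prob (pair_pmf (?W n) (?W m)) (E f)) * p"
      using p_pos UV by (intro mult_right_mono) (auto simp: measure_pmf_prob_product)
    also have "\<dots> = (\<Sum>f\<in>F. pmf_prob (pair_pmf (?W n) (?W m)) (E f) * p)" by (rule sum_distrib_right)
    also have "\<dots> \<le> card F * pmf_prob (?W (n + m + K)) ?T" using step by (intro sum_bounded_above)
    finally have "c * (pmf_prob (?W n) U * pmf_prob (?W m) V) \<le> pmf_prob (?W (n + m + K)) ?T"
      using cF by (simp add: c_def field_simps)
    then show ?thesis by (simp add: U_def V_def measure_Int_set_pmf mult.assoc)
  qed
  moreover have "c > 0" "C \<ge> 0" using p_pos cF by (auto simp: c_def C_def)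
  ultimately have "super_multiplicative (\<lambda>n. map_pmf (\<lambda>g. real (len g)) (?W n)) K C c"
    by unfold_locales
  then show thesis by (rule that)
qed

end

lemma (in relative_cayley_graph) countable_carrier: "countable (carrier G)"
proof -
  have "carrier G = (\<Union>n. {y \<in> carrier G. S.d \<one> y \<le> n})" by auto
  moreover have "countable {y \<in> carrier G. S.d \<one> y \<le> n}" for n
    by (rule countable_finite[OF S.finite_ball[OF S_finite one_closed]])
  then have "countable (\<Union>n. {y \<in> carrier G. S.d \<one> y \<le> n})" by (intro countable_UN) auto
  ultimately show ?thesis by simp
qed

lemma space_borel_of_topology: "space (borel_of_topology T) = topspace T"
  by (simp add: borel_of_topology_def space_measure_of_conv)

theorem theorem1p1:
  fixes G :: "('a, 'b) monoid_scheme"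
    and \<Omega> Hs :: "'a set set"
    and S :: "'a set"
    and \<mu> :: "'a pmf"
    and M :: "'w measure"
    and X :: "nat \<Rightarrow> 'w \<Rightarrow> 'a"
  assumes "group G"
    and "non_elementary G"
    and "finite_generating_set G S"
    and "peripheral_collection G \<Omega>"
    and "class_representatives G \<Omega> Hs"
    and "relatively_hyperbolic G \<Omega> S Hs"
    and "set_pmf \<mu> \<subseteq> carrier G"
    and "iid_increments G M \<mu> X"
    and "admissible_increments G M X"
  shows "\<exists>I :: real \<Rightarrow> ennreal.
           convex_ennreal_on {0..} I \<and>
           weak_LDP_variables (top_of_set {0..}) M
             (\<lambda>n w. real (word_length G S Hs (right_walk G X n w)) / real n) I"
proof -
  have "subgroup H G" if "H \<in> Hs" for H
    using assms(4,5) that by (auto simp: peripheral_collection_def class_representatives_def)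
  then interpret relative_cayley_graph G S Hs
    using assms(1,3) by (intro relative_cayley_graph.intro relative_cayley_graph_axioms.intro)
      (auto simp: finite_generating_set_def)
  interpret M: prob_space M using assms(8) by (simp add: iid_increments_def)
  note walk_prob = prob_right_walk[OF countable_carrier assms(8,7)]
  let ?len = "word_length G S Hs" and ?B = "borel_of_topology (top_of_set {0::real..})"
  let ?Z = "\<lambda>n w. real (?len (right_walk G X n w)) / real n"
  have hyp: "weakly_relatively_hyperbolic G S Hs" "bounded_coset_penetration G S Hs"
    using assms(6) by (simp_all add: relatively_hyperbolic_def)
  obtain F C where F: "finite F" "F \<subseteq> carrier G"
    and glue: "\<forall>g\<in>carrier G. \<forall>h\<in>carrier G. \<exists>f\<in>F. R.d \<one>\<^bsub>G\<^esub> g + R.d \<one>\<^bsub>G\<^esub> h \<le> R.d \<one>\<^bsub>G\<^esub> (g \<otimes>\<^bsub>G\<^esub> f \<otimes>\<^bsub>G\<^esub> h) + C"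
    using length_gluing[OF hyp assms(2)] .
  have adm: "\<exists>k. pmf (walk_pmf G \<mu> k) f > 0" if fc: "f \<in> carrier G" for f
  proof -
    obtain k where "measure M {w \<in> space M. right_walk G X k w = f} > 0"
      using assms(9) fc unfolding admissible_increments_def by blast
    then have "pmf (walk_pmf G \<mu> k) f > 0" by (simp only: prob_right_walk_at[OF countable_carrier assms(8,7) fc])
    then show ?thesis by blast
  qed
  obtain K C' c where sm: "super_multiplicative (\<lambda>n. map_pmf (\<lambda>g. real (?len g)) (walk_pmf G \<mu> n)) K C' c"
  proof (rule super_multiplicative_walk[OF assms(7) _ _ F, where len = ?len])
    fix g h assume gh: "g \<in> carrier G" "h \<in> carrier G"
    show "?len (g \<otimes>\<^bsub>G\<^esub> h) \<le> ?len g + ?len h"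
      using R.d_triangle[of "\<one>\<^bsub>G\<^esub>" g "g \<otimes>\<^bsub>G\<^esub> h"] R.d_translate[of "\<one>\<^bsub>G\<^esub>" h g] gh by (simp add: word_length_eq)
    obtain f where f: "f \<in> F" "R.d \<one>\<^bsub>G\<^esub> g + R.d \<one>\<^bsub>G\<^esub> h \<le> R.d \<one>\<^bsub>G\<^esub> (g \<otimes>\<^bsub>G\<^esub> f \<otimes>\<^bsub>G\<^esub> h) + C"
      using glue gh by blast
    moreover have "f \<in> carrier G" using f F(2) by blast
    ultimately show "\<exists>f\<in>F. ?len g + ?len h \<le> ?len (g \<otimes>\<^bsub>G\<^esub> f \<otimes>\<^bsub>G\<^esub> h) + C"
      using gh by (intro bexI[of _ f]) (simp_all add: word_length_eq)
  next
    fix g assume "g \<in> carrier G"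
    then show "?len (inv\<^bsub>G\<^esub> g) = ?len g" using len_inv[of g] by (simp add: word_length_eq)
  next
    fix f assume "f \<in> F"
    then show "\<exists>k. pmf (walk_pmf G \<mu> k) f > 0" using adm F(2) by blast
  qed
  define Q where "Q n = map_pmf (\<lambda>g. real (?len g)) (walk_pmf G \<mu> n)" for n
  interpret super_multiplicative Q K C' c using sm unfolding Q_def .
  have Z: "?Z n \<in> measurable M ?B" for n
    by (rule measurable_compose[OF right_walk_measurable[OF countable_carrier assms(8)]])
      (simp add: space_borel_of_topology)
  have "weak_LDP (top_of_set {0..}) (\<lambda>n. distr M ?B (?Z n)) (rate Q)"
  proof (rule weak_LDP_rate)
    show "set_pmf (Q n) \<subseteq> {0..}" for n by (auto simp: Q_def)
    show "prob_space (distr M ?B (?Z n))" for n by (rule M.prob_space_distr[OF Z])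
    fix n \<Lambda> assume "\<Lambda> \<in> sets ?B"
    then have "measure (distr M ?B (?Z n)) \<Lambda> = measure M (?Z n -` \<Lambda> \<inter> space M)"
      by (rule measure_distr[OF Z])
    also have "?Z n -` \<Lambda> \<inter> space M = {w \<in> space M. right_walk G X n w \<in> {g. real (?len g) / real n \<in> \<Lambda>}}" by auto
    also have "measure M \<dots> = measure (measure_pmf (walk_pmf G \<mu> n)) {g. real (?len g) / real n \<in> \<Lambda>}"
      by (rule walk_prob)
    also have "\<dots> = measure (measure_pmf (Q n)) {y. y / real n \<in> \<Lambda>}"
      by (simp add: Q_def vimage_def)
    finally show "measure (distr M ?B (?Z n)) \<Lambda> = measure (measure_pmf (Q n)) {y. y / real n \<in> \<Lambda>}" .
  qed simp
  then have "weak_LDP_variables (top_of_set {0..}) M ?Z (rate Q)"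
    unfolding weak_LDP_variables_def using Z by blast
  then show ?thesis using rate_convex by blast
qed

end
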